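(* Let $(Q,\nabla,\{g_1,\dots,g_m\})$ be a geodesically accessible affine connection control system and let $(x_0,v_0)\in TQ$ with $v_0\in T_{x_0}Q$. Suppose the system admits locally at $(x_0,v_0)$ a quotient mechanical system, given by a mechanical control system $(\tilde Q,\tilde\nabla,(\tilde g_0,\tilde g_1,\dots,\tilde g_m),\tilde d)$ and a quotient map $\tau:U\to V$ between neighborhoods $U$ of $(x_0,v_0)$ in $TQ$ and $V$ of $(\tilde x_0,\tilde v_0)$ in $T\tilde Q$. Then the quotient map $\tau:U\to V$ must have the form $\tau=T\Phi$ with $\Phi:U_1\to V_1$ a submersion, where $U_1$ and $V_1$ are neighborhoods of $x_0\in Q$ and $\tilde x_0\in\tilde Q$ respectively. Moreover, the quotient mechanical control system is also a geodesically accessible affine connection control system.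
   Context: Smooth means real analytic throughout; manifolds, vector fields, connections and maps are smooth. All affine connections are symmetric (torsion free). $T\Phi$ denotes the tangent map of $\Phi$. A mechanical control system $(Q,\nabla,(g_0,g_1,\dots,g_m),d)$ consists of an $n$-dimensional manifold $Q$, a symmetric affine connection $\nabla$ on $Q$, vector fields $g_0,\dots,g_m$ on $Q$, and a map $d:TQ\to TQ$ sending each fiber $T_qQ$ linearly into itself. Its trajectories satisfy $\nabla_{\dot\gamma}\dot\gamma=g_0(\gamma)+d(\dot\gamma)+\sum_{r=1}^m u_r g_r(\gamma)$, equivalently, on $TQ$, $\dot\Upsilon=S(\Upsilon)+g_0^{vlft}+d^{vlft}+\sum_r u_r g_r^{vlft}$. Here $S$ is the geodesic spray of $\nabla$, in natural coordinates $S=y^i\frac{\partial}{\partial x^i}-\Gamma^j_{kl}y^ky^l\frac{\partial}{\partial y^j}$; $X^{vlft}(v_q)=\frac{d}{dt}(v_q+tX(q))|_{t=0}$ is the vertical lift of a vector field $X$; and $d^{vlft}(v_q)=\frac{d}{dt}(v_q+t\,d(v_q))|_{t=0}$. An affine connection control system $(Q,\nabla,\{g_1,\dots,g_m\})$ is a mechanical control system with $g_0=0$ and $d=0$. The symmetric product is $\langle X:Y\rangle=\nabla_XY+\nabla_YX$. $Sym(g_1,\dots,g_m)$ is the smallest distribution containing $g_1,\dots,g_m$ and closed under the symmetric product. The system is geodesically accessible if $Sym(g_1,\dots,g_m)(x)=T_xQ$ for all $x\in Q$. Quotient map: for control-affine systems $\dot y=f_0(y)+\sum_i u_if_i(y)$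 on $M$ and $\dot z=h_0(z)+\sum_j v_jh_j(z)$ on $N$, a smooth surjective map $\psi:M\to N$ is a quotient map if it maps every trajectory of the first system to a trajectory of the second. The affine connection control system $(Q,\nabla,\{g_1,\dots,g_m\})$ admits locally at $(x_0,v_0)$ a quotient mechanical system if there exist a mechanical control system $(\tilde Q,\tilde\nabla,(\tilde g_0,\tilde g_1,\dots,\tilde g_m),\tilde d)$, a neighborhood $U$ of $(x_0,v_0)$ in $TQ$, a neighborhood $V$ of a point $(\tilde x_0,\tilde v_0)$ in $T\tilde Q$, and a quotient map $\tau:U\to V$ with $\tau_*S=\tilde S+\tilde g_0^{vlft}+\tilde d^{vlft}$ and $\tau_*g_r^{vlft}=\tilde g_r^{vlft}$ for $r=1,\dots,m$ (i.e. these vector fields are $\tau$-related), where $\tilde S$ is the geodesic spray of $\tilde\nabla$.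
   Formalization: τ = TΦ is claimed on a smaller neighborhood of (x_0,v_0), and on all of U only if U meets each fiber T_qQ in a connected set; the quotient is shown to be a geodesically accessible affine connection system on the projection of V to Q̃, not on all of Q̃. Both claims fail literally otherwise. *)

theory Defs
  imports "HOL-Analysis.Analysis"
begin

section \<open>Real analytic maps\<close>

text \<open>
  Around each point of the set, the map is the sum of a (multi-index) power series in the
  coordinates with respect to the standard basis. A multi-index is a function into the natural
  numbers that vanishes off the basis.
\<close>

definition real_analytic_on ::
    "('e::euclidean_space \<Rightarrow> 'f::real_normed_vector) \<Rightarrow> 'e set \<Rightarrow> bool" where
  "real_analytic_on f S \<longleftrightarrow>
     (\<forall>a\<in>S. \<exists>r>0. \<exists>c :: ('e \<Rightarrow> nat) \<Rightarrow> 'f. \<forall>x\<in>ball a r.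
        ((\<lambda>\<alpha>. (\<Prod>b\<in>Basis. ((x - a) \<bullet> b) ^ \<alpha> b) *\<^sub>R c \<alpha>) has_sum f x)
          {\<alpha>. \<forall>b. b \<notin> Basis \<longrightarrow> \<alpha> b = 0})"


section \<open>Manifolds\<close>

text \<open>
  An atlas is a family of charts indexed by a type; indices that are not needed have an empty
  domain. The chart map is only meaningful on the chart domain. All notions below are invariant
  under change of chart, so no maximality of the atlas is required. The point set and its topology
  are determined by the atlas.
\<close>

record ('i, 'a, 'e) atlas =
  cdom :: "'i \<Rightarrow> 'a set"
  cmap :: "'i \<Rightarrow> 'a \<Rightarrow> 'e"

definition points :: "('i, 'a, 'e) atlas \<Rightarrow> 'a set" where
  "points M = (\<Union>i. cdom M i)"

definition mtop :: "('i, 'a, 'e::euclidean_space) atlas \<Rightarrow> 'a topology" where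
  "mtop M = topology_generated_by {cdom M i \<inter> cmap M i -` W | i W. open W}"

abbreviation cinv :: "('i, 'a, 'e) atlas \<Rightarrow> 'i \<Rightarrow> 'e \<Rightarrow> 'a" where
  "cinv M i \<equiv> inv_into (cdom M i) (cmap M i)"

definition transition :: "('i, 'a, 'e) atlas \<Rightarrow> 'i \<Rightarrow> 'i \<Rightarrow> 'e \<Rightarrow> 'e" where
  "transition M i j = cmap M j \<circ> cinv M i"

definition analytic_manifold :: "('i, 'a, 'e::euclidean_space) atlas \<Rightarrow> bool" where
  "analytic_manifold M \<longleftrightarrow>
     (\<forall>i. inj_on (cmap M i) (cdom M i)) \<and>
     (\<forall>i j. open (cmap M i ` (cdom M i \<inter> cdom M j)) \<and>
            real_analytic_on (transition M i j) (cmap M i ` (cdom M i \<inter> cdom M j))) \<and>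
     Hausdorff_space (mtop M) \<and> second_countable (mtop M)"

definition submanifold :: "('i, 'a, 'e) atlas \<Rightarrow> 'a set \<Rightarrow> ('i, 'a, 'e) atlas" where
  "submanifold M W = M\<lparr>cdom := \<lambda>i. cdom M i \<inter> W\<rparr>" \<comment> \<open>used for open subsets only\<close>

definition analytic_map ::
    "('i, 'a, 'e::euclidean_space) atlas \<Rightarrow> ('j, 'b, 'f::euclidean_space) atlas \<Rightarrow> ('a \<Rightarrow> 'b) \<Rightarrow> bool" where
  "analytic_map M N f \<longleftrightarrow>
     continuous_map (mtop M) (mtop N) f \<and>
     (\<forall>i j. real_analytic_on (cmap N j \<circ> f \<circ> cinv M i)
              (cmap M i ` (cdom M i \<inter> f -` cdom N j)))"


section \<open>Tangent vectors\<close>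

text \<open>
  A tangent vector at a point is represented by the family of its components in all the charts
  around that point, related to each other by the derivatives of the transition maps; components
  in the other charts are set to zero. Hence the vector space operations are taken componentwise,
  and the tangent bundle is a manifold modelled on the product of the model space with itself,
  with charts indexed by the same type. The construction can be iterated.
\<close>

definition tangent_space :: "('i, 'a, 'e::euclidean_space) atlas \<Rightarrow> 'a \<Rightarrow> ('i \<Rightarrow> 'e) set" where
  "tangent_space M q =
     {v. (\<forall>i. q \<notin> cdom M i \<longrightarrow> v i = 0) \<and>
         (\<forall>i j. q \<in> cdom M i \<inter> cdom M j \<longrightarrow>
            v j = frechet_derivative (transition M i j) (at (cmap M i q)) (v i))}"

definition tangent_bundle ::
    "('i, 'a, 'e::euclidean_space) atlas \<Rightarrow> ('i, 'a \<times> ('i \<Rightarrow> 'e), 'e \<times> 'e) atlas" where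
  "tangent_bundle M =
     \<lparr>cdom = (\<lambda>i. {(q, v). q \<in> cdom M i \<and> v \<in> tangent_space M q}),
      cmap = (\<lambda>i (q, v). (cmap M i q, v i))\<rparr>"

text \<open>
  For a differentiable map, the following does not depend on the chart that is chosen around the
  base point.
\<close>

definition tangent_map ::
    "('i, 'a, 'e::euclidean_space) atlas \<Rightarrow> ('j, 'b, 'f::euclidean_space) atlas \<Rightarrow> ('a \<Rightarrow> 'b)
     \<Rightarrow> 'a \<times> ('i \<Rightarrow> 'e) \<Rightarrow> 'b \<times> ('j \<Rightarrow> 'f)" where
  "tangent_map M N f = (\<lambda>(q, v).
     (f q,
      \<lambda>j. if f q \<in> cdom N j
          then let i = (SOME i. q \<in> cdom M i)
               in frechet_derivative (cmap N j \<circ> f \<circ> cinv M i) (at (cmap M i q)) (v i)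
          else 0))"

definition submersion ::
    "('i, 'a, 'e::euclidean_space) atlas \<Rightarrow> ('j, 'b, 'f::euclidean_space) atlas \<Rightarrow> ('a \<Rightarrow> 'b) \<Rightarrow> bool" where
  "submersion M N f \<longleftrightarrow> analytic_map M N f \<and>
     (\<forall>q\<in>points M. (\<lambda>v. snd (tangent_map M N f (q, v))) ` tangent_space M q
                     = tangent_space N (f q))"

definition velocity ::
    "('i, 'a, 'e::euclidean_space) atlas \<Rightarrow> (real \<Rightarrow> 'a) \<Rightarrow> real \<Rightarrow> ('i \<Rightarrow> 'e)" where
  "velocity M \<gamma> t =
     (\<lambda>i. if \<gamma> t \<in> cdom M i then vector_derivative (cmap M i \<circ> \<gamma>) (at t) else 0)"

definition analytic_function :: "('i, 'a, 'e::euclidean_space) atlas \<Rightarrow> ('a \<Rightarrow> real) \<Rightarrow> bool" where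
  "analytic_function M f \<longleftrightarrow> (\<forall>i. real_analytic_on (f \<circ> cinv M i) (cmap M i ` cdom M i))"

text \<open>Values of a vector field outside the manifold are irrelevant.\<close>

definition vector_field ::
    "('i, 'a, 'e::euclidean_space) atlas \<Rightarrow> ('a \<Rightarrow> 'i \<Rightarrow> 'e) \<Rightarrow> bool" where
  "vector_field M X \<longleftrightarrow>
     (\<forall>q\<in>points M. X q \<in> tangent_space M q) \<and>
     (\<forall>i. real_analytic_on (\<lambda>x. X (cinv M i x) i) (cmap M i ` cdom M i))"

definition related ::
    "('i, 'a, 'e::euclidean_space) atlas \<Rightarrow> ('j, 'b, 'f::euclidean_space) atlas \<Rightarrow> ('a \<Rightarrow> 'b)
     \<Rightarrow> ('a \<Rightarrow> 'i \<Rightarrow> 'e) \<Rightarrow> ('b \<Rightarrow> 'j \<Rightarrow> 'f) \<Rightarrow> bool" where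
  "related M N \<tau> X Y \<longleftrightarrow> (\<forall>p\<in>points M. tangent_map M N \<tau> (p, X p) = (\<tau> p, Y (\<tau> p)))"


section \<open>Affine connections\<close>

text \<open>
  A torsion free affine connection is given by its Christoffel symbols in all charts: if
  \<open>e\<^sub>1, \<dots>, e\<^sub>n\<close> is the standard basis, then the \<open>j\<close>-th component of \<open>\<Gamma> i q e\<^sub>k e\<^sub>l\<close> is the
  classical symbol with upper index \<open>j\<close> and lower indices \<open>k\<close>, \<open>l\<close> in the chart \<open>i\<close> at the
  point \<open>q\<close>. The last condition is the classical transformation law
  \<open>Dh (\<Gamma>\<^sub>i(v, w)) = D\<^sup>2h (v, w) + \<Gamma>\<^sub>j(Dh v, Dh w)\<close> under the change of coordinates \<open>h\<close>.
\<close>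

definition symmetric_connection ::
    "('i, 'a, 'e::euclidean_space) atlas \<Rightarrow> ('i \<Rightarrow> 'a \<Rightarrow> 'e \<Rightarrow> 'e \<Rightarrow> 'e) \<Rightarrow> bool" where
  "symmetric_connection M \<Gamma> \<longleftrightarrow>
     (\<forall>i. \<forall>q\<in>cdom M i. bilinear (\<Gamma> i q) \<and> (\<forall>v w. \<Gamma> i q v w = \<Gamma> i q w v)) \<and>
     (\<forall>i v w. real_analytic_on (\<lambda>x. \<Gamma> i (cinv M i x) v w) (cmap M i ` cdom M i)) \<and>
     (\<forall>i j. \<forall>q\<in>cdom M i \<inter> cdom M j. \<forall>v w.
        let h = transition M i j; x = cmap M i q; Dh = (\<lambda>z. frechet_derivative h (at z))
        in Dh x (\<Gamma> i q v w) =
             frechet_derivative (\<lambda>z. Dh z w) (at x) v + \<Gamma> j q (Dh x v) (Dh x w))"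

definition cov_deriv ::
    "('i, 'a, 'e::euclidean_space) atlas \<Rightarrow> ('i \<Rightarrow> 'a \<Rightarrow> 'e \<Rightarrow> 'e \<Rightarrow> 'e)
     \<Rightarrow> ('a \<Rightarrow> 'i \<Rightarrow> 'e) \<Rightarrow> ('a \<Rightarrow> 'i \<Rightarrow> 'e) \<Rightarrow> ('a \<Rightarrow> 'i \<Rightarrow> 'e)" where
  "cov_deriv M \<Gamma> X Y = (\<lambda>q i.
     if q \<in> cdom M i
     then frechet_derivative (\<lambda>x. Y (cinv M i x) i) (at (cmap M i q)) (X q i) + \<Gamma> i q (X q i) (Y q i)
     else 0)"

definition sym_prod ::
    "('i, 'a, 'e::euclidean_space) atlas \<Rightarrow> ('i \<Rightarrow> 'a \<Rightarrow> 'e \<Rightarrow> 'e \<Rightarrow> 'e)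
     \<Rightarrow> ('a \<Rightarrow> 'i \<Rightarrow> 'e) \<Rightarrow> ('a \<Rightarrow> 'i \<Rightarrow> 'e) \<Rightarrow> ('a \<Rightarrow> 'i \<Rightarrow> 'e)" where
  "sym_prod M \<Gamma> X Y = (\<lambda>q i. cov_deriv M \<Gamma> X Y q i + cov_deriv M \<Gamma> Y X q i)"

definition spray ::
    "('i, 'a, 'e::euclidean_space) atlas \<Rightarrow> ('i \<Rightarrow> 'a \<Rightarrow> 'e \<Rightarrow> 'e \<Rightarrow> 'e)
     \<Rightarrow> ('a \<times> ('i \<Rightarrow> 'e) \<Rightarrow> 'i \<Rightarrow> 'e \<times> 'e)" where
  "spray M \<Gamma> = (\<lambda>(q, v) i. if q \<in> cdom M i then (v i, - \<Gamma> i q (v i) (v i)) else 0)"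

definition vlft ::
    "('i, 'a, 'e::euclidean_space) atlas \<Rightarrow> ('a \<Rightarrow> 'i \<Rightarrow> 'e)
     \<Rightarrow> ('a \<times> ('i \<Rightarrow> 'e) \<Rightarrow> 'i \<Rightarrow> 'e \<times> 'e)" where
  "vlft M X = (\<lambda>(q, v). velocity (tangent_bundle M) (\<lambda>t. (q, \<lambda>i. v i + t *\<^sub>R X q i)) 0)"

definition fiber_vlft ::
    "('i, 'a, 'e::euclidean_space) atlas \<Rightarrow> ('a \<times> ('i \<Rightarrow> 'e) \<Rightarrow> 'a \<times> ('i \<Rightarrow> 'e))
     \<Rightarrow> ('a \<times> ('i \<Rightarrow> 'e) \<Rightarrow> 'i \<Rightarrow> 'e \<times> 'e)" where
  "fiber_vlft M d =
     (\<lambda>(q, v). velocity (tangent_bundle M) (\<lambda>t. (q, \<lambda>i. v i + t *\<^sub>R snd (d (q, v)) i)) 0)"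

text \<open>
  A distribution is a module of analytic vector fields over the ring of analytic functions (its
  rank may vary); its value at a point consists of the values of its members.
\<close>

definition distribution ::
    "('i, 'a, 'e::euclidean_space) atlas \<Rightarrow> ('a \<Rightarrow> 'i \<Rightarrow> 'e) set \<Rightarrow> bool" where
  "distribution M D \<longleftrightarrow>
     (\<forall>X\<in>D. vector_field M X) \<and>
     (\<lambda>q i. 0) \<in> D \<and>
     (\<forall>X\<in>D. \<forall>Y\<in>D. (\<lambda>q i. X q i + Y q i) \<in> D) \<and>
     (\<forall>f X. analytic_function M f \<and> X \<in> D \<longrightarrow> (\<lambda>q i. f q *\<^sub>R X q i) \<in> D)"

definition Sym ::
    "('i, 'a, 'e::euclidean_space) atlas \<Rightarrow> ('i \<Rightarrow> 'a \<Rightarrow> 'e \<Rightarrow> 'e \<Rightarrow> 'e)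
     \<Rightarrow> ('a \<Rightarrow> 'i \<Rightarrow> 'e) set \<Rightarrow> ('a \<Rightarrow> 'i \<Rightarrow> 'e) set" where
  "Sym M \<Gamma> G = \<Inter>{D. distribution M D \<and> G \<subseteq> D \<and> (\<forall>X\<in>D. \<forall>Y\<in>D. sym_prod M \<Gamma> X Y \<in> D)}"


section \<open>Control systems\<close>

text \<open>
  A control-affine system consists of a manifold, the number \<open>m\<close> of inputs, the drift \<open>f 0\<close> and
  the control vector fields \<open>f 1, \<dots>, f m\<close>. Trajectories are differentiable curves on open
  intervals.
\<close>

definition trajectory ::
    "('i, 'a, 'e::euclidean_space) atlas \<Rightarrow> nat \<Rightarrow> (nat \<Rightarrow> 'a \<Rightarrow> 'i \<Rightarrow> 'e)
     \<Rightarrow> real set \<Rightarrow> (real \<Rightarrow> 'a) \<Rightarrow> bool" where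
  "trajectory M m f T \<gamma> \<longleftrightarrow>
     open T \<and> is_interval T \<and> continuous_map (top_of_set T) (mtop M) \<gamma> \<and>
     (\<exists>u :: real \<Rightarrow> nat \<Rightarrow> real. \<forall>t\<in>T. \<forall>i. \<gamma> t \<in> cdom M i \<longrightarrow>
        ((cmap M i \<circ> \<gamma>) has_vector_derivative
           (f 0 (\<gamma> t) i + (\<Sum>r=1..m. u t r *\<^sub>R f r (\<gamma> t) i))) (at t))"

definition quotient_map_of ::
    "('i, 'a, 'e::euclidean_space) atlas \<Rightarrow> nat \<Rightarrow> (nat \<Rightarrow> 'a \<Rightarrow> 'i \<Rightarrow> 'e)
     \<Rightarrow> ('j, 'b, 'f::euclidean_space) atlas \<Rightarrow> nat \<Rightarrow> (nat \<Rightarrow> 'b \<Rightarrow> 'j \<Rightarrow> 'f)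
     \<Rightarrow> ('a \<Rightarrow> 'b) \<Rightarrow> bool" where
  "quotient_map_of M m f N l h \<psi> \<longleftrightarrow>
     analytic_map M N \<psi> \<and> \<psi> ` points M = points N \<and>
     (\<forall>T \<gamma>. trajectory M m f T \<gamma> \<longrightarrow> trajectory N l h T (\<psi> \<circ> \<gamma>))"

record ('i, 'a, 'e) mechanical_data =
  base :: "('i, 'a, 'e) atlas"
  conn :: "'i \<Rightarrow> 'a \<Rightarrow> 'e \<Rightarrow> 'e \<Rightarrow> 'e"
  inputs :: nat
  field :: "nat \<Rightarrow> 'a \<Rightarrow> 'i \<Rightarrow> 'e"
  fibermap :: "'a \<times> ('i \<Rightarrow> 'e) \<Rightarrow> 'a \<times> ('i \<Rightarrow> 'e)"

abbreviation TQ ::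
    "('i, 'a, 'e::euclidean_space) mechanical_data \<Rightarrow> ('i, 'a \<times> ('i \<Rightarrow> 'e), 'e \<times> 'e) atlas" where
  "TQ \<Sigma> \<equiv> tangent_bundle (base \<Sigma>)"

definition fiberwise_linear ::
    "('i, 'a, 'e::euclidean_space) atlas \<Rightarrow> ('a \<times> ('i \<Rightarrow> 'e) \<Rightarrow> 'a \<times> ('i \<Rightarrow> 'e)) \<Rightarrow> bool" where
  "fiberwise_linear M d \<longleftrightarrow>
     (\<forall>q\<in>points M. \<forall>v\<in>tangent_space M q.
        fst (d (q, v)) = q \<and> snd (d (q, v)) \<in> tangent_space M q) \<and>
     (\<forall>q\<in>points M. \<forall>v\<in>tangent_space M q. \<forall>w\<in>tangent_space M q. \<forall>a b i.
        snd (d (q, \<lambda>i. a *\<^sub>R v i + b *\<^sub>R w i)) i = a *\<^sub>R snd (d (q, v)) i + b *\<^sub>R snd (d (q, w)) i)"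

definition mechanical_control_system ::
    "('i, 'a, 'e::euclidean_space) mechanical_data \<Rightarrow> bool" where
  "mechanical_control_system \<Sigma> \<longleftrightarrow>
     analytic_manifold (base \<Sigma>) \<and>
     symmetric_connection (base \<Sigma>) (conn \<Sigma>) \<and>
     (\<forall>r\<in>{0..inputs \<Sigma>}. vector_field (base \<Sigma>) (field \<Sigma> r)) \<and>
     analytic_map (TQ \<Sigma>) (TQ \<Sigma>) (fibermap \<Sigma>) \<and>
     fiberwise_linear (base \<Sigma>) (fibermap \<Sigma>)"

definition affine_connection_control_system ::
    "('i, 'a, 'e::euclidean_space) mechanical_data \<Rightarrow> bool" where
  "affine_connection_control_system \<Sigma> \<longleftrightarrow>
     mechanical_control_system \<Sigma> \<and>
     (\<forall>q\<in>points (base \<Sigma>). field \<Sigma> 0 q = (\<lambda>i. 0)) \<and>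
     (\<forall>q\<in>points (base \<Sigma>). \<forall>v\<in>tangent_space (base \<Sigma>) q. fibermap \<Sigma> (q, v) = (q, \<lambda>i. 0))"

definition geodesically_accessible ::
    "('i, 'a, 'e::euclidean_space) mechanical_data \<Rightarrow> bool" where
  "geodesically_accessible \<Sigma> \<longleftrightarrow>
     (\<forall>x\<in>points (base \<Sigma>).
        (\<lambda>X. X x) ` Sym (base \<Sigma>) (conn \<Sigma>) (field \<Sigma> ` {1..inputs \<Sigma>}) = tangent_space (base \<Sigma>) x)"

definition restrict_system ::
    "('i, 'a, 'e::euclidean_space) mechanical_data \<Rightarrow> 'a set \<Rightarrow> ('i, 'a, 'e) mechanical_data" where
  "restrict_system \<Sigma> W = \<Sigma>\<lparr>base := submanifold (base \<Sigma>) W\<rparr>"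

definition drift ::
    "('i, 'a, 'e::euclidean_space) mechanical_data \<Rightarrow> 'a \<times> ('i \<Rightarrow> 'e) \<Rightarrow> 'i \<Rightarrow> 'e \<times> 'e" where
  "drift \<Sigma> = (\<lambda>p i. spray (base \<Sigma>) (conn \<Sigma>) p i
                   + vlft (base \<Sigma>) (field \<Sigma> 0) p i
                   + fiber_vlft (base \<Sigma>) (fibermap \<Sigma>) p i)"

definition lifted_fields ::
    "('i, 'a, 'e::euclidean_space) mechanical_data \<Rightarrow> nat \<Rightarrow> 'a \<times> ('i \<Rightarrow> 'e) \<Rightarrow> 'i \<Rightarrow> 'e \<times> 'e" where
  "lifted_fields \<Sigma> r = (if r = 0 then drift \<Sigma> else vlft (base \<Sigma>) (field \<Sigma> r))"

definition local_quotient ::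
    "('i, 'a, 'e::euclidean_space) mechanical_data \<Rightarrow> 'a \<times> ('i \<Rightarrow> 'e)
     \<Rightarrow> ('j, 'b, 'f::euclidean_space) mechanical_data \<Rightarrow> 'b \<times> ('j \<Rightarrow> 'f)
     \<Rightarrow> ('a \<times> ('i \<Rightarrow> 'e)) set \<Rightarrow> ('b \<times> ('j \<Rightarrow> 'f)) set
     \<Rightarrow> ('a \<times> ('i \<Rightarrow> 'e) \<Rightarrow> 'b \<times> ('j \<Rightarrow> 'f)) \<Rightarrow> bool" where
  "local_quotient \<Sigma> p\<^sub>0 \<Sigma>' p\<^sub>0' U V \<tau> \<longleftrightarrow>
     mechanical_control_system \<Sigma>' \<and> inputs \<Sigma>' = inputs \<Sigma> \<and>
     openin (mtop (TQ \<Sigma>)) U \<and> p\<^sub>0 \<in> U \<and>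
     openin (mtop (TQ \<Sigma>')) V \<and> p\<^sub>0' \<in> V \<and>
     quotient_map_of (submanifold (TQ \<Sigma>) U) (inputs \<Sigma>) (lifted_fields \<Sigma>)
                     (submanifold (TQ \<Sigma>') V) (inputs \<Sigma>') (lifted_fields \<Sigma>') \<tau> \<and>
     related (submanifold (TQ \<Sigma>) U) (submanifold (TQ \<Sigma>') V) \<tau>
             (spray (base \<Sigma>) (conn \<Sigma>)) (drift \<Sigma>') \<and>
     (\<forall>r\<in>{1..inputs \<Sigma>}.
        related (submanifold (TQ \<Sigma>) U) (submanifold (TQ \<Sigma>') V) \<tau>
                (vlft (base \<Sigma>) (field \<Sigma> r)) (vlft (base \<Sigma>') (field \<Sigma>' r)))"

definition connected_fibers ::
    "('i, 'a, 'e::euclidean_space) atlas \<Rightarrow> ('a \<times> ('i \<Rightarrow> 'e)) set \<Rightarrow> bool" where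
  "connected_fibers M U \<longleftrightarrow>
     (\<forall>q\<in>points M. connectedin (mtop (tangent_bundle M)) {p \<in> U. fst p = q})"

text \<open>
  On \<open>U\<close>, the map \<open>\<tau>\<close> is the tangent map of a submersion from an open set \<open>U\<^sub>1\<close>, the projection of
  \<open>U\<close>, into an open set \<open>V\<^sub>1\<close>.
\<close>

definition is_tangent_map_of_submersion ::
    "('i, 'a, 'e::euclidean_space) atlas \<Rightarrow> ('j, 'b, 'f::euclidean_space) atlas
     \<Rightarrow> ('a \<times> ('i \<Rightarrow> 'e)) set \<Rightarrow> 'a set \<Rightarrow> 'b set
     \<Rightarrow> ('a \<times> ('i \<Rightarrow> 'e) \<Rightarrow> 'b \<times> ('j \<Rightarrow> 'f)) \<Rightarrow> bool" where
  "is_tangent_map_of_submersion M N U U\<^sub>1 V\<^sub>1 \<tau> \<longleftrightarrow>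
     openin (mtop M) U\<^sub>1 \<and> openin (mtop N) V\<^sub>1 \<and> fst ` U = U\<^sub>1 \<and>
     (\<exists>\<Phi>. submersion (submanifold M U\<^sub>1) (submanifold N V\<^sub>1) \<Phi> \<and>
          (\<forall>p\<in>U. \<tau> p = tangent_map (submanifold M U\<^sub>1) (submanifold N V\<^sub>1) \<Phi> p))"

end

theory Submission
  imports Defs
begin

text \<open>
  If two vertical lifts \<open>X\<^sup>v\<close>, \<open>Y\<^sup>v\<close> and the drift are \<open>\<tau>\<close>-related to \<open>X'\<^sup>v\<close>, \<open>Y'\<^sup>v\<close> and the drift of
  the quotient, then so are their brackets; since \<open>[Y\<^sup>v, [S, X\<^sup>v]] = \<langle>X : Y\<rangle>\<^sup>v\<close>, also with forces
  \<open>g\<^sub>0\<close> and \<open>d\<close> added to \<open>S\<close>, all iterated symmetric products of the inputs have related vertical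
  lifts. By accessibility these lifts span the vertical spaces, so the tangent map of \<open>\<tau>\<close> preserves
  vertical vectors and the base component of \<open>\<tau>\<close> is locally a function \<open>\<Phi>\<close> of the base point. The base
  component of the spray relation then reads \<open>\<tau> = T\<Phi>\<close>. Its fibre component is a polynomial identity of
  degree two in the velocity, whose terms of degree zero and one say that the forces of the quotient
  vanish. Finally, every vector of the open set \<open>V\<close> lies in the image of \<open>T\<Phi>\<close>, which is the span of the
  iterated symmetric products of the quotient inputs; a subspace with interior points is everything.
\<close>

section \<open>Power series in several variables\<close>

text \<open>Relatedness of vertical lifts survives brackets but not multiplication by functions on
  \<open>Q\<close>, since these need not descend to the quotient. Hence fields are matched only
  along iterated products of the inputs, and \<open>Sym\<close> enters pointwise, through the linear
  span of their values. That \<tau> preserves vertical vectors makes its base component only locally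
  constant along the fibres of \<open>U\<close>; a fibre with several components could be sent over
  several base points. So the tangent form is obtained near the given point in general, and on all
  of \<open>U\<close> when its fibres are connected. The quotient is visible only over the
  projection of \<open>V\<close>, hence the restriction of \<open>\<Sigma>'\<close> to it. Power
  series are never composed: the chart expression of \<tau> is analytic by assumption, \<Phi> is
  locally a slice of it at a fixed velocity, and the other analytic maps arise from sums, products,
  linear images, derivatives and slices.\<close>

lemma has_derivative_has_sum:
  fixes F :: "'i \<Rightarrow> 'a::real_normed_vector \<Rightarrow> 'b::banach"
  assumes A: "countable A" "infinite A" and S: "convex S" "open S"
    and D: "\<And>i x. i \<in> A \<Longrightarrow> x \<in> S \<Longrightarrow> (F i has_derivative F' i x) (at x)"
    and bd: "\<And>i x h. i \<in> A \<Longrightarrow> x \<in> S \<Longrightarrow> norm (F' i x h) \<le> K i * norm h"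
    and K0: "\<And>i. i \<in> A \<Longrightarrow> 0 \<le> K i" and K: "K summable_on A"
    and f: "\<And>x. x \<in> S \<Longrightarrow> ((\<lambda>i. F i x) has_sum f x) A"
    and x: "x \<in> S"
  shows "(f has_derivative (\<lambda>h. infsum (\<lambda>i. F' i x h) A)) (at x)"
    and "((\<lambda>i. F' i x h) has_sum infsum (\<lambda>i. F' i x h) A) A"
proof -
  \<comment> \<open>An enumeration of the index set turns the unordered sums into ordinary series,
    so that differentiation of series under uniform convergence applies.\<close>
  obtain e :: "nat \<Rightarrow> 'i" where e: "bij_betw e UNIV A"
    using countableE_infinite[OF A] bij_betw_inv_into by metis
  have eA: "e n \<in> A" for n using e by (auto simp: bij_betw_def)
  have hs: "((\<lambda>i. F' i x h) has_sum infsum (\<lambda>i. F' i x h) A) A" if "x \<in> S" for x h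
  proof (rule has_sum_infsum, rule Infinite_Sum.abs_summable_summable,
      rule Infinite_Sum.abs_summable_on_comparison_test[where g = "\<lambda>i. K i * norm h"])
    show "(\<lambda>i. norm (K i * norm h)) summable_on A"
      by (rule iffD1[OF summable_on_iff_abs_summable_on_real]) (rule summable_on_cmult_left[OF K])
    show "norm (F' i x h) \<le> norm (K i * norm h)" if "i \<in> A" for i
      using bd[OF that \<open>x \<in> S\<close>, of h] K0[OF that] by simp
  qed
  show "((\<lambda>i. F' i x h) has_sum infsum (\<lambda>i. F' i x h) A) A" by (rule hs[OF x])
  have sumsF': "(\<lambda>n. F' (e n) x h) sums infsum (\<lambda>i. F' i x h) A" if "x \<in> S" for x h
    using iffD2[OF has_sum_reindex_bij_betw[OF e, of "\<lambda>i. F' i x h"] hs[OF that]] by (rule has_sum_imp_sums)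
  have sumsF: "(\<lambda>n. F (e n) x) sums f x" if "x \<in> S" for x
    using iffD2[OF has_sum_reindex_bij_betw[OF e, of "\<lambda>i. F i x"] f[OF that]] by (rule has_sum_imp_sums)
  have sK: "summable (\<lambda>n. K (e n))"
    using iffD2[OF summable_on_reindex_bij_betw[OF e, of K] K] by (rule summable_on_imp_summable)
  \<comment> \<open>Weierstrass M-test: the tail of the \<open>K\<close>-series bounds the remainder
    for all points and directions at once.\<close>
  have unif: "\<forall>\<^sub>F n in sequentially. \<forall>x\<in>S. \<forall>h.
      norm (sum (\<lambda>i. F' (e i) x h) {..<n} - infsum (\<lambda>i. F' i x h) A) \<le> \<epsilon> * norm h" if "\<epsilon> > 0" for \<epsilon>
  proof -
    obtain N where N: "\<And>n. n \<ge> N \<Longrightarrow> norm (\<Sum>i. K (e (i + n))) < \<epsilon>"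
      using suminf_exist_split[OF \<open>\<epsilon> > 0\<close> sK] by blast
    have "norm (sum (\<lambda>i. F' (e i) x h) {..<n} - infsum (\<lambda>i. F' i x h) A) \<le> \<epsilon> * norm h"
      if "n \<ge> N" "x \<in> S" for n x h
    proof -
      let ?g = "\<lambda>i. F' (e i) x h"
      have sg: "summable ?g" using sumsF'[OF that(2)] by (rule sums_summable)
      have "infsum (\<lambda>i. F' i x h) A - sum ?g {..<n} = (\<Sum>i. ?g (i + n))"
        using suminf_split_initial_segment[OF sg, of n] sums_unique[OF sumsF'[OF that(2)], of h] by simp
      moreover have "norm (\<Sum>i. ?g (i + n)) \<le> (\<Sum>i. K (e (i + n)) * norm h)"
      proof -
        have s2: "summable (\<lambda>i. K (e (i + n)) * norm h)"
          by (intro summable_mult2 summable_ignore_initial_segment[OF sK])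
        have b: "norm (?g (i + n)) \<le> K (e (i + n)) * norm h" for i using bd[OF eA that(2)] .
        have s1: "summable (\<lambda>i. norm (?g (i + n)))"
          by (rule summable_comparison_test'[OF s2]) (use b in auto)
        show ?thesis using summable_norm[OF s1] suminf_le[OF b s1 s2] by linarith
      qed
      moreover have "(\<Sum>i. K (e (i + n)) * norm h) = (\<Sum>i. K (e (i + n))) * norm h"
        by (rule suminf_mult2[symmetric], rule summable_ignore_initial_segment[OF sK])
      moreover have "(\<Sum>i. K (e (i + n))) * norm h \<le> \<epsilon> * norm h"
        using N[OF that(1)] by (intro mult_right_mono) auto
      ultimately show ?thesis by (simp add: norm_minus_commute)
    qed
    then show ?thesis unfolding eventually_sequentially by blast
  qed
  have DS: "((\<lambda>x. F (e n) x) has_derivative F' (e n) x) (at x within S)" if "x \<in> S" for n x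
    using D[OF eA that] by (rule has_derivative_at_withinI)
  obtain g where g: "\<And>x. x \<in> S \<Longrightarrow> (\<lambda>n. F (e n) x) sums g x"
      "\<And>x. x \<in> S \<Longrightarrow> (g has_derivative (\<lambda>h. infsum (\<lambda>i. F' i x h) A)) (at x within S)"
    using has_derivative_series[where f = "\<lambda>n. F (e n)" and f' = "\<lambda>n. F' (e n)"
        and g' = "\<lambda>x h. infsum (\<lambda>i. F' i x h) A", OF S(1) DS unif x sumsF[OF x]] by blast
  have fg: "f y = g y" if "y \<in> S" for y
    using sums_unique2[OF sumsF g(1)] that by blast
  have "(f has_derivative (\<lambda>h. infsum (\<lambda>i. F' i x h) A)) (at x within S)"
    by (rule has_derivative_transform[OF x fg g(2)[OF x]])
  then show "(f has_derivative (\<lambda>h. infsum (\<lambda>i. F' i x h) A)) (at x)"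
    using at_within_open[OF x S(2)] by simp
qed

section \<open>Multi-indices, monomials and absolute convergence\<close>

definition multi_indices :: "('e::euclidean_space \<Rightarrow> nat) set" where
  "multi_indices = {\<alpha>. \<forall>b. b \<notin> Basis \<longrightarrow> \<alpha> b = 0}"

definition mpow :: "'e::euclidean_space \<Rightarrow> ('e \<Rightarrow> nat) \<Rightarrow> real" where
  "mpow x \<alpha> = (\<Prod>b\<in>Basis. (x \<bullet> b) ^ \<alpha> b)"

definition mdeg :: "('e::euclidean_space \<Rightarrow> nat) \<Rightarrow> nat" where
  "mdeg \<alpha> = sum \<alpha> Basis"

text \<open>Coefficients and radius are explicit, unlike in \<open>real_analytic_on\<close>, so that
  derivatives can be followed on the coefficients.\<close>

definition power_series_on ::
    "(('e::euclidean_space \<Rightarrow> nat) \<Rightarrow> 'f::real_normed_vector) \<Rightarrow> 'e \<Rightarrow> real \<Rightarrow> ('e \<Rightarrow> 'f) \<Rightarrow> bool" where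
  "power_series_on c a r f \<longleftrightarrow>
     (\<forall>x\<in>ball a r. ((\<lambda>\<alpha>. mpow (x - a) \<alpha> *\<^sub>R c \<alpha>) has_sum f x) multi_indices)"

lemma real_analytic_on_alt:
  "real_analytic_on f S \<longleftrightarrow> (\<forall>a\<in>S. \<exists>r>0. \<exists>c. power_series_on c a r f)"
  unfolding real_analytic_on_def power_series_on_def multi_indices_def mpow_def by blast

lemma power_series_on_mono: "power_series_on c a r f \<Longrightarrow> s \<le> r \<Longrightarrow> power_series_on c a s f"
  by (auto simp: power_series_on_def)

lemma power_series_on_cong:
  "power_series_on c a r f \<Longrightarrow> (\<And>x. x \<in> ball a r \<Longrightarrow> f x = g x) \<Longrightarrow> power_series_on c a r g"
  unfolding power_series_on_def by simp

lemma countable_multi_indices: "countable (multi_indices :: ('e::euclidean_space \<Rightarrow> nat) set)"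
proof -
  let ?g = "\<lambda>(f :: 'e \<Rightarrow> nat) b. if b \<in> Basis then f b else 0"
  have "countable (Pi\<^sub>E (Basis :: 'e set) (\<lambda>_. UNIV :: nat set))"
    by (intro countable_PiE) auto
  moreover have "multi_indices \<subseteq> ?g ` Pi\<^sub>E (Basis :: 'e set) (\<lambda>_. UNIV :: nat set)"
  proof
    fix \<alpha> :: "'e \<Rightarrow> nat" assume "\<alpha> \<in> multi_indices"
    then have "\<alpha> = ?g (restrict \<alpha> Basis)" by (auto simp: multi_indices_def fun_eq_iff)
    moreover have "restrict \<alpha> Basis \<in> Pi\<^sub>E (Basis :: 'e set) (\<lambda>_. UNIV :: nat set)" by simp
    ultimately show "\<alpha> \<in> ?g ` Pi\<^sub>E (Basis :: 'e set) (\<lambda>_. UNIV :: nat set)" by (rule image_eqI)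
  qed
  ultimately show ?thesis by (meson countable_image countable_subset)
qed

lemma infinite_multi_indices: "infinite (multi_indices :: ('e::euclidean_space \<Rightarrow> nat) set)"
proof -
  obtain b :: 'e where b: "b \<in> Basis" using nonempty_Basis by blast
  let ?h = "\<lambda>n::nat. (\<lambda>x. if x = b then n else 0)"
  have "inj ?h" by (auto simp: inj_def fun_eq_iff dest: spec[of _ b])
  moreover have "range ?h \<subseteq> multi_indices" using b by (auto simp: multi_indices_def)
  ultimately show ?thesis using infinite_super range_inj_infinite by blast
qed

lemma abs_mpow_le: "\<bar>mpow x \<alpha>\<bar> \<le> norm x ^ mdeg \<alpha>"
proof -
  have "\<bar>mpow x \<alpha>\<bar> = (\<Prod>b\<in>Basis. \<bar>x \<bullet> b\<bar> ^ \<alpha> b)" by (simp add: mpow_def abs_prod power_abs)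
  also have "\<dots> \<le> (\<Prod>b\<in>Basis. norm x ^ \<alpha> b)"
    by (intro prod_mono conjI power_mono Basis_le_norm) auto
  also have "\<dots> = norm x ^ mdeg \<alpha>" by (simp add: mdeg_def power_sum)
  finally show ?thesis .
qed

lemma mpow_0:
  assumes "\<alpha> \<in> multi_indices" "\<alpha> \<noteq> (\<lambda>_. 0)"
  shows "mpow 0 \<alpha> = 0"
proof -
  obtain b where b: "\<alpha> b \<noteq> 0" using assms(2) by auto
  then have "b \<in> Basis" using assms(1) by (auto simp: multi_indices_def)
  then show ?thesis using b by (auto simp: mpow_def intro!: bexI[of _ b])
qed

text \<open>All monomials except the constant one vanish at the centre. This later reads second
  derivatives off the coefficients.\<close>

lemma power_series_on_centre:
  assumes "power_series_on c a r f" "r > 0"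
  shows "f a = c (\<lambda>_. 0)"
proof -
  have "((\<lambda>\<alpha>. mpow (a - a) \<alpha> *\<^sub>R c \<alpha>) has_sum f a) multi_indices"
    using assms unfolding power_series_on_def by (meson centre_in_ball)
  moreover have "((\<lambda>\<alpha>. mpow (a - a) \<alpha> *\<^sub>R c \<alpha>) has_sum c (\<lambda>_. 0)) multi_indices
      \<longleftrightarrow> ((\<lambda>\<alpha>. c \<alpha>) has_sum c (\<lambda>_. 0)) {\<lambda>_. 0}"
    by (rule has_sum_cong_neutral) (auto simp: mpow_0, auto simp: multi_indices_def mpow_def)
  ultimately show ?thesis using has_sum_unique has_sum_finite[of "{\<lambda>_. 0}" c] by fastforce
qed

lemma summable_on_sum:
  fixes f :: "'j \<Rightarrow> 'i \<Rightarrow> 'a::{topological_comm_monoid_add,t2_space}"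
  assumes "\<And>j. j \<in> J \<Longrightarrow> f j summable_on A"
  shows "(\<lambda>i. \<Sum>j\<in>J. f j i) summable_on A"
  using assms by (induction J rule: infinite_finite_induct) (auto intro: summable_on_add)

text \<open>For real families unconditional and absolute summability coincide; finitely many
  coordinates carry this over, because the sum of their absolute values dominates the norm.\<close>

lemma abs_summable_on_euclidean:
  fixes f :: "'i \<Rightarrow> 'f::euclidean_space"
  assumes "f summable_on A"
  shows "(\<lambda>x. norm (f x)) summable_on A"
proof -
  have "(\<lambda>i. \<Sum>b\<in>Basis. \<bar>f i \<bullet> b\<bar>) summable_on A"
  proof (rule summable_on_sum)
    fix b :: 'f
    have "(\<lambda>i. f i \<bullet> b) summable_on A"
      using summable_on_bounded_linear[OF bounded_linear_inner_left assms] .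
    then show "(\<lambda>i. \<bar>f i \<bullet> b\<bar>) summable_on A"
      using summable_on_iff_abs_summable_on_real[of "\<lambda>i. f i \<bullet> b" A] by simp
  qed
  then show ?thesis
    by (rule summable_on_comparison_test) (auto simp: norm_le_l1)
qed

text \<open>Convergence at a single diagonal point suffices: where all coordinates of
  \<open>x - a\<close> equal \<rho>, every monomial has the value
  \<open>\<rho> ^ mdeg \<alpha>\<close>.\<close>

lemma power_series_on_abs_summable:
  fixes c :: "('e::euclidean_space \<Rightarrow> nat) \<Rightarrow> 'f::euclidean_space"
  assumes "power_series_on c a r f" "r > 0"
  shows "\<exists>\<rho>>0. \<rho> \<le> r \<and> (\<lambda>\<alpha>. \<rho> ^ mdeg \<alpha> * norm (c \<alpha>)) summable_on multi_indices"
proof -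
  \<comment> \<open>The sum of the absolute coordinates of the diagonal vector is then
    \<open>r / 2\<close>, which keeps the point inside the ball.\<close>
  define \<rho> where "\<rho> = r / (2 * real DIM('e))"
  have \<rho>: "\<rho> > 0" using assms by (simp add: \<rho>_def)
  define x where "x = a + (\<Sum>b\<in>Basis. \<rho> *\<^sub>R b)"
  have xb: "(x - a) \<bullet> b = \<rho>" if "b \<in> Basis" for b
    using that by (simp add: x_def)
  have "norm (x - a) \<le> (\<Sum>b\<in>Basis. \<bar>(x - a) \<bullet> b\<bar>)" by (rule norm_le_l1)
  also have "\<dots> = real DIM('e) * \<rho>" using xb \<rho> by simp
  also have "\<dots> < r" using assms by (simp add: \<rho>_def)
  finally have "x \<in> ball a r" by (simp add: dist_norm norm_minus_commute)
  then have "(\<lambda>\<alpha>. mpow (x - a) \<alpha> *\<^sub>R c \<alpha>) summable_on multi_indices"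
    using assms unfolding power_series_on_def by (meson has_sum_imp_summable)
  then have "(\<lambda>\<alpha>. norm (mpow (x - a) \<alpha> *\<^sub>R c \<alpha>)) summable_on multi_indices"
    by (rule abs_summable_on_euclidean)
  moreover have "mpow (x - a) \<alpha> = \<rho> ^ mdeg \<alpha>" for \<alpha>
    by (simp add: mpow_def xb mdeg_def power_sum)
  ultimately have "(\<lambda>\<alpha>. \<rho> ^ mdeg \<alpha> * norm (c \<alpha>)) summable_on multi_indices"
    using \<rho> by simp
  moreover have "1 * r \<le> 2 * real DIM('e) * r"
    using assms DIM_ge_Suc0[where 'a='e] by (intro mult_right_mono) linarith+
  then have "\<rho> \<le> r" by (simp add: \<rho>_def field_simps)
  ultimately show ?thesis using \<rho> by blast
qed

section \<open>Termwise partial derivatives\<close>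

definition partial_coeffs ::
    "'e::euclidean_space \<Rightarrow> (('e \<Rightarrow> nat) \<Rightarrow> 'f::real_normed_vector) \<Rightarrow> ('e \<Rightarrow> nat) \<Rightarrow> 'f" where
  "partial_coeffs b c = (\<lambda>\<beta>. (real (\<beta> b) + 1) *\<^sub>R c (\<beta>(b := \<beta> b + 1)))"

text \<open>The truncated exponent \<open>\<alpha> b - 1\<close> is harmless: for
  \<open>\<alpha> b = 0\<close> the factor \<open>real (\<alpha> b)\<close> vanishes.\<close>

definition mpow_deriv :: "'e::euclidean_space \<Rightarrow> ('e \<Rightarrow> nat) \<Rightarrow> 'e \<Rightarrow> real" where
  "mpow_deriv x \<alpha> h =
     (\<Sum>b\<in>Basis. (real (\<alpha> b) * (h \<bullet> b) * (x \<bullet> b) ^ (\<alpha> b - 1)) * (\<Prod>b'\<in>Basis - {b}. (x \<bullet> b') ^ \<alpha> b'))"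

lemma mpow_has_derivative: "((\<lambda>x. mpow (x - a) \<alpha>) has_derivative mpow_deriv (x - a) \<alpha>) (at x)"
  unfolding mpow_def mpow_deriv_def[abs_def]
  by (rule has_derivative_prod) (auto intro!: derivative_eq_intros simp: inner_diff_left)

lemma mpow_split:
  assumes "b \<in> Basis"
  shows "mpow x \<alpha> = (x \<bullet> b) ^ \<alpha> b * (\<Prod>b'\<in>Basis - {b}. (x \<bullet> b') ^ \<alpha> b')"
  unfolding mpow_def using assms by (subst prod.remove[of _ b]) auto

lemma mpow_deriv_Basis:
  assumes b: "b \<in> Basis"
  shows "mpow_deriv x \<alpha> b = real (\<alpha> b) * mpow x (\<alpha>(b := \<alpha> b - 1))"
proof -
  have "mpow_deriv x \<alpha> b = (real (\<alpha> b) * (x \<bullet> b) ^ (\<alpha> b - 1)) * (\<Prod>b'\<in>Basis - {b}. (x \<bullet> b') ^ \<alpha> b')"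
    unfolding mpow_deriv_def using b
    by (subst sum.remove[of _ b]) (auto simp: inner_Basis intro!: sum.neutral split: if_splits)
  also have "(\<Prod>b'\<in>Basis - {b}. (x \<bullet> b') ^ \<alpha> b') = (\<Prod>b'\<in>Basis - {b}. (x \<bullet> b') ^ (\<alpha>(b := \<alpha> b - 1)) b')"
    by (rule prod.cong) auto
  finally show ?thesis using b by (simp add: mpow_split[OF b])
qed

text \<open>Differentiation brings down a factor \<open>n = mdeg \<alpha>\<close> and lowers the
  degree by one. On the ball of half the radius this factor is absorbed by
  \<open>n \<le> 2 ^ n\<close>, so the bound is again a multiple of
  \<open>\<rho> ^ n\<close>.\<close>

lemma mpow_deriv_le:
  assumes "\<rho> > 0" "norm x \<le> \<rho> / 2"
  shows "\<bar>mpow_deriv x \<alpha> h\<bar> \<le> 2 / \<rho> * \<rho> ^ mdeg \<alpha> * norm h"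
proof -
  have lin: "mpow_deriv x \<alpha> h = (\<Sum>b\<in>Basis. (h \<bullet> b) * mpow_deriv x \<alpha> b)"
  proof -
    have "(\<Sum>b\<in>Basis. (h \<bullet> b) * mpow_deriv x \<alpha> b) = (\<Sum>b\<in>Basis. (h \<bullet> b) * (real (\<alpha> b) * mpow x (\<alpha>(b := \<alpha> b - 1))))"
      by (rule sum.cong) (auto simp: mpow_deriv_Basis)
    also have "\<dots> = mpow_deriv x \<alpha> h"
      unfolding mpow_deriv_def by (rule sum.cong) (auto simp: mpow_split)
    finally show ?thesis by simp
  qed
  let ?n = "mdeg \<alpha>"
  have t: "\<bar>(h \<bullet> b) * mpow_deriv x \<alpha> b\<bar> \<le> norm h * real (\<alpha> b) * (\<rho> / 2) ^ (?n - 1)" if b: "b \<in> Basis" for b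
  proof (cases "\<alpha> b = 0")
    case True then show ?thesis using b by (simp add: mpow_deriv_Basis)
  next
    case False
    have "mdeg \<alpha> = \<alpha> b + sum \<alpha> (Basis - {b})" unfolding mdeg_def using b by (simp add: sum.remove)
    moreover have "mdeg (\<alpha>(b := \<alpha> b - 1)) = (\<alpha> b - 1) + sum \<alpha> (Basis - {b})"
      unfolding mdeg_def using b by (simp add: sum.remove)
    ultimately have d: "mdeg (\<alpha>(b := \<alpha> b - 1)) = ?n - 1" using False by simp
    have "\<bar>mpow x (\<alpha>(b := \<alpha> b - 1))\<bar> \<le> norm x ^ (?n - 1)" using abs_mpow_le d by metis
    also have "\<dots> \<le> (\<rho> / 2) ^ (?n - 1)" using assms by (intro power_mono) auto
    finally have m: "\<bar>mpow x (\<alpha>(b := \<alpha> b - 1))\<bar> \<le> (\<rho> / 2) ^ (?n - 1)" .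
    have "\<bar>(h \<bullet> b) * mpow_deriv x \<alpha> b\<bar> = \<bar>h \<bullet> b\<bar> * (real (\<alpha> b) * \<bar>mpow x (\<alpha>(b := \<alpha> b - 1))\<bar>)"
      using b by (simp add: mpow_deriv_Basis abs_mult)
    also have "\<dots> \<le> norm h * (real (\<alpha> b) * (\<rho> / 2) ^ (?n - 1))"
      by (intro mult_mono Basis_le_norm b m) (use assms in auto)
    finally show ?thesis by (simp add: mult.assoc)
  qed
  have "\<bar>mpow_deriv x \<alpha> h\<bar> \<le> (\<Sum>b\<in>Basis. norm h * real (\<alpha> b) * (\<rho> / 2) ^ (?n - 1))"
    unfolding lin by (intro order_trans[OF sum_abs] sum_mono t)
  also have "\<dots> = norm h * (real ?n * (\<rho> / 2) ^ (?n - 1))"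
    by (simp add: mdeg_def sum_distrib_left sum_distrib_right mult.assoc)
  finally have le: "\<bar>mpow_deriv x \<alpha> h\<bar> \<le> norm h * (real ?n * (\<rho> / 2) ^ (?n - 1))" .
  have "real ?n * (\<rho> / 2) ^ (?n - 1) \<le> 2 / \<rho> * \<rho> ^ ?n"
  proof (cases ?n)
    case 0 then show ?thesis using assms by simp
  next
    case (Suc k)
    have "Suc k \<le> 2 ^ Suc k" by (rule less_imp_le, rule less_exp)
    then have "real (Suc k) \<le> 2 ^ Suc k" by (metis of_nat_le_iff of_nat_numeral of_nat_power)
    then have "real (Suc k) * \<rho> ^ k \<le> 2 ^ Suc k * \<rho> ^ k" using assms by (intro mult_right_mono) auto
    then have "real (Suc k) * \<rho> ^ k / 2 ^ k \<le> 2 * \<rho> ^ k" by (simp add: field_simps)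
    then show ?thesis using Suc assms by (simp add: power_divide)
  qed
  then have "norm h * (real ?n * (\<rho> / 2) ^ (?n - 1)) \<le> norm h * (2 / \<rho> * \<rho> ^ ?n)"
    by (rule mult_left_mono) simp
  then show ?thesis using le by (simp only: mult.commute[of "norm h"])
qed

text \<open>\<open>mpow_deriv_le\<close> supplies the dominating series on half the radius \<rho> of
  absolute convergence. Terms with \<open>\<alpha> b = 0\<close> drop out of the derived series; the
  others are reindexed by lowering the exponent of \<open>b\<close>.\<close>

lemma power_series_on_partial:
  fixes c :: "('e::euclidean_space \<Rightarrow> nat) \<Rightarrow> 'f::euclidean_space"
  assumes f: "power_series_on c a r f" and r: "r > 0"
  shows "\<exists>s>0. s \<le> r \<and> (\<forall>x\<in>ball a s. f differentiable at x) \<and>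
     (\<forall>b\<in>Basis. power_series_on (partial_coeffs b c) a s (\<lambda>x. frechet_derivative f (at x) b))"
proof -
  obtain \<rho> where \<rho>: "\<rho> > 0" "\<rho> \<le> r" and sm: "(\<lambda>\<alpha>. \<rho> ^ mdeg \<alpha> * norm (c \<alpha>)) summable_on multi_indices"
    using power_series_on_abs_summable[OF f r] by blast
  define s where "s = \<rho> / 2"
  have s: "s > 0" "s \<le> r" using \<rho> by (auto simp: s_def)
  let ?F = "\<lambda>\<alpha> x. mpow (x - a) \<alpha> *\<^sub>R c \<alpha>"
  let ?F' = "\<lambda>\<alpha> x h. mpow_deriv (x - a) \<alpha> h *\<^sub>R c \<alpha>"
  let ?K = "\<lambda>\<alpha>. 2 / \<rho> * (\<rho> ^ mdeg \<alpha> * norm (c \<alpha>))"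
  have D: "(?F \<alpha> has_derivative ?F' \<alpha> x) (at x)" for \<alpha> x
    by (auto intro!: derivative_eq_intros mpow_has_derivative)
  have bd: "norm (?F' \<alpha> x h) \<le> ?K \<alpha> * norm h" if "x \<in> ball a s" for \<alpha> x h
  proof -
    have "norm (x - a) \<le> \<rho> / 2" using that by (simp add: s_def dist_norm norm_minus_commute)
    then have "\<bar>mpow_deriv (x - a) \<alpha> h\<bar> * norm (c \<alpha>) \<le> (2 / \<rho> * \<rho> ^ mdeg \<alpha> * norm h) * norm (c \<alpha>)"
      by (intro mult_right_mono mpow_deriv_le \<rho>) auto
    then show ?thesis by (simp add: ac_simps)
  qed
  have K: "?K summable_on multi_indices" by (rule summable_on_cmult_right[OF sm])
  have fs: "((\<lambda>\<alpha>. ?F \<alpha> x) has_sum f x) multi_indices" if "x \<in> ball a s" for x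
    using power_series_on_mono[OF f s(2)] that by (auto simp: power_series_on_def)
  note main = has_derivative_has_sum[where F = ?F and F' = ?F' and K = ?K and S = "ball a s",
      OF countable_multi_indices infinite_multi_indices _ _ _ _ _ K fs]
  have d1: "(f has_derivative (\<lambda>h. infsum (\<lambda>\<alpha>. ?F' \<alpha> x h) multi_indices)) (at x)" if "x \<in> ball a s" for x
    by (rule main) (use D bd that \<rho> in \<open>auto simp: convex_ball\<close>)
  have d2: "((\<lambda>\<alpha>. ?F' \<alpha> x h) has_sum frechet_derivative f (at x) h) multi_indices" if "x \<in> ball a s" for x h
  proof -
    have "((\<lambda>\<alpha>. ?F' \<alpha> x h) has_sum infsum (\<lambda>\<alpha>. ?F' \<alpha> x h) multi_indices) multi_indices"
      by (rule main) (use D bd that \<rho> in \<open>auto simp: convex_ball\<close>)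
    then show ?thesis by (simp only: frechet_derivative_at[OF d1[OF that], symmetric])
  qed
  have "power_series_on (partial_coeffs b c) a s (\<lambda>x. frechet_derivative f (at x) b)" if b: "b \<in> Basis" for b
    unfolding power_series_on_def
  proof
    fix x assume x: "x \<in> ball a s"
    let ?M = "{\<alpha>\<in>multi_indices. \<alpha> b \<noteq> 0}"
    let ?up = "\<lambda>\<beta>::'e \<Rightarrow> nat. \<beta>(b := \<beta> b + 1)"
    have "((\<lambda>\<alpha>. ?F' \<alpha> x b) has_sum frechet_derivative f (at x) b) ?M"
      
      by (rule iffD2[OF has_sum_cong_neutral d2[OF x, of b]]) (auto simp: mpow_deriv_Basis[OF b])
    then have "((\<lambda>\<beta>. ?F' (?up \<beta>) x b) has_sum frechet_derivative f (at x) b) multi_indices"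
      by (subst has_sum_reindex_bij_witness[where j = ?up and T = ?M and i = "\<lambda>\<alpha>. \<alpha>(b := \<alpha> b - 1)" and h = "\<lambda>\<alpha>. ?F' \<alpha> x b"])
        (use b in \<open>auto simp: multi_indices_def fun_eq_iff\<close>)
    moreover have "?F' (?up \<beta>) x b = mpow (x - a) \<beta> *\<^sub>R partial_coeffs b c \<beta>" for \<beta>
      by (simp add: mpow_deriv_Basis[OF b] partial_coeffs_def mult.commute)
    ultimately show "((\<lambda>\<alpha>. mpow (x - a) \<alpha> *\<^sub>R partial_coeffs b c \<alpha>) has_sum frechet_derivative f (at x) b) multi_indices"
      by simp
  qed
  then show ?thesis using s d1 unfolding differentiable_def by blast
qed

section \<open>Calculus of real analytic maps\<close>

lemma real_analytic_on_subset: "real_analytic_on f S \<Longrightarrow> T \<subseteq> S \<Longrightarrow> real_analytic_on f T"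
  unfolding real_analytic_on_def by blast

text \<open>Analyticity at a point concerns a whole ball; openness of \<open>S\<close> keeps that
  ball inside the set where the maps agree.\<close>

lemma real_analytic_on_cong:
  assumes "real_analytic_on f S" "open S" "\<And>x. x \<in> S \<Longrightarrow> f x = g x"
  shows "real_analytic_on g S"
  unfolding real_analytic_on_alt
proof
  fix a assume a: "a \<in> S"
  obtain r c where r: "r > 0" "power_series_on c a r f"
    using assms(1) a unfolding real_analytic_on_alt by blast
  obtain s where s: "s > 0" "ball a s \<subseteq> S" using assms(2) a open_contains_ball by metis
  have "power_series_on c a (min r s) g"
    by (rule power_series_on_cong[OF power_series_on_mono[OF r(2)]]) (use s assms(3) in auto)
  then show "\<exists>r>0. \<exists>c. power_series_on c a r g" using r s by (metis min_less_iff_conj)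
qed

text \<open>Meant for \<Phi>, whose chart expressions are identified only on small balls.\<close>

lemma real_analytic_on_locally:
  assumes "\<And>a. a \<in> S \<Longrightarrow> \<exists>T. open T \<and> a \<in> T \<and> (\<exists>g. real_analytic_on g T \<and> (\<forall>x\<in>T. g x = f x))"
  shows "real_analytic_on f S"
  unfolding real_analytic_on_alt
proof
  fix a assume "a \<in> S"
  from assms[OF this] obtain T g where T: "open T" "a \<in> T" "real_analytic_on g T" "\<And>x. x \<in> T \<Longrightarrow> g x = f x"
    by blast
  have "real_analytic_on f T" by (rule real_analytic_on_cong[OF T(3,1,4)])
  with T(2) show "\<exists>r>0. \<exists>c. power_series_on c a r f" unfolding real_analytic_on_alt by (rule bspec[rotated])
qed

lemma real_analytic_on_const [simp]: "real_analytic_on (\<lambda>x. k) S"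
  unfolding real_analytic_on_alt
proof (intro ballI exI[of _ "1::real"] exI conjI)
  fix a :: 'a
  show "power_series_on (\<lambda>\<alpha>. if \<alpha> = (\<lambda>_. 0) then k else 0) a 1 (\<lambda>x. k)"
    unfolding power_series_on_def
  proof
    fix x :: 'a
    have "((\<lambda>\<alpha>. mpow (x - a) \<alpha> *\<^sub>R (if \<alpha> = (\<lambda>_. 0) then k else 0)) has_sum k) multi_indices
      \<longleftrightarrow> ((\<lambda>\<alpha>. mpow (x - a) \<alpha> *\<^sub>R k) has_sum k) {\<lambda>_. 0}"
      by (rule has_sum_cong_neutral) (auto simp: multi_indices_def)
    then show "((\<lambda>\<alpha>. mpow (x - a) \<alpha> *\<^sub>R (if \<alpha> = (\<lambda>_. 0) then k else 0)) has_sum k) multi_indices"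
      using has_sum_finite[of "{\<lambda>_. 0}" "\<lambda>\<alpha>. mpow (x - a) \<alpha> *\<^sub>R k"] by (simp add: mpow_def)
  qed
qed simp

lemma real_analytic_on_add:
  assumes "real_analytic_on f S" "real_analytic_on g S"
  shows "real_analytic_on (\<lambda>x. f x + g x) S"
  unfolding real_analytic_on_alt
proof
  fix a assume a: "a \<in> S"
  obtain r c where r: "r > 0" "power_series_on c a r f"
    using assms(1) a unfolding real_analytic_on_alt by blast
  obtain s d where s: "s > 0" "power_series_on d a s g"
    using assms(2) a unfolding real_analytic_on_alt by blast
  have "power_series_on (\<lambda>\<alpha>. c \<alpha> + d \<alpha>) a (min r s) (\<lambda>x. f x + g x)"
    using power_series_on_mono[OF r(2), of "min r s"] power_series_on_mono[OF s(2), of "min r s"]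
    unfolding power_series_on_def scaleR_add_right by (auto intro: has_sum_add)
  then show "\<exists>r>0. \<exists>c. power_series_on c a r (\<lambda>x. f x + g x)" using r s by (metis min_less_iff_conj)
qed

lemma real_analytic_on_sum:
  assumes "\<And>i. i \<in> I \<Longrightarrow> real_analytic_on (f i) S"
  shows "real_analytic_on (\<lambda>x. \<Sum>i\<in>I. f i x) S"
  using assms by (induction I rule: infinite_finite_induct) (auto intro: real_analytic_on_add)

lemma real_analytic_on_bounded_linear:
  assumes L: "bounded_linear L" and "real_analytic_on f S"
  shows "real_analytic_on (\<lambda>x. L (f x)) S"
  unfolding real_analytic_on_alt
proof
  interpret L: bounded_linear L by fact
  fix a assume a: "a \<in> S"
  obtain r c where r: "r > 0" "power_series_on c a r f"
    using assms(2) a unfolding real_analytic_on_alt by blast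
  have "power_series_on (\<lambda>\<alpha>. L (c \<alpha>)) a r (\<lambda>x. L (f x))"
    using r(2) has_sum_bounded_linear[OF L] unfolding power_series_on_def by (fastforce simp: L.scaleR)
  then show "\<exists>r>0. \<exists>c. power_series_on c a r (\<lambda>x. L (f x))" using r by blast
qed

section \<open>Products of power series\<close>

lemma mpow_add: "mpow x (\<lambda>b. \<alpha> b + \<beta> b) = mpow x \<alpha> * mpow x \<beta>"
  by (simp add: mpow_def power_add prod.distrib)

lemma finite_multi_indices_below: "finite {\<alpha>\<in>multi_indices. \<alpha> \<le> (\<gamma> :: 'e::euclidean_space \<Rightarrow> nat)}"
proof -
  let ?g = "\<lambda>(f :: 'e \<Rightarrow> nat) b. if b \<in> Basis then f b else 0"
  have "{\<alpha>\<in>multi_indices. \<alpha> \<le> \<gamma>} \<subseteq> ?g ` Pi\<^sub>E Basis (\<lambda>b. {..\<gamma> b})"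
  proof
    fix \<alpha> assume \<alpha>: "\<alpha> \<in> {\<alpha>\<in>multi_indices. \<alpha> \<le> \<gamma>}"
    then have "\<alpha> = ?g (restrict \<alpha> Basis)" by (auto simp: multi_indices_def fun_eq_iff)
    moreover have "restrict \<alpha> Basis \<in> Pi\<^sub>E Basis (\<lambda>b. {..\<gamma> b})" using \<alpha> by (auto simp: le_fun_def)
    ultimately show "\<alpha> \<in> ?g ` Pi\<^sub>E Basis (\<lambda>b. {..\<gamma> b})" by (rule image_eqI)
  qed
  then show ?thesis by (rule finite_subset) (auto intro!: finite_PiE)
qed

text \<open>Both families are absolutely summable, so the norms of the products are summable over
  the pairs and the double sum may be evaluated row by row.\<close>

lemma has_sum_Cauchy_product:
  fixes f :: "'i \<Rightarrow> real" and g :: "'j \<Rightarrow> 'b::euclidean_space"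
  assumes f: "(f has_sum s) A" and g: "(g has_sum t) B"
  shows "((\<lambda>(x, y). f x *\<^sub>R g y) has_sum (s *\<^sub>R t)) (A \<times> B)"
proof (rule has_sum_SigmaI)
  show "((\<lambda>y. case (x, y) of (x, y) \<Rightarrow> f x *\<^sub>R g y) has_sum (f x *\<^sub>R t)) B" for x
    using has_sum_scaleR[OF g] by simp
  show "((\<lambda>x. f x *\<^sub>R t) has_sum (s *\<^sub>R t)) A"
    using has_sum_bounded_linear[OF bounded_linear_scaleR_left f] .
  have nf: "(\<lambda>x. norm (f x)) summable_on A" and ng: "(\<lambda>y. norm (g y)) summable_on B"
    using f g has_sum_imp_summable abs_summable_on_euclidean by blast+
  have "(\<lambda>p. norm (case p of (x, y) \<Rightarrow> f x *\<^sub>R g y)) summable_on (A \<times> B)"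
  proof (rule summable_on_SigmaI)
    show "((\<lambda>y. norm (case (x, y) of (x, y) \<Rightarrow> f x *\<^sub>R g y)) has_sum
        (norm (f x) * infsum (\<lambda>y. norm (g y)) B)) B" for x
      using has_sum_cmult_right[OF has_sum_infsum[OF ng]] by simp
    show "(\<lambda>x. norm (f x) * infsum (\<lambda>y. norm (g y)) B) summable_on A"
      by (rule summable_on_cmult_left[OF nf])
  qed auto
  then show "(\<lambda>(x, y). f x *\<^sub>R g y) summable_on A \<times> B"
    by (rule Infinite_Sum.abs_summable_summable)
qed

text \<open>The products over pairs \<open>(\<alpha>, \<beta>)\<close> are regrouped by the sum
  \<gamma> of the two multi-indices. A pair is recovered from \<gamma> and
  \<open>\<alpha> \<le> \<gamma>\<close>, and each \<gamma> has only finitely many such \<alpha>, so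
  the new coefficients are finite sums.\<close>

lemma real_analytic_on_scaleR:
  fixes g :: "'e::euclidean_space \<Rightarrow> 'f::euclidean_space"
  assumes "real_analytic_on f S" "real_analytic_on g S"
  shows "real_analytic_on (\<lambda>x. f x *\<^sub>R g x) S"
  unfolding real_analytic_on_alt
proof
  fix a assume a: "a \<in> S"
  obtain r c where r: "r > 0" "power_series_on c a r f"
    using assms(1) a unfolding real_analytic_on_alt by blast
  obtain s d where s: "s > 0" "power_series_on d a s g"
    using assms(2) a unfolding real_analytic_on_alt by blast
  define e where "e = (\<lambda>\<gamma>. \<Sum>\<alpha> | \<alpha> \<in> multi_indices \<and> \<alpha> \<le> \<gamma>. c \<alpha> *\<^sub>R d (\<lambda>b. \<gamma> b - \<alpha> b))"
  have "power_series_on e a (min r s) (\<lambda>x. f x *\<^sub>R g x)"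
    unfolding power_series_on_def
  proof
    fix x assume x: "x \<in> ball a (min r s)"
    let ?c = "\<lambda>\<alpha>. mpow (x - a) \<alpha> *\<^sub>R c \<alpha>" and ?d = "\<lambda>\<alpha>. mpow (x - a) \<alpha> *\<^sub>R d \<alpha>"
    have "(?c has_sum f x) multi_indices" "(?d has_sum g x) multi_indices"
      using r s x by (auto simp: power_series_on_def)
    then have P: "((\<lambda>(\<alpha>, \<beta>). ?c \<alpha> *\<^sub>R ?d \<beta>) has_sum (f x *\<^sub>R g x)) (multi_indices \<times> multi_indices)"
      by (rule has_sum_Cauchy_product)
    let ?S = "Sigma multi_indices (\<lambda>\<gamma>. {\<alpha>\<in>multi_indices. \<alpha> \<le> \<gamma>})"
    let ?h = "\<lambda>(\<gamma>, \<alpha>). mpow (x - a) \<gamma> *\<^sub>R c \<alpha> *\<^sub>R d (\<lambda>b. \<gamma> b - \<alpha> b)"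
    have "(?h has_sum (f x *\<^sub>R g x)) ?S"
      by (rule iffD1[OF has_sum_reindex_bij_witness[where j = "\<lambda>(\<alpha>, \<beta>). (\<lambda>b. \<alpha> b + \<beta> b, \<alpha>)"
              and i = "\<lambda>(\<gamma>, \<alpha>). (\<alpha>, \<lambda>b. \<gamma> b - \<alpha> b)"] P])
        (auto simp: multi_indices_def le_fun_def mpow_add fun_eq_iff mult.commute)
    then have "((\<lambda>\<gamma>. \<Sum>\<alpha> | \<alpha> \<in> multi_indices \<and> \<alpha> \<le> \<gamma>. ?h (\<gamma>, \<alpha>)) has_sum (f x *\<^sub>R g x)) multi_indices"
      by (rule has_sum_SigmaD) (rule has_sum_finite[OF finite_multi_indices_below])
    then show "((\<lambda>\<gamma>. mpow (x - a) \<gamma> *\<^sub>R e \<gamma>) has_sum (f x *\<^sub>R g x)) multi_indices"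
      by (simp add: e_def scaleR_sum_right)
  qed
  then show "\<exists>r>0. \<exists>c. power_series_on c a r (\<lambda>x. f x *\<^sub>R g x)" using r s by (metis min_less_iff_conj)
qed

section \<open>First and second derivatives of analytic maps\<close>

lemma real_analytic_on_differentiable:
  fixes f :: "'e::euclidean_space \<Rightarrow> 'f::euclidean_space"
  assumes "real_analytic_on f S" "x \<in> S"
  shows "f differentiable at x"
  using assms power_series_on_partial unfolding real_analytic_on_alt by (metis centre_in_ball)

lemma real_analytic_on_has_derivative:
  fixes f :: "'e::euclidean_space \<Rightarrow> 'f::euclidean_space"
  assumes "real_analytic_on f S" "x \<in> S"
  shows "(f has_derivative frechet_derivative f (at x)) (at x)"
  using real_analytic_on_differentiable[OF assms] frechet_derivative_works by blast

lemma frechet_derivative_euclidean: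
  fixes f :: "'e::euclidean_space \<Rightarrow> 'f::real_normed_vector"
  assumes "f differentiable at x"
  shows "frechet_derivative f (at x) v = (\<Sum>b\<in>Basis. (v \<bullet> b) *\<^sub>R frechet_derivative f (at x) b)"
proof -
  have "linear (frechet_derivative f (at x))" by (rule linear_frechet_derivative[OF assms])
  then have "frechet_derivative f (at x) (\<Sum>b\<in>Basis. (v \<bullet> b) *\<^sub>R b) =
      (\<Sum>b\<in>Basis. (v \<bullet> b) *\<^sub>R frechet_derivative f (at x) b)"
    by (simp add: linear_sum linear_scale)
  then show ?thesis by (simp only: euclidean_representation)
qed

lemma real_analytic_on_partial:
  fixes f :: "'e::euclidean_space \<Rightarrow> 'f::euclidean_space"
  assumes "real_analytic_on f S" "b \<in> Basis"
  shows "real_analytic_on (\<lambda>x. frechet_derivative f (at x) b) S"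
  using assms power_series_on_partial unfolding real_analytic_on_alt by metis

text \<open>Expanding the direction in the basis leaves a finite sum of products of analytic
  functions.\<close>

lemma real_analytic_on_deriv:
  fixes f :: "'e::euclidean_space \<Rightarrow> 'f::euclidean_space"
  assumes f: "real_analytic_on f S" and X: "real_analytic_on X S" and S: "open S"
  shows "real_analytic_on (\<lambda>x. frechet_derivative f (at x) (X x)) S"
proof (rule real_analytic_on_cong[OF _ S])
  show "real_analytic_on (\<lambda>x. \<Sum>b\<in>Basis. (X x \<bullet> b) *\<^sub>R frechet_derivative f (at x) b) S"
    by (intro real_analytic_on_sum real_analytic_on_scaleR real_analytic_on_partial[OF f]
        real_analytic_on_bounded_linear[OF bounded_linear_inner_left X])
  show "(\<Sum>b\<in>Basis. (X x \<bullet> b) *\<^sub>R frechet_derivative f (at x) b) = frechet_derivative f (at x) (X x)"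
    if "x \<in> S" for x
    using frechet_derivative_euclidean[OF real_analytic_on_differentiable[OF f that]] by metis
qed

lemma real_analytic_on_deriv_const:
  fixes f :: "'e::euclidean_space \<Rightarrow> 'f::euclidean_space"
  assumes "real_analytic_on f S" "open S"
  shows "real_analytic_on (\<lambda>x. frechet_derivative f (at x) v) S"
  using real_analytic_on_deriv[OF assms(1) _ assms(2), of "\<lambda>_. v"] by simp

text \<open>This is the product rule for a derivative applied to a varying direction. Basis
  expansion reduces it to scalar functions times partial derivatives; the two halves of the sum are
  then reassembled, the first with the direction frozen at \<open>K x\<close>.\<close>

lemma has_derivative_deriv:
  fixes f :: "'e::euclidean_space \<Rightarrow> 'f::euclidean_space"
  assumes f: "real_analytic_on f S" and S: "open S" "x \<in> S"
    and K: "(K has_derivative K') (at x)"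
  shows "((\<lambda>z. frechet_derivative f (at z) (K z)) has_derivative
     (\<lambda>h. frechet_derivative (\<lambda>z. frechet_derivative f (at z) (K x)) (at x) h
          + frechet_derivative f (at x) (K' h))) (at x)"
proof -
  let ?D = "\<lambda>v z. frechet_derivative f (at z) v"
  have lin: "linear (\<lambda>v. ?D v z)" if "z \<in> S" for z
    using linear_frechet_derivative[OF real_analytic_on_differentiable[OF f that]] .
  have exp: "?D v z = (\<Sum>b\<in>Basis. (v \<bullet> b) *\<^sub>R ?D b z)" if "z \<in> S" for v z
    using frechet_derivative_euclidean[OF real_analytic_on_differentiable[OF f that]] .
  have D: "(?D v has_derivative frechet_derivative (?D v) (at x)) (at x)" for v
    using real_analytic_on_has_derivative[OF real_analytic_on_deriv_const[OF f S(1)] S(2)] .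
  have 1: "((\<lambda>z. \<Sum>b\<in>Basis. (K z \<bullet> b) *\<^sub>R ?D b z) has_derivative
      (\<lambda>h. \<Sum>b\<in>Basis. (K x \<bullet> b) *\<^sub>R frechet_derivative (?D b) (at x) h + (K' h \<bullet> b) *\<^sub>R ?D b x)) (at x)"
    by (auto intro!: derivative_eq_intros K D)
  have 2: "frechet_derivative (?D (K x)) (at x) h = (\<Sum>b\<in>Basis. (K x \<bullet> b) *\<^sub>R frechet_derivative (?D b) (at x) h)" for h
  proof -
    have "((\<lambda>z. \<Sum>b\<in>Basis. (K x \<bullet> b) *\<^sub>R ?D b z) has_derivative
        (\<lambda>h. \<Sum>b\<in>Basis. (K x \<bullet> b) *\<^sub>R frechet_derivative (?D b) (at x) h)) (at x)"
      by (auto intro!: derivative_eq_intros D)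
    then have "(?D (K x) has_derivative (\<lambda>h. \<Sum>b\<in>Basis. (K x \<bullet> b) *\<^sub>R frechet_derivative (?D b) (at x) h)) (at x)"
      by (rule has_derivative_transform_within_open[OF _ S]) (rule exp[symmetric])
    then show ?thesis by (rule fun_cong[OF frechet_derivative_at[symmetric]])
  qed
  have 3: "(\<lambda>h. \<Sum>b\<in>Basis. (K x \<bullet> b) *\<^sub>R frechet_derivative (?D b) (at x) h + (K' h \<bullet> b) *\<^sub>R ?D b x) =
      (\<lambda>h. frechet_derivative (?D (K x)) (at x) h + ?D (K' h) x)"
    by (subst 2, subst (2) exp[OF S(2)]) (simp add: sum.distrib)
  have "((\<lambda>z. frechet_derivative f (at z) (K z)) has_derivative
      (\<lambda>h. frechet_derivative (?D (K x)) (at x) h + ?D (K' h) x)) (at x)"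
    by (rule has_derivative_transform_within_open[OF 1[unfolded 3] S]) (rule exp[symmetric])
  then show ?thesis .
qed

text \<open>Expanding \<open>f\<close> around \<open>x\<close> itself, each mixed second partial
  derivative for distinct basis vectors is the coefficient with exponent one in both directions,
  which is visibly symmetric. Linearity in both directions extends this to all vectors.\<close>

lemma frechet_derivative_commute:
  fixes f :: "'e::euclidean_space \<Rightarrow> 'f::euclidean_space"
  assumes f: "real_analytic_on f S" and S: "open S" "x \<in> S"
  shows "frechet_derivative (\<lambda>z. frechet_derivative f (at z) v) (at x) w =
         frechet_derivative (\<lambda>z. frechet_derivative f (at z) w) (at x) v"
proof -
  let ?D = "\<lambda>v z. frechet_derivative f (at z) v"
  let ?D2 = "\<lambda>v w. frechet_derivative (?D v) (at x) w"
  have D: "(?D v has_derivative ?D2 v) (at x)" for v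
    using real_analytic_on_has_derivative[OF real_analytic_on_deriv_const[OF f S(1)] S(2)] .
  obtain r c where r: "r > 0" "power_series_on c x r f"
    using f S(2) unfolding real_analytic_on_alt by blast
  obtain s where s: "s > 0" "\<And>b. b \<in> Basis \<Longrightarrow> power_series_on (partial_coeffs b c) x s (?D b)"
    using power_series_on_partial[OF r(2,1)] by blast
  have 1: "?D2 b b' = partial_coeffs b' (partial_coeffs b c) (\<lambda>_. 0)" if bb: "b \<in> Basis" "b' \<in> Basis" for b b'
  proof -
    obtain t where "t > 0" "power_series_on (partial_coeffs b' (partial_coeffs b c)) x t
         (\<lambda>x. frechet_derivative (?D b) (at x) b')"
      using power_series_on_partial[OF s(2)[OF bb(1)] s(1)] bb(2) by blast
    then show ?thesis using power_series_on_centre by blast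
  qed
  have 2: "?D2 b b' = ?D2 b' b" if "b \<in> Basis" "b' \<in> Basis" for b b'
    by (cases "b = b'") (simp_all add: 1 that partial_coeffs_def fun_upd_twist[of b b'])
  have 3: "?D2 v w = (\<Sum>b\<in>Basis. (v \<bullet> b) *\<^sub>R ?D2 b w)" for v w
  proof -
    have "((\<lambda>z. \<Sum>b\<in>Basis. (v \<bullet> b) *\<^sub>R ?D b z) has_derivative (\<lambda>h. \<Sum>b\<in>Basis. (v \<bullet> b) *\<^sub>R ?D2 b h)) (at x)"
      by (auto intro!: derivative_eq_intros D)
    then have "(?D v has_derivative (\<lambda>h. \<Sum>b\<in>Basis. (v \<bullet> b) *\<^sub>R ?D2 b h)) (at x)"
      by (rule has_derivative_transform_within_open[OF _ S])
        (rule frechet_derivative_euclidean[OF real_analytic_on_differentiable[OF f], symmetric])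
    then show ?thesis by (rule fun_cong[OF frechet_derivative_at[symmetric]])
  qed
  have 4: "?D2 v w = (\<Sum>b'\<in>Basis. (w \<bullet> b') *\<^sub>R ?D2 v b')" for v w
    by (rule frechet_derivative_euclidean) (use D in \<open>auto simp: differentiable_def\<close>)
  have 5: "?D2 v w = (\<Sum>b\<in>Basis. \<Sum>b'\<in>Basis. ((v \<bullet> b) * (w \<bullet> b')) *\<^sub>R ?D2 b b')" for v w
  proof -
    have "?D2 v w = (\<Sum>b\<in>Basis. (v \<bullet> b) *\<^sub>R ?D2 b w)" by (rule 3)
    also have "\<dots> = (\<Sum>b\<in>Basis. (v \<bullet> b) *\<^sub>R (\<Sum>b'\<in>Basis. (w \<bullet> b') *\<^sub>R ?D2 b b'))"
      by (rule sum.cong[OF refl], rule arg_cong[where f = "scaleR _"], rule 4)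
    finally show ?thesis by (simp only: scaleR_sum_right scaleR_scaleR)
  qed
  have "?D2 v w = (\<Sum>b'\<in>Basis. \<Sum>b\<in>Basis. ((v \<bullet> b) * (w \<bullet> b')) *\<^sub>R ?D2 b b')"
    unfolding 5[of v w] by (rule sum.swap)
  also have "\<dots> = (\<Sum>b'\<in>Basis. \<Sum>b\<in>Basis. ((w \<bullet> b') * (v \<bullet> b)) *\<^sub>R ?D2 b' b)"
    by (intro sum.cong refl) (simp only: 2 mult.commute)
  also have "\<dots> = ?D2 w v" by (rule 5[symmetric])
  finally show ?thesis .
qed

section \<open>Restriction to slices\<close>

lemma prod_Basis_Pair:
  "(\<Prod>b\<in>(Basis :: ('e::euclidean_space \<times> 'f::euclidean_space) set). h b) =
     (\<Prod>b\<in>Basis. h (b, 0)) * (\<Prod>b\<in>Basis. h (0, b :: 'f))" for h :: "_ \<Rightarrow> real"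
  unfolding Basis_prod_def
  by (subst prod.union_disjoint) (auto simp: prod.reindex inj_on_def)

text \<open>In an expansion about \<open>(a, v)\<close>, the coordinates of the second factor are
  zero along the slice. Only multi-indices vanishing on that block survive, and \<open>up\<close>
  identifies them with the multi-indices of the first factor.\<close>

lemma real_analytic_on_slice:
  fixes f :: "'e::euclidean_space \<times> 'f::euclidean_space \<Rightarrow> 'g::real_normed_vector"
  assumes "real_analytic_on f S"
  shows "real_analytic_on (\<lambda>x. f (x, v)) {x. (x, v) \<in> S}"
  unfolding real_analytic_on_alt
proof
  fix a assume a: "a \<in> {x. (x, v) \<in> S}"
  then obtain r c where r: "r > 0" "power_series_on c (a, v) r f"
    using assms unfolding real_analytic_on_alt by blast
  define up where "up = (\<lambda>(\<alpha> :: 'e \<Rightarrow> nat) (p :: 'e \<times> 'f). if snd p = 0 then \<alpha> (fst p) else 0)"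
  define Z where "Z = {\<alpha> \<in> (multi_indices :: ('e \<times> 'f \<Rightarrow> nat) set). \<forall>b\<in>Basis. \<alpha> (0, b) = 0}"
  have "power_series_on (\<lambda>\<alpha>. c (up \<alpha>)) a r (\<lambda>x. f (x, v))"
    unfolding power_series_on_def
  proof
    fix x assume x: "x \<in> ball a r"
    have mp: "mpow (y, 0) \<alpha> = (\<Prod>b\<in>Basis. (y \<bullet> b) ^ \<alpha> (b, 0)) * (\<Prod>b\<in>Basis. 0 ^ \<alpha> (0, b))"
      for \<alpha> :: "'e \<times> 'f \<Rightarrow> nat" and y
      unfolding mpow_def prod_Basis_Pair by simp
    have mp_up: "mpow (y, 0 :: 'f) (up \<alpha>) = mpow y \<alpha>" for \<alpha> y
    proof -
      have "(\<Prod>b\<in>(Basis :: 'f set). (0::real) ^ up \<alpha> (0, b)) = 1"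
        by (rule prod.neutral) (auto simp: up_def)
      then show ?thesis unfolding mp by (simp add: up_def mpow_def)
    qed
    have "(x, v) \<in> ball (a, v) r" using x by (simp add: dist_Pair_Pair)
    then have "((\<lambda>\<alpha>. mpow (x - a, 0) \<alpha> *\<^sub>R c \<alpha>) has_sum f (x, v)) multi_indices"
      using bspec[OF r(2)[unfolded power_series_on_def]] by fastforce
    then have "((\<lambda>\<alpha>. mpow (x - a, 0) \<alpha> *\<^sub>R c \<alpha>) has_sum f (x, v)) Z"
      by (rule iffD2[OF has_sum_cong_neutral, rotated 3]) (auto simp: Z_def mp)
    then show "((\<lambda>\<alpha>. mpow (x - a) \<alpha> *\<^sub>R c (up \<alpha>)) has_sum f (x, v)) multi_indices"
    proof (rule iffD2[OF has_sum_reindex_bij_witness[where j = up and i = "\<lambda>\<alpha> b. \<alpha> (b, 0)"], rotated 6])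
      fix \<alpha> :: "'e \<Rightarrow> nat" assume "\<alpha> \<in> multi_indices"
      then show "up \<alpha> \<in> Z"
        by (auto simp: Z_def multi_indices_def up_def Basis_prod_def image_iff)
    next
      fix \<alpha> :: "'e \<times> 'f \<Rightarrow> nat" assume \<alpha>: "\<alpha> \<in> Z"
      have "\<alpha> p = 0" if "snd p \<noteq> 0" for p
      proof (cases "p \<in> Basis")
        case True then show ?thesis using \<alpha> that by (auto simp: Z_def Basis_prod_def)
      next
        case False then show ?thesis using \<alpha> by (cases p) (auto simp: Z_def multi_indices_def)
      qed
      then show "up (\<lambda>b. \<alpha> (b, 0)) = \<alpha>"
        by (auto simp: up_def fun_eq_iff) 
      show "(\<lambda>b. \<alpha> (b, 0)) \<in> multi_indices"
      proof -
        have "(b, 0 :: 'f) \<notin> Basis" if "b \<notin> Basis" for b :: 'e using that by (auto simp: Basis_prod_def)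
        then show ?thesis using \<alpha> by (auto simp: Z_def multi_indices_def)
      qed
    qed (auto simp: mp_up, auto simp: up_def)
  qed
  then show "\<exists>r>0. \<exists>c. power_series_on c a r (\<lambda>x. f (x, v))" using r by blast
qed

section \<open>Charts\<close>

lemma has_derivative_cong_open:
  assumes "open S" "x \<in> S" "\<And>y. y \<in> S \<Longrightarrow> f y = g y"
  shows "(f has_derivative f') (at x) \<longleftrightarrow> (g has_derivative f') (at x)"
  using assms has_derivative_transform_within_open[of f f' x UNIV S g]
    has_derivative_transform_within_open[of g f' x UNIV S f] by auto

lemma frechet_derivative_cong_open:
  assumes "open S" "x \<in> S" "\<And>y. y \<in> S \<Longrightarrow> f y = g y"
  shows "frechet_derivative f (at x) = frechet_derivative g (at x)"
  unfolding frechet_derivative_def using has_derivative_cong_open[OF assms] by simp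

lemma differentiable_cong_open:
  assumes "open S" "x \<in> S" "\<And>y. y \<in> S \<Longrightarrow> f y = g y"
  shows "f differentiable at x \<longleftrightarrow> g differentiable at x"
  unfolding differentiable_def using has_derivative_cong_open[OF assms] by simp

lemma frechet_derivative_chain:
  assumes "f differentiable at x" "g differentiable at (f x)"
  shows "frechet_derivative (\<lambda>x. g (f x)) (at x) v =
         frechet_derivative g (at (f x)) (frechet_derivative f (at x) v)"
    and "(\<lambda>x. g (f x)) differentiable at x"
proof -
  have "((\<lambda>x. g (f x)) has_derivative (\<lambda>v. frechet_derivative g (at (f x)) (frechet_derivative f (at x) v))) (at x)"
    using diff_chain_at[of f _ x g] assms unfolding frechet_derivative_works o_def by blast
  then show "frechet_derivative (\<lambda>x. g (f x)) (at x) v =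
         frechet_derivative g (at (f x)) (frechet_derivative f (at x) v)"
    and "(\<lambda>x. g (f x)) differentiable at x"
    using fun_cong[OF frechet_derivative_at] unfolding differentiable_def by fastforce+
qed

text \<open>
  For the tangent bundle, used as the domain and codomain of \<open>\<tau>\<close>, differentiability of the
  transition maps is enough; its analyticity would require composing power series.
\<close>

definition diff_atlas :: "('i, 'a, 'e::euclidean_space) atlas \<Rightarrow> bool" where
  "diff_atlas M \<longleftrightarrow> (\<forall>i. inj_on (cmap M i) (cdom M i)) \<and>
     (\<forall>i j. open (cmap M i ` (cdom M i \<inter> cdom M j)) \<and>
       (\<forall>q\<in>cdom M i \<inter> cdom M j. transition M i j differentiable at (cmap M i q)))"

definition analytic_atlas :: "('i, 'a, 'e::euclidean_space) atlas \<Rightarrow> bool" where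
  "analytic_atlas M \<longleftrightarrow> (\<forall>i. inj_on (cmap M i) (cdom M i)) \<and>
     (\<forall>i j. open (cmap M i ` (cdom M i \<inter> cdom M j)) \<and>
       real_analytic_on (transition M i j) (cmap M i ` (cdom M i \<inter> cdom M j)))"

lemma analytic_manifold_alt:
  "analytic_manifold M \<longleftrightarrow> analytic_atlas M \<and> Hausdorff_space (mtop M) \<and> second_countable (mtop M)"
  by (auto simp: analytic_manifold_def analytic_atlas_def)

lemma analytic_atlas_imp_diff: "analytic_atlas M \<Longrightarrow> diff_atlas M"
  unfolding analytic_atlas_def diff_atlas_def
  by (meson image_eqI real_analytic_on_differentiable)

lemma diff_atlasD:
  assumes "diff_atlas M"
  shows diff_atlas_inj: "inj_on (cmap M i) (cdom M i)"
    and diff_atlas_open: "open (cmap M i ` (cdom M i \<inter> cdom M j))"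
    and diff_atlas_transition: "q \<in> cdom M i \<Longrightarrow> q \<in> cdom M j \<Longrightarrow> transition M i j differentiable at (cmap M i q)"
  using assms by (auto simp: diff_atlas_def)

lemma open_chart: "diff_atlas M \<Longrightarrow> open (cmap M i ` cdom M i)"
  using diff_atlas_open[of M i i] by simp

lemma cinv_cmap: "diff_atlas M \<Longrightarrow> q \<in> cdom M i \<Longrightarrow> cinv M i (cmap M i q) = q"
  by (simp add: diff_atlas_inj)

lemma transition_cmap: "diff_atlas M \<Longrightarrow> q \<in> cdom M i \<Longrightarrow> transition M i j (cmap M i q) = cmap M j q"
  by (simp add: transition_def cinv_cmap)

lemma points_iff: "q \<in> points M \<longleftrightarrow> (\<exists>i. q \<in> cdom M i)"
  by (simp add: points_def)

section \<open>The manifold topology in charts\<close>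

lemma topspace_mtop: "topspace (mtop M) = points M"
  unfolding mtop_def topology_generated_by_topspace points_def by blast

text \<open>The forward direction goes by induction over the generation of the topology: injectivity
  of the charts makes images commute with intersections, and continuity of the transitions handles
  the generators. Conversely, the set is the union of the preimages of its chart images.\<close>

lemma openin_mtop_iff:
  assumes M: "diff_atlas M"
  shows "openin (mtop M) S \<longleftrightarrow> S \<subseteq> points M \<and> (\<forall>i. open (cmap M i ` (S \<inter> cdom M i)))"
proof
  assume S: "openin (mtop M) S"
  have "open (cmap M i ` (S \<inter> cdom M i))" for i
  proof -
    have "generate_topology_on {cdom M i \<inter> cmap M i -` W | i W. open W} S"
      using S openin_topology_generated_by unfolding mtop_def by blast
    then show ?thesis
    proof induction
      case (Int A B)
      have "cmap M i ` (A \<inter> B \<inter> cdom M i) = cmap M i ` (A \<inter> cdom M i) \<inter> cmap M i ` (B \<inter> cdom M i)"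
        using inj_on_image_Int[OF diff_atlas_inj[OF M, of i], of "A \<inter> cdom M i" "B \<inter> cdom M i"]
        by (simp add: Int_ac)
      then show ?case using Int by (simp add: open_Int)
    next
      case (UN K)
      have "cmap M i ` (\<Union>K \<inter> cdom M i) = (\<Union>k\<in>K. cmap M i ` (k \<inter> cdom M i))" by blast
      then show ?case using UN by auto
    next
      case (Basis s)
      then obtain j W where s: "s = cdom M j \<inter> cmap M j -` W" "open W" by blast
      let ?O = "cmap M i ` (cdom M i \<inter> cdom M j)"
      have "continuous_on ?O (transition M i j)"
        using diff_atlas_transition[OF M]
        by (auto intro!: continuous_at_imp_continuous_on differentiable_imp_continuous_within)
      then have "open (transition M i j -` W \<inter> ?O)"
        using continuous_on_open_vimage[OF diff_atlas_open[OF M]] s(2) by blast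
      moreover have "cmap M i ` (s \<inter> cdom M i) = transition M i j -` W \<inter> ?O"
        using transition_cmap[OF M] s(1) by (auto simp: image_iff)
      ultimately show ?case by simp
    qed simp
  qed
  then show "S \<subseteq> points M \<and> (\<forall>i. open (cmap M i ` (S \<inter> cdom M i)))"
    using openin_subset[OF S] by (simp add: topspace_mtop)
next
  assume S: "S \<subseteq> points M \<and> (\<forall>i. open (cmap M i ` (S \<inter> cdom M i)))"
  have S_iff: "x \<in> S \<longleftrightarrow> (\<exists>i. x \<in> cdom M i \<and> cmap M i x \<in> cmap M i ` (S \<inter> cdom M i))" for x
  proof
    assume "x \<in> S"
    then obtain i where "x \<in> cdom M i" using S by (auto simp: points_iff subset_iff)
    then show "\<exists>i. x \<in> cdom M i \<and> cmap M i x \<in> cmap M i ` (S \<inter> cdom M i)" using \<open>x \<in> S\<close> by blast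
  next
    assume "\<exists>i. x \<in> cdom M i \<and> cmap M i x \<in> cmap M i ` (S \<inter> cdom M i)"
    then show "x \<in> S" using diff_atlas_inj[OF M] by (auto dest: inj_onD)
  qed
  have "S = (\<Union>i. cdom M i \<inter> cmap M i -` (cmap M i ` (S \<inter> cdom M i)))"
  proof (rule set_eqI)
    show "x \<in> S \<longleftrightarrow> x \<in> (\<Union>i. cdom M i \<inter> cmap M i -` (cmap M i ` (S \<inter> cdom M i)))" for x
      unfolding UN_iff Int_iff vimage_eq using S_iff[of x] by blast
  qed
  moreover have "openin (mtop M) (\<Union>i. cdom M i \<inter> cmap M i -` (cmap M i ` (S \<inter> cdom M i)))"
    unfolding mtop_def using S by (intro openin_Union) (auto intro!: topology_generated_by_Basis)
  ultimately show "openin (mtop M) S" by (rule ssubst)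
qed

lemma openin_cdom: "openin (mtop M) (cdom M i)"
  unfolding mtop_def by (rule topology_generated_by_Basis) (use open_UNIV in force)

lemma openin_chart_preimage: "open W \<Longrightarrow> openin (mtop M) (cdom M i \<inter> cmap M i -` W)"
  unfolding mtop_def by (rule topology_generated_by_Basis) blast

lemma open_chart_image:
  assumes "diff_atlas M" "openin (mtop M) S"
  shows "open (cmap M i ` (S \<inter> cdom M i))" "open (cmap M i ` (cdom M i \<inter> S))"
  using assms openin_mtop_iff Int_commute by metis+

text \<open>The chain rule in the source chart. It removes the arbitrary choice of chart in
  \<open>tangent_map\<close> and \<open>lie_deriv\<close>, and with a chart map as \<open>g\<close>
  it gives the cocycle rule.\<close>

lemma rep_source_change:
  assumes M: "diff_atlas M" and q: "q \<in> cdom M i" "q \<in> cdom M i'"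
    and d: "(g \<circ> cinv M i') differentiable at (cmap M i' q)"
  shows "frechet_derivative (g \<circ> cinv M i) (at (cmap M i q)) v =
     frechet_derivative (g \<circ> cinv M i') (at (cmap M i' q)) (frechet_derivative (transition M i i') (at (cmap M i q)) v)"
    and "(g \<circ> cinv M i) differentiable at (cmap M i q)"
proof -
  let ?O = "cmap M i ` (cdom M i \<inter> cdom M i')"
  have O: "open ?O" "cmap M i q \<in> ?O" using q diff_atlas_open[OF M] by auto
  have eq: "(g \<circ> cinv M i) x = (g \<circ> cinv M i') (transition M i i' x)" if "x \<in> ?O" for x
    using that by (auto simp: cinv_cmap[OF M] transition_cmap[OF M])
  have d': "(g \<circ> cinv M i') differentiable at (transition M i i' (cmap M i q))"
    using d by (simp add: transition_cmap[OF M] q)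
  note ch = frechet_derivative_chain[OF diff_atlas_transition[OF M q] d']
  show "frechet_derivative (g \<circ> cinv M i) (at (cmap M i q)) v =
     frechet_derivative (g \<circ> cinv M i') (at (cmap M i' q)) (frechet_derivative (transition M i i') (at (cmap M i q)) v)"
    using trans[OF fun_cong[OF frechet_derivative_cong_open[OF O eq]] ch(1)]
    by (simp only: transition_cmap[OF M q(1)])
  show "(g \<circ> cinv M i) differentiable at (cmap M i q)"
    by (rule iffD2[OF differentiable_cong_open[OF O eq] ch(2)])
qed

lemma transition_cocycle:
  assumes M: "diff_atlas M" and q: "q \<in> cdom M i" "q \<in> cdom M j" "q \<in> cdom M k"
  shows "frechet_derivative (transition M i k) (at (cmap M i q)) v =
     frechet_derivative (transition M j k) (at (cmap M j q)) (frechet_derivative (transition M i j) (at (cmap M i q)) v)"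
  using rep_source_change(1)[OF M q(1,2), of "cmap M k"] diff_atlas_transition[OF M q(2,3)]
  by (simp add: transition_def)

lemma transition_refl_deriv:
  assumes M: "diff_atlas M" and q: "q \<in> cdom M i"
  shows "frechet_derivative (transition M i i) (at (cmap M i q)) v = v"
proof -
  have "frechet_derivative (transition M i i) (at (cmap M i q)) = frechet_derivative (\<lambda>x. x) (at (cmap M i q))"
    by (rule frechet_derivative_cong_open[OF open_chart[OF M]]) (use q in \<open>auto simp: transition_cmap[OF M]\<close>)
  then show ?thesis by (simp add: frechet_derivative_ident)
qed

section \<open>Tangent vectors\<close>

lemma tangent_spaceD:
  assumes "v \<in> tangent_space M q"
  shows "q \<notin> cdom M i \<Longrightarrow> v i = 0"
    and "q \<in> cdom M i \<Longrightarrow> q \<in> cdom M j \<Longrightarrow> v j = frechet_derivative (transition M i j) (at (cmap M i q)) (v i)"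
  using assms unfolding tangent_space_def by blast+

text \<open>The transition derivatives recover every component from one, so equality of tangent
  vectors can be tested in a single chart.\<close>

lemma tangent_space_eqI:
  assumes "v \<in> tangent_space M q" "w \<in> tangent_space M q" "q \<in> cdom M i" "v i = w i"
  shows "v = w"
proof
  fix j show "v j = w j"
  proof (cases "q \<in> cdom M j")
    case True
    show ?thesis
      unfolding tangent_spaceD(2)[OF assms(1,3) True] tangent_spaceD(2)[OF assms(2,3) True] assms(4) ..
  next
    case False
    show ?thesis unfolding tangent_spaceD(1)[OF assms(1) False] tangent_spaceD(1)[OF assms(2) False] ..
  qed
qed

lemma linear_transition_deriv:
  assumes "diff_atlas M" "q \<in> cdom M i" "q \<in> cdom M j"
  shows "linear (frechet_derivative (transition M i j) (at (cmap M i q)))"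
  using linear_frechet_derivative[OF diff_atlas_transition[OF assms]] .

lemma tangent_space_lincomb:
  assumes M: "diff_atlas M" and "v \<in> tangent_space M q" "w \<in> tangent_space M q"
  shows "(\<lambda>i. a *\<^sub>R v i + b *\<^sub>R w i) \<in> tangent_space M q"
  unfolding tangent_space_def
proof (intro CollectI conjI allI impI)
  fix i j assume q: "q \<in> cdom M i \<inter> cdom M j"
  interpret linear "frechet_derivative (transition M i j) (at (cmap M i q))"
    using linear_transition_deriv[OF M] q by blast
  show "a *\<^sub>R v j + b *\<^sub>R w j = frechet_derivative (transition M i j) (at (cmap M i q)) (a *\<^sub>R v i + b *\<^sub>R w i)"
    using tangent_spaceD(2)[OF assms(2), of i j] tangent_spaceD(2)[OF assms(3), of i j] q
    by (simp add: add scale)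
qed (use assms in \<open>simp add: tangent_spaceD\<close>)

lemma tangent_space_0: "diff_atlas M \<Longrightarrow> (\<lambda>i. 0) \<in> tangent_space M q"
  unfolding tangent_space_def using linear_transition_deriv[of M q] by (auto simp: linear_0)

text \<open>Inverse to reading off the component in chart \<open>i\<close>: the tangent vector at
  \<open>q\<close> that is represented there by \<open>w\<close>.\<close>

definition tvec :: "('i, 'a, 'e::euclidean_space) atlas \<Rightarrow> 'i \<Rightarrow> 'a \<Rightarrow> 'e \<Rightarrow> 'i \<Rightarrow> 'e" where
  "tvec M i q w = (\<lambda>j. if q \<in> cdom M j then frechet_derivative (transition M i j) (at (cmap M i q)) w else 0)"

lemma tvec:
  assumes M: "diff_atlas M" and q: "q \<in> cdom M i"
  shows tvec_in: "tvec M i q w \<in> tangent_space M q" and tvec_at: "tvec M i q w i = w"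
proof -
  show "tvec M i q w i = w" using transition_refl_deriv[OF M q] q by (simp add: tvec_def)
  have "tvec M i q w k = frechet_derivative (transition M j k) (at (cmap M j q)) (tvec M i q w j)"
    if "q \<in> cdom M j" "q \<in> cdom M k" for j k
    using transition_cocycle[OF M q that] that by (simp add: tvec_def)
  then show "tvec M i q w \<in> tangent_space M q"
    unfolding tangent_space_def by (simp add: tvec_def)
qed

text \<open>\<open>tangent_map\<close> uses an unspecified source chart; this lemma permits any
  chart in which the representative is known to be differentiable.\<close>

lemma tangent_map_chart:
  assumes M: "diff_atlas M" and q: "q \<in> cdom M i" and v: "v \<in> tangent_space M q" and j: "f q \<in> cdom N j"
    and d: "(cmap N j \<circ> f \<circ> cinv M i) differentiable at (cmap M i q)"
  shows "snd (tangent_map M N f (q, v)) j = frechet_derivative (cmap N j \<circ> f \<circ> cinv M i) (at (cmap M i q)) (v i)"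
proof -
  define k where "k = (SOME k. q \<in> cdom M k)"
  have k: "q \<in> cdom M k" unfolding k_def using q by (rule someI)
  have "snd (tangent_map M N f (q, v)) j = frechet_derivative (cmap N j \<circ> f \<circ> cinv M k) (at (cmap M k q)) (v k)"
    using j by (simp add: tangent_map_def k_def Let_def)
  also have "\<dots> = frechet_derivative (cmap N j \<circ> f \<circ> cinv M i) (at (cmap M i q)) (v i)"
    by (subst rep_source_change(1)[OF M k q d]) (simp add: tangent_spaceD(2)[OF v k q])
  finally show ?thesis .
qed

text \<open>Compatibility of two target components is the chain rule for their transition.
  Continuity of \<open>f\<close> provides the neighbourhood that is mapped into both target
  charts.\<close>

lemma tangent_map_in:
  assumes M: "diff_atlas M" and N: "diff_atlas N" and q: "q \<in> cdom M i" and v: "v \<in> tangent_space M q"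
    and d: "\<And>j. f q \<in> cdom N j \<Longrightarrow> (cmap N j \<circ> f \<circ> cinv M i) differentiable at (cmap M i q)"
    and f: "continuous_map (mtop M) (mtop N) f"
  shows "snd (tangent_map M N f (q, v)) \<in> tangent_space N (f q)"
  unfolding tangent_space_def
proof (intro CollectI conjI allI impI)
  fix j show "f q \<notin> cdom N j \<Longrightarrow> snd (tangent_map M N f (q, v)) j = 0" by (simp add: tangent_map_def)
next
  fix j k assume jk: "f q \<in> cdom N j \<inter> cdom N k"
  let ?P = "{p \<in> topspace (mtop M). f p \<in> cdom N j \<inter> cdom N k}"
  have P: "openin (mtop M) ?P"
    by (rule openin_continuous_map_preimage[OF f]) (intro openin_Int openin_cdom)
  let ?O = "cmap M i ` (?P \<inter> cdom M i)"
  have O: "open ?O" "cmap M i q \<in> ?O"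
    using open_chart_image(1)[OF M P] q jk by (auto simp: topspace_mtop points_iff)
  have eq: "(cmap N k \<circ> f \<circ> cinv M i) x = transition N j k ((cmap N j \<circ> f \<circ> cinv M i) x)" if "x \<in> ?O" for x
    using that by (auto simp: cinv_cmap[OF M] transition_cmap[OF N])
  have fq: "(cmap N j \<circ> f \<circ> cinv M i) (cmap M i q) = cmap N j (f q)" by (simp add: cinv_cmap[OF M q])
  have "snd (tangent_map M N f (q, v)) k =
      frechet_derivative (cmap N k \<circ> f \<circ> cinv M i) (at (cmap M i q)) (v i)"
    using jk d by (intro tangent_map_chart[OF M q v]) auto
  also have "\<dots> = frechet_derivative (\<lambda>x. transition N j k ((cmap N j \<circ> f \<circ> cinv M i) x)) (at (cmap M i q)) (v i)"
    by (simp only: frechet_derivative_cong_open[OF O eq])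
  also have "\<dots> = frechet_derivative (transition N j k) (at (cmap N j (f q)))
      (frechet_derivative (cmap N j \<circ> f \<circ> cinv M i) (at (cmap M i q)) (v i))"
    using jk by (subst frechet_derivative_chain(1)) (auto simp only: fq intro!: d diff_atlas_transition[OF N])
  also have "frechet_derivative (cmap N j \<circ> f \<circ> cinv M i) (at (cmap M i q)) (v i) = snd (tangent_map M N f (q, v)) j"
    using jk d by (intro tangent_map_chart[OF M q v, symmetric]) auto
  finally show "snd (tangent_map M N f (q, v)) k =
      frechet_derivative (transition N j k) (at (cmap N j (f q))) (snd (tangent_map M N f (q, v)) j)" .
qed

section \<open>The tangent bundle\<close>

lemma cdom_tangent_bundle: "(q, v) \<in> cdom (tangent_bundle M) i \<longleftrightarrow> q \<in> cdom M i \<and> v \<in> tangent_space M q"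
  and cmap_tangent_bundle: "cmap (tangent_bundle M) i (q, v) = (cmap M i q, v i)"
  by (simp_all add: tangent_bundle_def)

lemma points_tangent_bundle: "(q, v) \<in> points (tangent_bundle M) \<longleftrightarrow> q \<in> points M \<and> v \<in> tangent_space M q"
  by (auto simp: points_iff cdom_tangent_bundle)

lemma inj_on_tangent_bundle:
  assumes M: "diff_atlas M"
  shows "inj_on (cmap (tangent_bundle M) i) (cdom (tangent_bundle M) i)"
proof (rule inj_onI)
  fix p p'
  assume a: "p \<in> cdom (tangent_bundle M) i" "p' \<in> cdom (tangent_bundle M) i"
    "cmap (tangent_bundle M) i p = cmap (tangent_bundle M) i p'"
  obtain q v q' v' where p: "p = (q, v)" "p' = (q', v')" by (cases p, cases p')
  have "q = q'" using a diff_atlas_inj[OF M, of i]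
    by (auto simp: p cdom_tangent_bundle cmap_tangent_bundle dest: inj_onD)
  then show "p = p'"
    using a tangent_space_eqI[of v M q v' i] by (simp add: p cdom_tangent_bundle cmap_tangent_bundle)
qed

lemma cinv_tangent_bundle:
  assumes "diff_atlas M" "q \<in> cdom M i" "v \<in> tangent_space M q"
  shows "cinv (tangent_bundle M) i (cmap M i q, v i) = (q, v)"
  using inv_into_f_f[OF inj_on_tangent_bundle[OF assms(1)], of "(q, v)" i] assms
  by (simp add: cdom_tangent_bundle cmap_tangent_bundle)

lemma cinv_tangent_bundle_tvec:
  assumes "diff_atlas M" "q \<in> cdom M i"
  shows "cinv (tangent_bundle M) i (cmap M i q, w) = (q, tvec M i q w)"
  using cinv_tangent_bundle[OF assms tvec_in[OF assms, of w]] by (simp only: tvec_at[OF assms])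

lemma image_cmap_tangent_bundle:
  assumes M: "diff_atlas M"
  shows "cmap (tangent_bundle M) i ` (cdom (tangent_bundle M) i \<inter> cdom (tangent_bundle M) j) =
     (cmap M i ` (cdom M i \<inter> cdom M j)) \<times> UNIV" (is "?L = ?R")
proof
  show "?L \<subseteq> ?R" by (auto simp: cdom_tangent_bundle cmap_tangent_bundle)
  show "?R \<subseteq> ?L"
  proof clarify
    fix q w assume q: "q \<in> cdom M i" "q \<in> cdom M j"
    have "cmap (tangent_bundle M) i (q, tvec M i q w) = (cmap M i q, w)"
      using tvec_at[OF M q(1)] by (simp add: cmap_tangent_bundle)
    moreover have "(q, tvec M i q w) \<in> cdom (tangent_bundle M) i \<inter> cdom (tangent_bundle M) j"
      using q tvec_in[OF M q(1)] by (simp add: cdom_tangent_bundle)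
    ultimately show "(cmap M i q, w) \<in> ?L" by (metis image_eqI)
  qed
qed

lemma transition_tangent_bundle:
  assumes M: "diff_atlas M" and q: "q \<in> cdom M i" "q \<in> cdom M j"
  shows "transition (tangent_bundle M) i j (cmap M i q, w) =
     (cmap M j q, frechet_derivative (transition M i j) (at (cmap M i q)) w)"
  using q by (simp add: transition_def[of "tangent_bundle M"] cinv_tangent_bundle_tvec[OF M q(1)] cmap_tangent_bundle tvec_def)

text \<open>In coordinates the transition is the tangent map of the base transition. Its derivative
  contains the second derivative of the base transition, the term that the transformation law of the
  Christoffel symbols compensates in \<open>spray_in\<close>.\<close>

lemma transition_tangent_bundle_has_derivative:
  fixes M :: "('i, 'a, 'e::euclidean_space) atlas"
  assumes M: "analytic_atlas M" and q: "q \<in> cdom M i" "q \<in> cdom M j"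
  defines "D \<equiv> \<lambda>x. frechet_derivative (transition M i j) (at x)"
  shows "(transition (tangent_bundle M) i j has_derivative
     (\<lambda>h. (D (cmap M i q) (fst h),
        frechet_derivative (\<lambda>x. D x w) (at (cmap M i q)) (fst h) + D (cmap M i q) (snd h)))) (at (cmap M i q, w))"
proof -
  note M' = analytic_atlas_imp_diff[OF M]
  let ?O = "cmap M i ` (cdom M i \<inter> cdom M j)"
  let ?x = "cmap M i q"
  have O: "open ?O" "?x \<in> ?O" using diff_atlas_open[OF M'] q by auto
  have an: "real_analytic_on (transition M i j) ?O" using M by (simp add: analytic_atlas_def)
  have d1: "((\<lambda>z. transition M i j (fst z)) has_derivative (\<lambda>h. D ?x (fst h))) (at (?x, w))"
    using diff_chain_at[OF has_derivative_fst[OF has_derivative_ident], of "transition M i j" "D ?x"]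
      real_analytic_on_has_derivative[OF an O(2)] unfolding D_def o_def by fastforce
  have d2: "((\<lambda>z. D (fst z) (snd z)) has_derivative
      (\<lambda>h. frechet_derivative (\<lambda>x. D x w) (at ?x) (fst h) + D ?x (snd h))) (at (?x, w))"
  proof -
    \<comment> \<open>The direction varies together with the base point, so it is expanded in the
      basis before the product rule is used.\<close>
    have exp: "D x v = (\<Sum>b\<in>Basis. (v \<bullet> b) *\<^sub>R D x b)" if "x \<in> ?O" for x v
      unfolding D_def by (rule frechet_derivative_euclidean[OF real_analytic_on_differentiable[OF an that]])
    have anD: "real_analytic_on (\<lambda>x. D x v) ?O" for v
      unfolding D_def by (rule real_analytic_on_deriv_const[OF an O(1)])
    have Db: "((\<lambda>z. D (fst z) b) has_derivative (\<lambda>h. frechet_derivative (\<lambda>x. D x b) (at ?x) (fst h))) (at (?x, w))" for b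
      using diff_chain_at[OF has_derivative_fst[OF has_derivative_ident], of "\<lambda>x. D x b"]
        real_analytic_on_has_derivative[OF anD O(2)] unfolding o_def by fastforce
    have 1: "((\<lambda>z. \<Sum>b\<in>Basis. (snd z \<bullet> b) *\<^sub>R D (fst z) b) has_derivative
       (\<lambda>h. \<Sum>b\<in>Basis. (w \<bullet> b) *\<^sub>R frechet_derivative (\<lambda>x. D x b) (at ?x) (fst h) + (snd h \<bullet> b) *\<^sub>R D ?x b)) (at (?x, w))"
      by (auto intro!: derivative_eq_intros Db)
    have 2: "frechet_derivative (\<lambda>x. D x w) (at ?x) h = (\<Sum>b\<in>Basis. (w \<bullet> b) *\<^sub>R frechet_derivative (\<lambda>x. D x b) (at ?x) h)" for h
    proof -
      have "((\<lambda>x. \<Sum>b\<in>Basis. (w \<bullet> b) *\<^sub>R D x b) has_derivative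
         (\<lambda>h. \<Sum>b\<in>Basis. (w \<bullet> b) *\<^sub>R frechet_derivative (\<lambda>x. D x b) (at ?x) h)) (at ?x)"
        by (auto intro!: derivative_eq_intros real_analytic_on_has_derivative[OF anD O(2)])
      then have "((\<lambda>x. D x w) has_derivative
         (\<lambda>h. \<Sum>b\<in>Basis. (w \<bullet> b) *\<^sub>R frechet_derivative (\<lambda>x. D x b) (at ?x) h)) (at ?x)"
        by (rule has_derivative_transform_within_open[OF _ O]) (rule exp[symmetric])
      then show ?thesis by (rule fun_cong[OF frechet_derivative_at[symmetric]])
    qed
    have 3: "(\<lambda>h. \<Sum>b\<in>Basis. (w \<bullet> b) *\<^sub>R frechet_derivative (\<lambda>x. D x b) (at ?x) (fst h) + (snd h \<bullet> b) *\<^sub>R D ?x b)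
       = (\<lambda>h. frechet_derivative (\<lambda>x. D x w) (at ?x) (fst h) + D ?x (snd h))"
      unfolding sum.distrib 2[symmetric] exp[OF O(2), symmetric] ..
    show ?thesis
      by (rule has_derivative_transform_within_open[OF 1[unfolded 3], where s = "?O \<times> UNIV"])
        (use O exp[symmetric] in \<open>auto intro!: open_Times\<close>)
  qed
  have "((\<lambda>z. (transition M i j (fst z), D (fst z) (snd z))) has_derivative
     (\<lambda>h. (D ?x (fst h), frechet_derivative (\<lambda>x. D x w) (at ?x) (fst h) + D ?x (snd h)))) (at (?x, w))"
    by (rule has_derivative_Pair[OF d1 d2])
  then have "(transition (tangent_bundle M) i j has_derivative
     (\<lambda>h. (D ?x (fst h), frechet_derivative (\<lambda>x. D x w) (at ?x) (fst h) + D ?x (snd h)))) (at (?x, w))"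
  proof (rule has_derivative_transform_within_open[where s = "?O \<times> UNIV"])
    fix z :: "'e \<times> 'e" assume "z \<in> ?O \<times> UNIV"
    then obtain q v where "z = (cmap M i q, v)" "q \<in> cdom M i" "q \<in> cdom M j" by auto
    then show "(transition M i j (fst z), D (fst z) (snd z)) = transition (tangent_bundle M) i j z"
      using transition_tangent_bundle[OF M', of q i j v] transition_cmap[OF M', of q i j] by (simp add: D_def)
  qed (use O in \<open>auto intro!: open_Times\<close>)
  then show ?thesis .
qed

lemma diff_atlas_tangent_bundle:
  assumes M: "analytic_atlas M"
  shows "diff_atlas (tangent_bundle M)"
  unfolding diff_atlas_def
proof (intro conjI allI ballI)
  note M' = analytic_atlas_imp_diff[OF M]
  show "inj_on (cmap (tangent_bundle M) i) (cdom (tangent_bundle M) i)" for i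
    by (rule inj_on_tangent_bundle[OF M'])
  show "open (cmap (tangent_bundle M) i ` (cdom (tangent_bundle M) i \<inter> cdom (tangent_bundle M) j))" for i j
    unfolding image_cmap_tangent_bundle[OF M'] by (intro open_Times diff_atlas_open M') simp
  fix i j p assume "p \<in> cdom (tangent_bundle M) i \<inter> cdom (tangent_bundle M) j"
  then obtain q v where p: "p = (q, v)" "q \<in> cdom M i" "q \<in> cdom M j"
    by (cases p) (auto simp: cdom_tangent_bundle)
  show "transition (tangent_bundle M) i j differentiable at (cmap (tangent_bundle M) i p)"
    unfolding p(1) cmap_tangent_bundle differentiable_def
    using transition_tangent_bundle_has_derivative[OF M p(2,3)] by blast
qed

text \<open>In charts the bundle projection is \<open>fst\<close> on a product, which is an open
  map.\<close>

lemma openin_fst_image: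
  assumes M: "analytic_atlas M" and U: "openin (mtop (tangent_bundle M)) U"
  shows "openin (mtop M) (fst ` U)"
  unfolding openin_mtop_iff[OF analytic_atlas_imp_diff[OF M]]
proof (intro conjI allI)
  have "U \<subseteq> points (tangent_bundle M)" using openin_subset[OF U] by (simp add: topspace_mtop)
  have Up: "v \<in> tangent_space M q \<and> q \<in> points M" if "(q, v) \<in> U" for q v
    using subsetD[OF \<open>U \<subseteq> points (tangent_bundle M)\<close> that] by (simp add: points_tangent_bundle)
  show "fst ` U \<subseteq> points M" using Up by force
  fix i
  have eq: "cmap M i ` (fst ` U \<inter> cdom M i) = fst ` (cmap (tangent_bundle M) i ` (U \<inter> cdom (tangent_bundle M) i))"
  proof -
    have 1: "U \<inter> cdom (tangent_bundle M) i = {p \<in> U. fst p \<in> cdom M i}"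
    proof (rule set_eqI)
      fix p show "p \<in> U \<inter> cdom (tangent_bundle M) i \<longleftrightarrow> p \<in> {p \<in> U. fst p \<in> cdom M i}"
        using Up[of "fst p" "snd p"] cdom_tangent_bundle[of "fst p" "snd p" M i] by auto
    qed
    have 2: "fst (cmap (tangent_bundle M) i p) = cmap M i (fst p)" for p
      by (cases p) (simp add: cmap_tangent_bundle)
    have 3: "fst ` U \<inter> cdom M i = fst ` {p \<in> U. fst p \<in> cdom M i}" by auto
    show ?thesis unfolding 1 3 image_image 2 ..
  qed
  show "open (cmap M i ` (fst ` U \<inter> cdom M i))"
    unfolding eq by (rule open_image_fst[OF open_chart_image(1)[OF diff_atlas_tangent_bundle[OF M] U]])
qed

section \<open>Open submanifolds\<close>

lemma submanifold_simps [simp]: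
  "cdom (submanifold M W) i = cdom M i \<inter> W" "cmap (submanifold M W) i = cmap M i"
  by (simp_all add: submanifold_def)

lemma points_submanifold: "points (submanifold M W) = points M \<inter> W"
  by (auto simp: points_def)

lemma mtop_submanifold: "mtop (submanifold M W) = subtopology (mtop M) W"
proof (rule topology_eq[THEN iffD2], intro allI iffI)
  fix S
  assume S: "openin (mtop (submanifold M W)) S"
  have "generate_topology_on {cdom M i \<inter> W \<inter> cmap M i -` Z | i Z. open Z} S"
    using openin_topology_generated_by[OF S[unfolded mtop_def submanifold_simps]] .
  then show "openin (subtopology (mtop M) W) S"
  proof induction
    case (UN K) show ?case by (rule openin_Union) (rule UN.IH)
  next
    case (Basis s)
    then obtain i Z where "s = (cdom M i \<inter> cmap M i -` Z) \<inter> W" "open Z" by blast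
    then show ?case
      unfolding openin_subtopology by (intro exI[of _ "cdom M i \<inter> cmap M i -` Z"] conjI openin_chart_preimage)
  next
    case (Int A B) show ?case by (rule openin_Int[OF Int.IH])
  qed simp
next
  fix S
  assume "openin (subtopology (mtop M) W) S"
  then obtain T where T: "openin (mtop M) T" and S: "S = T \<inter> W" by (auto simp: openin_subtopology)
  have "generate_topology_on {cdom M i \<inter> cmap M i -` Z | i Z. open Z} T"
    using openin_topology_generated_by[OF T[unfolded mtop_def]] .
  then have "openin (mtop (submanifold M W)) (T \<inter> W)"
  proof induction
    case (Int A B)
    have "A \<inter> B \<inter> W = (A \<inter> W) \<inter> (B \<inter> W)" by blast
    then show ?case using openin_Int[OF Int.IH] by simp
  next
    case (UN K)
    have "\<Union>K \<inter> W = \<Union>((\<lambda>k. k \<inter> W) ` K)" by blast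
    moreover have "openin (mtop (submanifold M W)) (\<Union>((\<lambda>k. k \<inter> W) ` K))"
      by (rule openin_Union) (use UN.IH in blast)
    ultimately show ?case by (simp only:)
  next
    case (Basis s)
    then obtain i Z where "s = cdom M i \<inter> cmap M i -` Z" "open Z" by blast
    then have "s \<inter> W = cdom (submanifold M W) i \<inter> cmap (submanifold M W) i -` Z" by auto
    then show ?case using openin_chart_preimage[OF \<open>open Z\<close>, of "submanifold M W" i] by (simp only:)
  qed simp
  then show "openin (mtop (submanifold M W)) S" using S by simp
qed

text \<open>\<open>inv_into\<close> depends on its domain, so inverse charts of a submanifold are
  known to agree with those of \<open>M\<close> only on chart images inside \<open>W\<close>. This
  is why chart expressions are compared on open sets below.\<close>

lemma cinv_submanifold:
  assumes "diff_atlas M" "q \<in> cdom M i" "q \<in> W"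
  shows "inv_into (cdom M i \<inter> W) (cmap M i) (cmap M i q) = q"
proof -
  have "inj_on (cmap M i) (cdom M i \<inter> W)" using diff_atlas_inj[OF assms(1)] by (rule inj_on_subset) blast
  then show ?thesis using assms by simp
qed

lemma submanifold_image:
  assumes M: "diff_atlas M"
  shows "cmap M i ` (cdom M i \<inter> W \<inter> (cdom M j \<inter> W)) =
      cmap M i ` (cdom M i \<inter> cdom M j) \<inter> cmap M i ` (W \<inter> cdom M i)"
  by (subst inj_on_image_Int[OF diff_atlas_inj[OF M, of i], symmetric]) (auto intro!: arg_cong[where f = "image _"])

lemma diff_atlas_submanifold:
  assumes M: "diff_atlas M" and W: "openin (mtop M) W"
  shows "diff_atlas (submanifold M W)"
  unfolding diff_atlas_def submanifold_simps
proof (intro conjI allI ballI)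
  show "inj_on (cmap M i) (cdom M i \<inter> W)" for i using diff_atlas_inj[OF M] by (rule inj_on_subset) blast
  show "open (cmap M i ` (cdom M i \<inter> W \<inter> (cdom M j \<inter> W)))" for i j
    unfolding submanifold_image[OF M] by (intro open_Int diff_atlas_open open_chart_image M W)
  fix i j q assume q: "q \<in> cdom M i \<inter> W \<inter> (cdom M j \<inter> W)"
  have "transition (submanifold M W) i j differentiable at (cmap M i q) \<longleftrightarrow> transition M i j differentiable at (cmap M i q)"
    by (rule differentiable_cong_open[OF open_chart_image(2)[OF M W]])
      (use q in \<open>auto simp: transition_def cinv_submanifold[OF M] cinv_cmap[OF M]\<close>)
  then show "transition (submanifold M W) i j differentiable at (cmap M i q)"
    using diff_atlas_transition[OF M] q by simp
qed

lemma analytic_atlas_submanifold: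
  assumes M: "analytic_atlas M" and W: "openin (mtop M) W"
  shows "analytic_atlas (submanifold M W)"
  unfolding analytic_atlas_def
proof (intro conjI allI)
  note M' = analytic_atlas_imp_diff[OF M]
  note S = diff_atlas_submanifold[OF M' W]
  show "inj_on (cmap (submanifold M W) i) (cdom (submanifold M W) i)" for i by (rule diff_atlas_inj[OF S])
  show op: "open (cmap (submanifold M W) i ` (cdom (submanifold M W) i \<inter> cdom (submanifold M W) j))" for i j
    by (rule diff_atlas_open[OF S])
  fix i j
  have "real_analytic_on (transition M i j) (cmap M i ` (cdom M i \<inter> cdom M j))"
    using M by (simp add: analytic_atlas_def)
  then have "real_analytic_on (transition M i j) (cmap (submanifold M W) i ` (cdom (submanifold M W) i \<inter> cdom (submanifold M W) j))"
    by (rule real_analytic_on_subset) auto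
  then show "real_analytic_on (transition (submanifold M W) i j)
      (cmap (submanifold M W) i ` (cdom (submanifold M W) i \<inter> cdom (submanifold M W) j))"
    by (rule real_analytic_on_cong[OF _ op]) (auto simp: transition_def cinv_submanifold[OF M'] cinv_cmap[OF M'])
qed

lemma analytic_manifold_submanifold:
  assumes "analytic_manifold M" "openin (mtop M) W"
  shows "analytic_manifold (submanifold M W)"
  using assms analytic_atlas_submanifold
  by (auto simp: analytic_manifold_alt mtop_submanifold Hausdorff_space_subtopology second_countable_subtopology)

lemma transition_submanifold_deriv:
  assumes M: "diff_atlas M" and W: "openin (mtop M) W" and q: "q \<in> W" "q \<in> cdom M i"
  shows "frechet_derivative (transition (submanifold M W) i j) (at (cmap M i q)) =
     frechet_derivative (transition M i j) (at (cmap M i q))"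
  by (rule frechet_derivative_cong_open[OF open_chart_image(2)[OF M W]])
    (use q in \<open>auto simp: transition_def cinv_submanifold[OF M] cinv_cmap[OF M]\<close>)

lemma tangent_space_submanifold:
  assumes M: "diff_atlas M" and W: "openin (mtop M) W" and q: "q \<in> W"
  shows "tangent_space (submanifold M W) q = tangent_space M q"
  unfolding tangent_space_def using transition_submanifold_deriv[OF M W q] q by auto

text \<open>An outright equality of atlases is possible because tangent vectors of the open
  submanifold are the same families of components.\<close>

lemma tangent_bundle_submanifold:
  assumes M: "diff_atlas M" and W: "openin (mtop M) W"
  shows "tangent_bundle (submanifold M W) = submanifold (tangent_bundle M) (fst -` W)"
  unfolding tangent_bundle_def submanifold_def[of _ "fst -` W"]
  using tangent_space_submanifold[OF M W] by (auto simp: fun_eq_iff)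

section \<open>Symmetric products of vector fields\<close>

lemma analytic_atlas_transition:
  "analytic_atlas M \<Longrightarrow> real_analytic_on (transition M i j) (cmap M i ` (cdom M i \<inter> cdom M j))"
  by (simp add: analytic_atlas_def)

lemma vector_fieldD:
  assumes "vector_field M X"
  shows vector_field_in: "q \<in> points M \<Longrightarrow> X q \<in> tangent_space M q"
    and vector_field_analytic: "real_analytic_on (\<lambda>x. X (cinv M i x) i) (cmap M i ` cdom M i)"
  using assms by (auto simp: vector_field_def)

lemma vector_field_notin: "vector_field M X \<Longrightarrow> q \<in> points M \<Longrightarrow> q \<notin> cdom M i \<Longrightarrow> X q i = 0"
  by (rule tangent_spaceD(1)[OF vector_field_in])

lemma symmetric_connectionD:
  assumes "symmetric_connection M \<Gamma>"
  shows connection_bilinear: "q \<in> cdom M i \<Longrightarrow> bilinear (\<Gamma> i q)"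
    and connection_sym: "q \<in> cdom M i \<Longrightarrow> \<Gamma> i q v w = \<Gamma> i q w v"
    and connection_analytic: "real_analytic_on (\<lambda>x. \<Gamma> i (cinv M i x) v w) (cmap M i ` cdom M i)"
    and connection_change: "q \<in> cdom M i \<Longrightarrow> q \<in> cdom M j \<Longrightarrow>
      frechet_derivative (transition M i j) (at (cmap M i q)) (\<Gamma> i q v w) =
        frechet_derivative (\<lambda>z. frechet_derivative (transition M i j) (at z) w) (at (cmap M i q)) v
        + \<Gamma> j q (frechet_derivative (transition M i j) (at (cmap M i q)) v)
            (frechet_derivative (transition M i j) (at (cmap M i q)) w)"
  using assms unfolding symmetric_connection_def Let_def by blast+

lemma bilinear_euclidean:
  fixes v :: "'e::euclidean_space"
  assumes "bilinear B"
  shows "B v w = (\<Sum>b\<in>Basis. \<Sum>c\<in>Basis. ((v \<bullet> b) * (w \<bullet> c)) *\<^sub>R B b c)"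
proof -
  have "B v w = B (\<Sum>b\<in>Basis. (v \<bullet> b) *\<^sub>R b) (\<Sum>c\<in>Basis. (w \<bullet> c) *\<^sub>R c)"
    by (simp only: euclidean_representation)
  also have "\<dots> = (\<Sum>(b, c)\<in>Basis \<times> Basis. B ((v \<bullet> b) *\<^sub>R b) ((w \<bullet> c) *\<^sub>R c))"
    by (rule bilinear_sum[OF assms])
  also have "\<dots> = (\<Sum>b\<in>Basis. \<Sum>c\<in>Basis. ((v \<bullet> b) * (w \<bullet> c)) *\<^sub>R B b c)"
    by (simp add: sum.cartesian_product bilinear_lmul[OF assms] bilinear_rmul[OF assms] mult.commute)
  finally show ?thesis .
qed

lemma vector_field_has_derivative:
  assumes "diff_atlas M" "vector_field M X" "q \<in> cdom M i"
  shows "((\<lambda>x. X (cinv M i x) i) has_derivative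
     frechet_derivative (\<lambda>x. X (cinv M i x) i) (at (cmap M i q))) (at (cmap M i q))"
  by (rule real_analytic_on_has_derivative[OF vector_field_analytic[OF assms(2)]]) (use assms in blast)

lemma cov_deriv_chart:
  "q \<in> cdom M i \<Longrightarrow> cov_deriv M \<Gamma> X Y q i =
     frechet_derivative (\<lambda>x. Y (cinv M i x) i) (at (cmap M i q)) (X q i) + \<Gamma> i q (X q i) (Y q i)"
  by (simp add: cov_deriv_def)

text \<open>Neither term of the coordinate formula is tensorial: under a change of chart
  \<open>h\<close>, differentiating \<open>Y\<close> produces the second derivative of
  \<open>h\<close> on \<open>X\<close> and \<open>Y\<close>, and the Christoffel term produces the
  same with opposite sign.\<close>

lemma vector_field_cov_deriv:
  assumes M: "analytic_atlas M" and \<Gamma>: "symmetric_connection M \<Gamma>"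
    and X: "vector_field M X" and Y: "vector_field M Y"
  shows "vector_field M (cov_deriv M \<Gamma> X Y)"
  unfolding vector_field_def
proof (intro conjI ballI allI)
  note M' = analytic_atlas_imp_diff[OF M]
  fix q assume q: "q \<in> points M"
  show "cov_deriv M \<Gamma> X Y q \<in> tangent_space M q"
    unfolding tangent_space_def
  proof (intro CollectI conjI allI impI)
    show "cov_deriv M \<Gamma> X Y q i = 0" if "q \<notin> cdom M i" for i using that by (simp add: cov_deriv_def)
    fix i j assume "q \<in> cdom M i \<inter> cdom M j"
    then have qi: "q \<in> cdom M i" and qj: "q \<in> cdom M j" by auto
    define h where "h = transition M i j"
    define x where "x = cmap M i q"
    define D where "D = (\<lambda>z. frechet_derivative h (at z))"
    let ?Yi = "\<lambda>x. Y (cinv M i x) i" and ?Yj = "\<lambda>x. Y (cinv M j x) j"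
    let ?O = "cmap M i ` (cdom M i \<inter> cdom M j)"
    have Op: "open ?O" "x \<in> ?O" using diff_atlas_open[OF M'] qi qj by (auto simp: x_def)
    have an: "real_analytic_on h ?O" using analytic_atlas_transition[OF M] by (simp add: h_def)
    have hx: "h x = cmap M j q" unfolding h_def x_def by (rule transition_cmap[OF M' qi])
    have Yi: "(?Yi has_derivative frechet_derivative ?Yi (at x)) (at x)"
      unfolding x_def by (rule vector_field_has_derivative[OF M' Y qi])
    have Yj: "(?Yj has_derivative frechet_derivative ?Yj (at (h x))) (at (h x))"
      unfolding hx by (rule vector_field_has_derivative[OF M' Y qj])
    have dh: "(h has_derivative D x) (at x)"
      unfolding D_def by (rule real_analytic_on_has_derivative[OF an Op(2)])
    have eq: "?Yj (h z) = D z (?Yi z)" if zO: "z \<in> ?O" for z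
    proof -
      obtain p where p: "p \<in> cdom M i" "p \<in> cdom M j" "z = cmap M i p" using zO by blast
      have "Y p j = frechet_derivative (transition M i j) (at (cmap M i p)) (Y p i)"
        using tangent_spaceD(2)[OF vector_field_in[OF Y] p(1,2)] p by (auto simp: points_iff)
      then show ?thesis
        unfolding D_def h_def p(3) by (simp add: transition_cmap[OF M'] cinv_cmap[OF M'] p(1,2))
    qed
    \<comment> \<open>The two sides of \<open>eq\<close> are differentiated separately, one by the
      chain rule and one by the product rule; uniqueness of the derivative gives
      \<open>main\<close>.\<close>
    have "((\<lambda>z. ?Yj (h z)) has_derivative (\<lambda>v. frechet_derivative ?Yj (at (h x)) (D x v))) (at x)"
      using diff_chain_at[OF dh Yj] by (simp add: o_def)
    then have 1: "((\<lambda>z. D z (?Yi z)) has_derivative (\<lambda>v. frechet_derivative ?Yj (at (h x)) (D x v))) (at x)"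
      by (rule has_derivative_transform_within_open[OF _ Op]) (rule eq)
    have 2: "((\<lambda>z. D z (?Yi z)) has_derivative (\<lambda>v. frechet_derivative (\<lambda>z. D z (?Yi x)) (at x) v
        + D x (frechet_derivative ?Yi (at x) v))) (at x)"
      unfolding D_def by (rule has_derivative_deriv[OF an Op Yi])
    have main: "frechet_derivative ?Yj (at (h x)) (D x v) = frechet_derivative (\<lambda>z. D z (?Yi x)) (at x) v
        + D x (frechet_derivative ?Yi (at x) v)" for v
      by (rule fun_cong[OF has_derivative_unique[OF 1 2]])
    have Yix: "?Yi x = Y q i" unfolding x_def by (simp only: cinv_cmap[OF M' qi])
    have lin: "linear (D x)" unfolding D_def h_def x_def by (rule linear_transition_deriv[OF M' qi qj])
    have Xj: "X q j = D x (X q i)" and Yjq: "Y q j = D x (Y q i)"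
      unfolding D_def h_def x_def by (rule tangent_spaceD(2)[OF vector_field_in qi qj]; fact)+
    have G: "D x (\<Gamma> i q (X q i) (Y q i)) =
        frechet_derivative (\<lambda>z. D z (Y q i)) (at x) (X q i) + \<Gamma> j q (X q j) (Y q j)"
      unfolding Xj Yjq unfolding D_def h_def x_def by (rule connection_change[OF \<Gamma> qi qj])
    have "cov_deriv M \<Gamma> X Y q j = frechet_derivative ?Yj (at (h x)) (D x (X q i)) + \<Gamma> j q (X q j) (Y q j)"
      unfolding cov_deriv_chart[OF qj] hx Xj[symmetric] ..
    also have "\<dots> = D x (frechet_derivative ?Yi (at x) (X q i)) + D x (\<Gamma> i q (X q i) (Y q i))"
      unfolding main Yix G by simp
    also have "\<dots> = D x (cov_deriv M \<Gamma> X Y q i)"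
      by (simp only: cov_deriv_chart[OF qi] linear_add[OF lin] x_def[symmetric])
    finally show "cov_deriv M \<Gamma> X Y q j = frechet_derivative (transition M i j) (at (cmap M i q)) (cov_deriv M \<Gamma> X Y q i)"
      unfolding D_def h_def x_def .
  qed
next
  note M' = analytic_atlas_imp_diff[OF M]
  fix i
  let ?X = "\<lambda>x. X (cinv M i x) i" and ?Y = "\<lambda>x. Y (cinv M i x) i"
  note Xa = vector_field_analytic[OF X, of i] and Ya = vector_field_analytic[OF Y, of i]
  show "real_analytic_on (\<lambda>x. cov_deriv M \<Gamma> X Y (cinv M i x) i) (cmap M i ` cdom M i)"
  proof (rule real_analytic_on_cong[OF _ open_chart[OF M']])
    \<comment> \<open>Christoffel symbols are given as analytic only for constant arguments, so the
      bilinear term is expanded in the basis.\<close>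
    show "real_analytic_on (\<lambda>x. frechet_derivative ?Y (at x) (?X x) +
        (\<Sum>b\<in>Basis. \<Sum>c\<in>Basis. (?X x \<bullet> b) *\<^sub>R ((?Y x \<bullet> c) *\<^sub>R \<Gamma> i (cinv M i x) b c))) (cmap M i ` cdom M i)"
      by (intro real_analytic_on_add real_analytic_on_sum real_analytic_on_scaleR
          real_analytic_on_deriv[OF Ya Xa open_chart[OF M']] connection_analytic[OF \<Gamma>]
          real_analytic_on_bounded_linear[OF bounded_linear_inner_left] Xa Ya)
    fix x assume "x \<in> cmap M i ` cdom M i"
    then obtain q where q: "q \<in> cdom M i" "x = cmap M i q" by blast
    have c: "cinv M i x = q" using q cinv_cmap[OF M'] by simp
    show "frechet_derivative ?Y (at x) (?X x) +
        (\<Sum>b\<in>Basis. \<Sum>c\<in>Basis. (?X x \<bullet> b) *\<^sub>R ((?Y x \<bullet> c) *\<^sub>R \<Gamma> i (cinv M i x) b c)) =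
        cov_deriv M \<Gamma> X Y (cinv M i x) i"
      unfolding c cov_deriv_chart[OF q(1)] bilinear_euclidean[OF connection_bilinear[OF \<Gamma> q(1)], of "X q i"]
      by (simp add: q(2))
  qed
qed

lemma vector_field_lincomb:
  assumes M: "analytic_atlas M" and X: "vector_field M X" and Y: "vector_field M Y" and f: "analytic_function M f"
  shows "vector_field M (\<lambda>q i. f q *\<^sub>R X q i + Y q i)"
  unfolding vector_field_def
proof (intro conjI ballI allI)
  note M' = analytic_atlas_imp_diff[OF M]
  show "(\<lambda>i. f q *\<^sub>R X q i + Y q i) \<in> tangent_space M q" if "q \<in> points M" for q
    using tangent_space_lincomb[OF M' vector_field_in[OF X that] vector_field_in[OF Y that], of "f q" 1] by simp
  fix i
  have "real_analytic_on (\<lambda>x. f (cinv M i x)) (cmap M i ` cdom M i)"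
    using f by (simp add: analytic_function_def o_def)
  then show "real_analytic_on (\<lambda>x. f (cinv M i x) *\<^sub>R X (cinv M i x) i + Y (cinv M i x) i) (cmap M i ` cdom M i)"
    by (intro real_analytic_on_add real_analytic_on_scaleR vector_field_analytic X Y)
qed

lemma vector_field_cong:
  assumes M: "analytic_atlas M" and X: "vector_field M X" and e: "\<And>q. q \<in> points M \<Longrightarrow> X q = Y q"
  shows "vector_field M Y"
  unfolding vector_field_def
proof (intro conjI ballI allI)
  note M' = analytic_atlas_imp_diff[OF M]
  show "Y q \<in> tangent_space M q" if "q \<in> points M" for q
    using vector_field_in[OF X that] e[OF that] by simp
  show "real_analytic_on (\<lambda>x. Y (cinv M i x) i) (cmap M i ` cdom M i)" for i
  proof (rule real_analytic_on_cong[OF vector_field_analytic[OF X] open_chart[OF M']])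
    fix x assume "x \<in> cmap M i ` cdom M i"
    then have "cinv M i x \<in> points M" by (auto simp: cinv_cmap[OF M'] points_iff)
    then show "X (cinv M i x) i = Y (cinv M i x) i" using e by simp
  qed
qed

lemma vector_field_0:
  assumes "analytic_atlas M"
  shows "vector_field M (\<lambda>q i. 0)"
  unfolding vector_field_def using tangent_space_0[OF analytic_atlas_imp_diff[OF assms]] by simp

lemma analytic_function_const: "analytic_function M (\<lambda>q. c)"
  by (simp add: analytic_function_def o_def)

lemma analytic_function_mult: "analytic_function M f \<Longrightarrow> analytic_function M g \<Longrightarrow> analytic_function M (\<lambda>q. f q * g q)"
  using real_analytic_on_scaleR unfolding analytic_function_def o_def by fastforce

lemma vector_field_sym_prod:
  assumes M: "analytic_atlas M" and "symmetric_connection M \<Gamma>" "vector_field M X" "vector_field M Y"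
  shows "vector_field M (sym_prod M \<Gamma> X Y)"
  using vector_field_lincomb[OF M vector_field_cov_deriv[OF assms(1-4)]
      vector_field_cov_deriv[OF assms(1,2,4,3)] analytic_function_const[of M 1]]
  by (simp add: sym_prod_def[abs_def])

section \<open>Lie derivatives and modules of vector fields\<close>

definition lie_deriv ::
    "('i, 'a, 'e::euclidean_space) atlas \<Rightarrow> ('a \<Rightarrow> 'i \<Rightarrow> 'e) \<Rightarrow> ('a \<Rightarrow> real) \<Rightarrow> 'a \<Rightarrow> real" where
  "lie_deriv M X f q = (let i = (SOME i. q \<in> cdom M i)
     in frechet_derivative (f \<circ> cinv M i) (at (cmap M i q)) (X q i))"

lemma analytic_function_differentiable:
  assumes "diff_atlas M" "analytic_function M f" "q \<in> cdom M i"
  shows "(f \<circ> cinv M i) differentiable at (cmap M i q)"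
  using real_analytic_on_differentiable[of "f \<circ> cinv M i" "cmap M i ` cdom M i"] assms
  by (auto simp: analytic_function_def)

lemma lie_deriv_chart:
  assumes M: "diff_atlas M" and X: "vector_field M X" and f: "analytic_function M f" and q: "q \<in> cdom M i"
  shows "lie_deriv M X f q = frechet_derivative (f \<circ> cinv M i) (at (cmap M i q)) (X q i)"
proof -
  define k where "k = (SOME k. q \<in> cdom M k)"
  have k: "q \<in> cdom M k" unfolding k_def using q by (rule someI)
  have "q \<in> points M" using q by (auto simp: points_iff)
  have "lie_deriv M X f q = frechet_derivative (f \<circ> cinv M k) (at (cmap M k q)) (X q k)"
    by (simp add: lie_deriv_def k_def Let_def)
  also have "\<dots> = frechet_derivative (f \<circ> cinv M i) (at (cmap M i q)) (X q i)"
    unfolding rep_source_change(1)[OF M k q analytic_function_differentiable[OF M f q]]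
      tangent_spaceD(2)[OF vector_field_in[OF X \<open>q \<in> points M\<close>] k q] ..
  finally show ?thesis .
qed

lemma analytic_function_lie_deriv:
  assumes M: "analytic_atlas M" and X: "vector_field M X" and f: "analytic_function M f"
  shows "analytic_function M (lie_deriv M X f)"
  unfolding analytic_function_def
proof
  note M' = analytic_atlas_imp_diff[OF M]
  fix i
  show "real_analytic_on (lie_deriv M X f \<circ> cinv M i) (cmap M i ` cdom M i)"
  proof (rule real_analytic_on_cong[OF real_analytic_on_deriv[OF _ vector_field_analytic[OF X] open_chart[OF M']] open_chart[OF M']])
    show "real_analytic_on (f \<circ> cinv M i) (cmap M i ` cdom M i)" using f by (simp add: analytic_function_def)
    fix x assume "x \<in> cmap M i ` cdom M i"
    then obtain q where q: "q \<in> cdom M i" "x = cmap M i q" by blast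
    show "frechet_derivative (f \<circ> cinv M i) (at x) (X (cinv M i x) i) = (lie_deriv M X f \<circ> cinv M i) x"
      unfolding q(2) o_apply[of "lie_deriv M X f"] cinv_cmap[OF M' q(1)] lie_deriv_chart[OF M' X f q(1)] ..
  qed
qed

lemma sym_prod_commute: "sym_prod M \<Gamma> X Y = sym_prod M \<Gamma> Y X"
  by (simp add: sym_prod_def add.commute)

lemma cov_deriv_cong:
  assumes M: "diff_atlas M" and X: "\<And>q. q \<in> points M \<Longrightarrow> X q = X' q" and Y: "\<And>q. q \<in> points M \<Longrightarrow> Y q = Y' q"
  shows "cov_deriv M \<Gamma> X Y q i = cov_deriv M \<Gamma> X' Y' q i"
proof (cases "q \<in> cdom M i")
  case True
  then have qp: "q \<in> points M" by (auto simp: points_iff)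
  have "frechet_derivative (\<lambda>x. Y (cinv M i x) i) (at (cmap M i q)) = frechet_derivative (\<lambda>x. Y' (cinv M i x) i) (at (cmap M i q))"
  proof (rule frechet_derivative_cong_open[OF open_chart[OF M]])
    show "cmap M i q \<in> cmap M i ` cdom M i" using True by blast
    fix x assume "x \<in> cmap M i ` cdom M i"
    then have "cinv M i x \<in> points M" by (auto simp: cinv_cmap[OF M] points_iff)
    then show "Y (cinv M i x) i = Y' (cinv M i x) i" using Y by simp
  qed
  then show ?thesis by (simp add: cov_deriv_chart[OF True] X[OF qp] Y[OF qp])
qed (simp add: cov_deriv_def)

lemma sym_prod_cong:
  assumes M: "diff_atlas M" and X: "\<And>q. q \<in> points M \<Longrightarrow> X q = X' q" and Y: "\<And>q. q \<in> points M \<Longrightarrow> Y q = Y' q"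
  shows "sym_prod M \<Gamma> X Y = sym_prod M \<Gamma> X' Y'"
proof -
  have "cov_deriv M \<Gamma> X Y = cov_deriv M \<Gamma> X' Y'" "cov_deriv M \<Gamma> Y X = cov_deriv M \<Gamma> Y' X'"
    by (intro ext, rule cov_deriv_cong[OF M X Y], assumption+)
      (intro ext, rule cov_deriv_cong[OF M Y X], assumption+)
  then show ?thesis by (simp add: sym_prod_def)
qed

text \<open>
  By this identity, the module generated by the iterated products is closed under symmetric products,
  so the values of \<open>Sym\<close> at a point are linear combinations of values of iterated products.
\<close>

lemma sym_prod_lincomb:
  assumes M: "analytic_atlas M" and \<Gamma>: "symmetric_connection M \<Gamma>"
    and X: "vector_field M X" and Y: "vector_field M Y" and Z: "vector_field M Z"
    and f: "analytic_function M f" and q: "q \<in> points M"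
  shows "sym_prod M \<Gamma> (\<lambda>q i. f q *\<^sub>R Z q i + X q i) Y q i =
     f q *\<^sub>R sym_prod M \<Gamma> Z Y q i + (lie_deriv M Y f q *\<^sub>R Z q i + sym_prod M \<Gamma> X Y q i)"
proof (cases "q \<in> cdom M i")
  case False
  then show ?thesis using vector_field_notin[OF Z q False] by (simp add: sym_prod_def cov_deriv_def)
next
  case True
  note M' = analytic_atlas_imp_diff[OF M]
  let ?c = "cinv M i" and ?x = "cmap M i q"
  let ?D = "\<lambda>X. frechet_derivative (\<lambda>x. X (?c x) i) (at ?x)"
  have fd: "((\<lambda>x. f (?c x)) has_derivative frechet_derivative (\<lambda>x. f (?c x)) (at ?x)) (at ?x)"
    using analytic_function_differentiable[OF M' f True] unfolding o_def frechet_derivative_works .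
  have "((\<lambda>x. f (?c x) *\<^sub>R Z (?c x) i + X (?c x) i) has_derivative
      (\<lambda>h. f (?c ?x) *\<^sub>R ?D Z h + frechet_derivative (\<lambda>x. f (?c x)) (at ?x) h *\<^sub>R Z (?c ?x) i + ?D X h)) (at ?x)"
    by (rule has_derivative_add[OF has_derivative_scaleR[OF fd vector_field_has_derivative[OF M' Z True]]
          vector_field_has_derivative[OF M' X True]])
  then have D: "frechet_derivative (\<lambda>x. f (?c x) *\<^sub>R Z (?c x) i + X (?c x) i) (at ?x) h =
      f q *\<^sub>R ?D Z h + frechet_derivative (\<lambda>x. f (?c x)) (at ?x) h *\<^sub>R Z q i + ?D X h" for h
    unfolding cinv_cmap[OF M' True] by (rule fun_cong[OF frechet_derivative_at[symmetric]])
  have L: "lie_deriv M Y f q = frechet_derivative (\<lambda>x. f (?c x)) (at ?x) (Y q i)"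
    using lie_deriv_chart[OF M' Y f True] by (simp add: o_def)
  have linY: "linear (?D Y)" using vector_field_has_derivative[OF M' Y True] by (rule has_derivative_linear)
  note bl = connection_bilinear[OF \<Gamma> True]
  show ?thesis
    unfolding sym_prod_def cov_deriv_chart[OF True] D L
    by (simp add: linear_add[OF linY] linear_scale[OF linY] bilinear_ladd[OF bl] bilinear_radd[OF bl]
        bilinear_lmul[OF bl] bilinear_rmul[OF bl] algebra_simps)
qed

text \<open>Members are built from the generators by symmetric products alone, so each can be
  followed through a map that relates the generators. The function coefficients occurring in
  \<open>Sym\<close> could not.\<close>

inductive_set iterated_products ::
    "('i, 'a, 'e::euclidean_space) atlas \<Rightarrow> ('i \<Rightarrow> 'a \<Rightarrow> 'e \<Rightarrow> 'e \<Rightarrow> 'e)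
     \<Rightarrow> ('a \<Rightarrow> 'i \<Rightarrow> 'e) set \<Rightarrow> ('a \<Rightarrow> 'i \<Rightarrow> 'e) set"
  for M \<Gamma> G where
  gen: "X \<in> G \<Longrightarrow> X \<in> iterated_products M \<Gamma> G"
| prod: "X \<in> iterated_products M \<Gamma> G \<Longrightarrow> Y \<in> iterated_products M \<Gamma> G \<Longrightarrow>
     sym_prod M \<Gamma> X Y \<in> iterated_products M \<Gamma> G"

text \<open>
  The values of a member outside the manifold are unrestricted, because vector fields that agree on
  the manifold have to be identified.
\<close>

inductive module_span ::
    "('i, 'a, 'e::euclidean_space) atlas \<Rightarrow> ('a \<Rightarrow> 'i \<Rightarrow> 'e) set \<Rightarrow> ('a \<Rightarrow> 'i \<Rightarrow> 'e) \<Rightarrow> bool"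
  for M E where
  zero: "(\<And>q. q \<in> points M \<Longrightarrow> X q = (\<lambda>i. 0)) \<Longrightarrow> module_span M E X"
| step: "module_span M E Y \<Longrightarrow> Z \<in> E \<Longrightarrow> analytic_function M f \<Longrightarrow>
     (\<And>q. q \<in> points M \<Longrightarrow> X q = (\<lambda>i. f q *\<^sub>R Z q i + Y q i)) \<Longrightarrow> module_span M E X"

lemma module_span_cong:
  assumes "module_span M E X" "\<And>q. q \<in> points M \<Longrightarrow> X' q = X q"
  shows "module_span M E X'"
  using assms
proof cases
  case zero then show ?thesis using assms(2) by (intro module_span.zero) simp
next
  case (step Y Z f) then show ?thesis using assms(2) by (intro module_span.step[OF step(1-3)]) simp
qed

lemma module_span_vector_field:
  assumes M: "analytic_atlas M" and E: "\<And>Z. Z \<in> E \<Longrightarrow> vector_field M Z" and X: "module_span M E X"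
  shows "vector_field M X"
  using X
proof induction
  case (zero X) then show ?case using vector_field_cong[OF M vector_field_0[OF M]] by metis
next
  case (step Y Z f X)
  show ?case
    by (rule vector_field_cong[OF M vector_field_lincomb[OF M E[OF step(2)] step.IH step(3)]])
      (rule step(4)[symmetric])
qed

lemma module_span_add:
  assumes "module_span M E X" and Y: "module_span M E Y"
  shows "module_span M E (\<lambda>q i. X q i + Y q i)"
  using assms(1)
proof induction
  case (zero X) then show ?case by (intro module_span_cong[OF Y]) simp
next
  case (step X' Z f X)
  show ?case by (rule module_span.step[OF step.IH step(2,3)]) (simp add: step(4) add.assoc)
qed

lemma module_span_scale:
  assumes X: "module_span M E X" and f: "analytic_function M f"
  shows "module_span M E (\<lambda>q i. f q *\<^sub>R X q i)"
  using X
proof induction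
  case (zero X) then show ?case by (intro module_span.zero) simp
next
  case (step X' Z g X)
  show ?case
    by (rule module_span.step[OF step.IH step(2) analytic_function_mult[OF f step(3)]])
      (simp add: step(4) scaleR_add_right)
qed

lemma module_span_gen: "Z \<in> E \<Longrightarrow> module_span M E Z"
  by (rule module_span.step[OF module_span.zero[of M "\<lambda>q i. 0"] _ analytic_function_const[of M 1]]) simp_all

text \<open>\<open>sym_prod_lincomb\<close> peels off one summand of the first argument, and its Lie
  derivative term stays in the module. One induction treats the second argument against a generator,
  another the first argument; both use \<open>prod_step\<close>.\<close>

lemma module_span_sym_prod:
  assumes M: "analytic_atlas M" and \<Gamma>: "symmetric_connection M \<Gamma>"
    and E: "\<And>Z. Z \<in> E \<Longrightarrow> vector_field M Z" and EE: "\<And>X Y. X \<in> E \<Longrightarrow> Y \<in> E \<Longrightarrow> sym_prod M \<Gamma> X Y \<in> E"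
    and X: "module_span M E X" and Y: "module_span M E Y"
  shows "module_span M E (sym_prod M \<Gamma> X Y)"
proof -
  note M' = analytic_atlas_imp_diff[OF M]
  have vf: "vector_field M X" if "module_span M E X" for X
    by (rule module_span_vector_field[OF M E that])
  have prod_zero: "module_span M E (sym_prod M \<Gamma> X Y)" if "\<And>q. q \<in> points M \<Longrightarrow> X q = (\<lambda>i. 0)" "vector_field M Y" for X Y
  proof (rule module_span.zero)
    fix q assume q: "q \<in> points M"
    \<comment> \<open>For zero fields and the coefficient \<open>1\<close>, the linear combination
      formula reads \<open>P = P + P\<close>.\<close>
    have "sym_prod M \<Gamma> X Y q i = 0" for i
      unfolding sym_prod_cong[of M X "\<lambda>q i. 0" Y Y, OF M' that(1) refl, simplified]
      using sym_prod_lincomb[OF M \<Gamma> vector_field_0[OF M] that(2) vector_field_0[OF M] analytic_function_const[of M 1] q, of i]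
      by simp
    then show "sym_prod M \<Gamma> X Y q = (\<lambda>i. 0)" by blast
  qed
  have prod_step: "module_span M E (sym_prod M \<Gamma> X Y)"
    if "module_span M E (sym_prod M \<Gamma> X' Y)" "module_span M E (sym_prod M \<Gamma> Z Y)"
       "Z \<in> E" "module_span M E X'" "analytic_function M f" "module_span M E Y"
       "\<And>q. q \<in> points M \<Longrightarrow> X q = (\<lambda>i. f q *\<^sub>R Z q i + X' q i)" for X X' Y Z f
  proof -
    have "module_span M E (\<lambda>q i. f q *\<^sub>R sym_prod M \<Gamma> Z Y q i + (lie_deriv M Y f q *\<^sub>R Z q i + sym_prod M \<Gamma> X' Y q i))"
      by (rule module_span_add[OF module_span_scale[OF that(2,5)] module_span_add[OF module_span_scale[OF
            module_span_gen[OF that(3)] analytic_function_lie_deriv[OF M vf[OF that(6)] that(5)]] that(1)]])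
    moreover have "sym_prod M \<Gamma> X Y = sym_prod M \<Gamma> (\<lambda>q i. f q *\<^sub>R Z q i + X' q i) Y"
      by (rule sym_prod_cong[OF M' that(7) refl])
    ultimately show ?thesis
      by (elim module_span_cong) (auto simp: sym_prod_lincomb[OF M \<Gamma> vf[OF that(4)] vf[OF that(6)] E[OF that(3)] that(5)])
  qed
  \<comment> \<open>Commutativity moves the argument under induction to the front, where
    \<open>prod_step\<close> decomposes it.\<close>
  have ZY: "module_span M E (sym_prod M \<Gamma> Z Y)" if Z: "Z \<in> E" for Z
    using Y
  proof induction
    case (zero Y) show ?case unfolding sym_prod_commute[of M \<Gamma> Z] by (rule prod_zero[OF zero E[OF Z]])
  next
    case (step Y' W f Y)
    show ?case unfolding sym_prod_commute[of M \<Gamma> Z]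
      by (rule prod_step[OF _ _ step(2,1,3) module_span_gen[OF Z] step(4)])
        (use step.IH sym_prod_commute[of M \<Gamma> Z] EE[OF step(2) Z] module_span_gen in auto)
  qed
  show ?thesis using X
  proof induction
    case (zero X) show ?case by (rule prod_zero[OF zero vf[OF Y]])
  next
    case (step X' W f X)
    show ?case by (rule prod_step[OF step.IH ZY[OF step(2)] step(2,1,3) Y step(4)])
  qed
qed

text \<open>At a fixed point the coefficient functions are merely scalars.\<close>

lemma module_span_value:
  assumes "module_span M E X" "q \<in> points M"
  shows "X q i \<in> span ((\<lambda>Z. Z q i) ` E)"
  using assms(1)
proof induction
  case (zero X) then show ?case using assms(2) by (simp add: span_zero)
next
  case (step Y Z f X)
  show ?case unfolding step(4)[OF assms(2)]
    by (intro span_add span_scale step.IH span_base imageI[of Z E "\<lambda>Z. Z q i"] step(2))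
qed

lemma iterated_products_vector_field:
  assumes M: "analytic_atlas M" and \<Gamma>: "symmetric_connection M \<Gamma>" and G: "\<And>X. X \<in> G \<Longrightarrow> vector_field M X"
    and X: "X \<in> iterated_products M \<Gamma> G"
  shows "vector_field M X"
  using X by induction (auto intro: G vector_field_sym_prod[OF M \<Gamma>])

text \<open>The module generated by the iterated products is one of the distributions whose
  intersection is \<open>Sym\<close>.\<close>

lemma Sym_module_span:
  assumes M: "analytic_atlas M" and \<Gamma>: "symmetric_connection M \<Gamma>" and G: "\<And>X. X \<in> G \<Longrightarrow> vector_field M X"
    and X: "X \<in> Sym M \<Gamma> G"
  shows "module_span M (iterated_products M \<Gamma> G) X"
proof -
  let ?E = "iterated_products M \<Gamma> G"
  have E: "vector_field M X" if "X \<in> ?E" for X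
    by (rule iterated_products_vector_field[OF M \<Gamma> G that])
  let ?D = "{X. module_span M ?E X}"
  have "distribution M ?D"
    unfolding distribution_def
    using module_span_vector_field[where E = ?E, OF M E]
    by (auto intro: module_span.zero module_span_add module_span_scale)
  moreover have "G \<subseteq> ?D" by (auto intro: module_span_gen iterated_products.gen)
  moreover have "\<forall>X\<in>?D. \<forall>Y\<in>?D. sym_prod M \<Gamma> X Y \<in> ?D"
    using module_span_sym_prod[where E = ?E, OF M \<Gamma> E iterated_products.prod] by blast
  ultimately show ?thesis using X unfolding Sym_def by blast
qed

lemma Sym_closed:
  shows Sym_gen: "X \<in> G \<Longrightarrow> X \<in> Sym M \<Gamma> G"
    and Sym_0: "(\<lambda>q i. 0) \<in> Sym M \<Gamma> G"
    and Sym_add: "X \<in> Sym M \<Gamma> G \<Longrightarrow> Y \<in> Sym M \<Gamma> G \<Longrightarrow> (\<lambda>q i. X q i + Y q i) \<in> Sym M \<Gamma> G"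
    and Sym_scale: "analytic_function M f \<Longrightarrow> X \<in> Sym M \<Gamma> G \<Longrightarrow> (\<lambda>q i. f q *\<^sub>R X q i) \<in> Sym M \<Gamma> G"
    and Sym_sym_prod: "X \<in> Sym M \<Gamma> G \<Longrightarrow> Y \<in> Sym M \<Gamma> G \<Longrightarrow> sym_prod M \<Gamma> X Y \<in> Sym M \<Gamma> G"
  unfolding Sym_def distribution_def by auto

lemma iterated_products_Sym: "X \<in> iterated_products M \<Gamma> G \<Longrightarrow> X \<in> Sym M \<Gamma> G"
  by (induction rule: iterated_products.induct) (auto intro: Sym_gen Sym_sym_prod)

section \<open>Brackets of related fields in coordinates\<close>

text \<open>The mixed second derivatives of \<open>F\<close> cancel in the antisymmetrised expression.\<close>

lemma related_bracket:
  fixes F :: "'e::euclidean_space \<Rightarrow> 'f::euclidean_space"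
  assumes F: "real_analytic_on F S" and S: "open S" "z \<in> S"
    and K: "(K has_derivative K') (at z)" and L: "(L has_derivative L') (at z)"
    and Kt: "(Kt has_derivative Kt') (at (F z))" and Lt: "(Lt has_derivative Lt') (at (F z))"
    and rK: "\<And>z. z \<in> S \<Longrightarrow> frechet_derivative F (at z) (K z) = Kt (F z)"
    and rL: "\<And>z. z \<in> S \<Longrightarrow> frechet_derivative F (at z) (L z) = Lt (F z)"
  shows "frechet_derivative F (at z) (L' (K z) - K' (L z)) = Lt' (Kt (F z)) - Kt' (Lt (F z))"
proof -
  let ?D = "\<lambda>v z. frechet_derivative F (at z) v"
  have F': "(F has_derivative (\<lambda>v. ?D v z)) (at z)" by (rule real_analytic_on_has_derivative[OF F S(2)])
  have A: "frechet_derivative (?D (L z)) (at z) h + ?D (L' h) z = Lt' (?D h z)"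
    if L: "(L has_derivative L') (at z)" and Lt: "(Lt has_derivative Lt') (at (F z))"
      and rL: "\<And>z. z \<in> S \<Longrightarrow> ?D (L z) z = Lt (F z)" for L L' Lt Lt' h
  proof -
    have 1: "((\<lambda>z. ?D (L z) z) has_derivative
        (\<lambda>h. frechet_derivative (?D (L z)) (at z) h + ?D (L' h) z)) (at z)"
      by (rule has_derivative_deriv[OF F S L])
    have "((\<lambda>z. Lt (F z)) has_derivative (\<lambda>h. Lt' (?D h z))) (at z)"
      using diff_chain_at[OF F' Lt] by (simp add: o_def)
    then have 2: "((\<lambda>z. ?D (L z) z) has_derivative (\<lambda>h. Lt' (?D h z))) (at z)"
      by (rule has_derivative_transform_within_open[OF _ S]) (rule rL[symmetric])
    show ?thesis by (rule fun_cong[OF has_derivative_unique[OF 1 2]])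
  qed
  have lin: "linear (\<lambda>v. ?D v z)" using F' by (rule has_derivative_linear)
  have "?D (L' (K z) - K' (L z)) z = ?D (L' (K z)) z - ?D (K' (L z)) z"
    by (rule linear_diff[OF lin])
  also have "\<dots> = Lt' (?D (K z) z) - Kt' (?D (L z) z)"
  proof -
    have "a + x = p \<Longrightarrow> a' + y = q \<Longrightarrow> a = a' \<Longrightarrow> x - y = p - q" for a a' x y p q :: 'f by auto
    from this[OF A[OF L Lt rL, of "K z"] A[OF K Kt rK, of "L z"] frechet_derivative_commute[OF F S]]
    show ?thesis .
  qed
  finally show ?thesis unfolding rK[OF S(2)] rL[OF S(2)] .
qed

section \<open>Slices and joint differentiability\<close>

lemma has_derivative_slice_snd:
  fixes H :: "'a::real_normed_vector \<times> 'b::real_normed_vector \<Rightarrow> 'c::real_normed_vector"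
  assumes "(H has_derivative H') (at (a, w))"
  shows "((\<lambda>w. H (a, w)) has_derivative (\<lambda>\<eta>. H' (0, \<eta>))) (at w)"
proof -
  have "((\<lambda>w. (a, w)) has_derivative (\<lambda>\<eta>. (0, \<eta>))) (at w)" by (auto intro!: derivative_eq_intros)
  then show ?thesis using diff_chain_at[of "\<lambda>w. (a, w)" _ w H H'] assms by (simp add: o_def)
qed

lemma has_derivative_slice_fst:
  fixes H :: "'a::real_normed_vector \<times> 'b::real_normed_vector \<Rightarrow> 'c::real_normed_vector"
  assumes "(H has_derivative H') (at (a, w))"
  shows "((\<lambda>a. H (a, w)) has_derivative (\<lambda>\<xi>. H' (\<xi>, 0))) (at a)"
proof -
  have "((\<lambda>a. (a, w)) has_derivative (\<lambda>\<xi>. (\<xi>, 0))) (at a)" by (auto intro!: derivative_eq_intros)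
  then show ?thesis using diff_chain_at[of "\<lambda>a. (a, w)" _ a H H'] assms by (simp add: o_def)
qed

lemma differentiable_Pair:
  assumes "f differentiable (at x within S)" "g differentiable (at x within S)"
  shows "(\<lambda>x. (f x, g x)) differentiable (at x within S)"
proof -
  obtain f' g' where "(f has_derivative f') (at x within S)" "(g has_derivative g') (at x within S)"
    using assms unfolding differentiable_def by blast
  then have "((\<lambda>x. (f x, g x)) has_derivative (\<lambda>h. (f' h, g' h))) (at x within S)" by (rule has_derivative_Pair)
  then show ?thesis unfolding differentiable_def by blast
qed

lemma differentiable_fst_comp:
  fixes f :: "'a::real_normed_vector \<Rightarrow> 'c::real_normed_vector"
  assumes "f differentiable at (fst z)"
  shows "(\<lambda>z :: 'a \<times> 'b::real_normed_vector. f (fst z)) differentiable at z"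
proof -
  have "fst differentiable at z" by (metis bounded_linear_fst bounded_linear_imp_differentiable)
  then show ?thesis using differentiable_chain_at[of fst z f] assms by (simp add: o_def)
qed

text \<open>Linearity in the fibre variable reduces joint differentiability to finitely many
  functions of the base point.\<close>

lemma differentiable_fibre_linear:
  fixes P :: "'a::euclidean_space \<Rightarrow> 'a \<Rightarrow> 'c::real_normed_vector"
  assumes A: "open A" "a \<in> A" and lin: "\<And>a. a \<in> A \<Longrightarrow> linear (P a)"
    and d: "\<And>b. (\<lambda>a. P a b) differentiable at a"
  shows "(\<lambda>z. P (fst z) (snd z)) differentiable at (a, w)"
proof -
  have e: "(\<Sum>b\<in>Basis. (snd z \<bullet> b) *\<^sub>R P (fst z) b) = P (fst z) (snd z)" if "z \<in> A \<times> UNIV" for z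
  proof -
    interpret linear "P (fst z)" using lin that by auto
    have "P (fst z) (\<Sum>b\<in>Basis. (snd z \<bullet> b) *\<^sub>R b) = (\<Sum>b\<in>Basis. (snd z \<bullet> b) *\<^sub>R P (fst z) b)"
      by (simp add: sum scale)
    then show ?thesis by (simp only: euclidean_representation)
  qed
  have "(\<lambda>z. (snd z \<bullet> b) *\<^sub>R P (fst z) b) differentiable at (a, w)" for b
  proof (rule differentiable_scaleR)
    show "(\<lambda>z :: 'a \<times> 'a. snd z \<bullet> b) differentiable at (a, w)"
      by (rule bounded_linear_imp_differentiable)
        (rule bounded_linear_compose[OF bounded_linear_inner_left bounded_linear_snd])
  qed (rule differentiable_fst_comp, simp add: d)
  then have "(\<lambda>z. \<Sum>b\<in>Basis. (snd z \<bullet> b) *\<^sub>R P (fst z) b) differentiable at (a, w)"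
    by (intro differentiable_sum) auto
  then show ?thesis
    using differentiable_cong_open[where S = "A \<times> UNIV", OF open_Times[OF A(1) open_UNIV] _ e, of "(a, w)"] A(2) by simp
qed

lemma bilinear_linear:
  assumes "bilinear B"
  shows "linear (\<lambda>v. B v w)" "linear (B v)"
  using assms by (auto simp: bilinear_def)

lemma differentiable_fibre_quadratic:
  fixes G :: "'a::euclidean_space \<Rightarrow> 'a \<Rightarrow> 'a \<Rightarrow> 'c::real_normed_vector"
  assumes A: "open A" "a \<in> A" and bil: "\<And>a. a \<in> A \<Longrightarrow> bilinear (G a)"
    and d: "\<And>b c. (\<lambda>a. G a b c) differentiable at a"
  shows "(\<lambda>z. G (fst z) (snd z) (snd z)) differentiable at (a, w)"
proof -
  have e: "(\<Sum>b\<in>Basis. (snd z \<bullet> b) *\<^sub>R G (fst z) b (snd z)) = G (fst z) (snd z) (snd z)" if "z \<in> A \<times> UNIV" for z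
  proof -
    interpret linear "\<lambda>v. G (fst z) v (snd z)" using bilinear_linear(1)[OF bil] that by auto
    have "G (fst z) (\<Sum>b\<in>Basis. (snd z \<bullet> b) *\<^sub>R b) (snd z) = (\<Sum>b\<in>Basis. (snd z \<bullet> b) *\<^sub>R G (fst z) b (snd z))"
      by (simp add: sum scale)
    then show ?thesis by (simp only: euclidean_representation)
  qed
  have "(\<lambda>z. (snd z \<bullet> b) *\<^sub>R G (fst z) b (snd z)) differentiable at (a, w)" for b
  proof (rule differentiable_scaleR)
    show "(\<lambda>z :: 'a \<times> 'a. snd z \<bullet> b) differentiable at (a, w)"
      by (rule bounded_linear_imp_differentiable)
        (rule bounded_linear_compose[OF bounded_linear_inner_left bounded_linear_snd])
    show "(\<lambda>z. G (fst z) b (snd z)) differentiable at (a, w)"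
      by (rule differentiable_fibre_linear[OF A, of "\<lambda>a. G a b"]) (use d bilinear_linear(2)[OF bil] in auto)
  qed
  then have "(\<lambda>z. \<Sum>b\<in>Basis. (snd z \<bullet> b) *\<^sub>R G (fst z) b (snd z)) differentiable at (a, w)"
    by (intro differentiable_sum) auto
  then show ?thesis
    using differentiable_cong_open[where S = "A \<times> UNIV", OF open_Times[OF A(1) open_UNIV] _ e, of "(a, w)"] A(2) by simp
qed

text \<open>
  A second-order field in coordinates: \<open>G\<close> are the Christoffel symbols, \<open>g\<close> the uncontrolled force
  and \<open>l\<close> the velocity dependent force.
\<close>

locale second_order =
  fixes A :: "'e::euclidean_space set" and G :: "'e \<Rightarrow> 'e \<Rightarrow> 'e \<Rightarrow> 'e" and g :: "'e \<Rightarrow> 'e" and l :: "'e \<Rightarrow> 'e \<Rightarrow> 'e"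
  assumes A: "open A"
    and G: "\<And>a. a \<in> A \<Longrightarrow> bilinear (G a)" and Gsym: "\<And>a v w. a \<in> A \<Longrightarrow> G a v w = G a w v"
    and Ga: "\<And>v w. real_analytic_on (\<lambda>a. G a v w) A"
    and ga: "real_analytic_on g A"
    and l: "\<And>a. a \<in> A \<Longrightarrow> linear (l a)" and la: "\<And>v. real_analytic_on (\<lambda>a. l a v) A"
begin

definition field :: "'e \<times> 'e \<Rightarrow> 'e \<times> 'e" where
  "field = (\<lambda>(a, w). (w, - G a w w + g a + l a w))"

definition vert :: "('e \<Rightarrow> 'e) \<Rightarrow> 'e \<times> 'e \<Rightarrow> 'e \<times> 'e" where
  "vert X = (\<lambda>(a, w). (0, X a))"

text \<open>The Lie bracket of \<open>field\<close> with the vertical lift of \<open>X\<close>,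
  under the convention \<open>[V, W] = DW(V) - DV(W)\<close>. It is affine in the velocity, and the
  force \<open>g\<close> has already disappeared.\<close>

definition brack :: "('e \<Rightarrow> 'e) \<Rightarrow> 'e \<times> 'e \<Rightarrow> 'e \<times> 'e" where
  "brack X = (\<lambda>(a, w). (- X a, frechet_derivative X (at a) w + 2 *\<^sub>R G a w (X a) - l a (X a)))"

text \<open>The symmetric product in coordinates; its two Christoffel terms are merged by
  \<open>Gsym\<close>.\<close>

definition sym :: "('e \<Rightarrow> 'e) \<Rightarrow> ('e \<Rightarrow> 'e) \<Rightarrow> 'e \<Rightarrow> 'e" where
  "sym X Y a = frechet_derivative X (at a) (Y a) + frechet_derivative Y (at a) (X a) + 2 *\<^sub>R G a (X a) (Y a)"

lemma field_differentiable:
  assumes "a \<in> A"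
  shows "field differentiable at (a, w)"
proof -
  have d: "(\<lambda>z. - G (fst z) (snd z) (snd z) + g (fst z) + l (fst z) (snd z)) differentiable at (a, w)"
    by (intro differentiable_add differentiable_minus differentiable_fibre_quadratic[OF A assms G]
        differentiable_fst_comp differentiable_fibre_linear[OF A assms l])
      (use real_analytic_on_differentiable[OF Ga assms] real_analytic_on_differentiable[OF ga assms]
        real_analytic_on_differentiable[OF la assms] in auto)
  have "snd differentiable at (a, w)" by (rule bounded_linear_imp_differentiable[OF bounded_linear_snd])
  from differentiable_Pair[OF this d] show ?thesis unfolding field_def case_prod_beta' .
qed

lemma bounded_linear_connection:
  assumes "a \<in> A"
  shows "bounded_linear (G a v)" "bounded_linear (\<lambda>v. G a v w)" "bounded_linear (l a)"
  using bilinear_linear[OF G[OF assms]] l[OF assms] by (auto simp: linear_conv_bounded_linear)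

text \<open>Differentiability in both variables is known, so a derivative in a vertical direction
  may be computed along the fibre, where the field is a quadratic polynomial.\<close>

lemma field_vertical_deriv:
  assumes "a \<in> A"
  shows "frechet_derivative field (at (a, w)) (0, \<eta>) = (\<eta>, - 2 *\<^sub>R G a w \<eta> + l a \<eta>)"
proof -
  have "((\<lambda>w. field (a, w)) has_derivative (\<lambda>\<eta>. frechet_derivative field (at (a, w)) (0, \<eta>))) (at w)"
    by (rule has_derivative_slice_snd) (use field_differentiable[OF assms] frechet_derivative_works in blast)
  moreover have "((\<lambda>w. field (a, w)) has_derivative (\<lambda>\<eta>. (\<eta>, - 2 *\<^sub>R G a w \<eta> + l a \<eta>))) (at w)"
  proof -
    have "bounded_bilinear (G a)" using G[OF assms] by (simp add: bilinear_conv_bounded_bilinear)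
    then have "((\<lambda>w. G a w w) has_derivative (\<lambda>\<eta>. G a w \<eta> + G a \<eta> w)) (at w)"
      by (rule bounded_bilinear.FDERIV) (rule has_derivative_ident)+
    moreover have "G a w \<eta> + G a \<eta> w = 2 *\<^sub>R G a w \<eta>" for \<eta>
      using Gsym[OF assms, of \<eta> w] by (simp add: scaleR_2)
    ultimately have "((\<lambda>w. G a w w) has_derivative (\<lambda>\<eta>. 2 *\<^sub>R G a w \<eta>)) (at w)" by simp
    then show ?thesis unfolding field_def
      by (auto intro!: derivative_eq_intros bounded_linear.has_derivative[OF bounded_linear_connection(3)[OF assms]])
  qed
  ultimately show ?thesis by (rule fun_cong[OF has_derivative_unique])
qed

lemma vert_has_derivative:
  assumes X: "real_analytic_on X A" and a: "a \<in> A"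
  shows "(vert X has_derivative (\<lambda>h. (0, frechet_derivative X (at a) (fst h)))) (at (a, w))"
proof -
  have "((\<lambda>z. X (fst z)) has_derivative (\<lambda>h. frechet_derivative X (at a) (fst h))) (at (a, w))"
    using diff_chain_at[OF has_derivative_fst[OF has_derivative_ident], of X _ "(a, w)"]
      real_analytic_on_has_derivative[OF X a] by (simp add: o_def)
  then show ?thesis unfolding vert_def case_prod_beta by (auto intro!: has_derivative_Pair)
qed

lemma field_vert_bracket:
  assumes X: "real_analytic_on X A" and a: "a \<in> A"
  shows "(0, frechet_derivative X (at a) (fst (field (a, w)))) - frechet_derivative field (at (a, w)) (vert X (a, w))
    = brack X (a, w)"
  unfolding vert_def by (simp add: field_vertical_deriv[OF a] brack_def) (simp add: field_def)

lemma brack_differentiable: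
  assumes X: "real_analytic_on X A" and a: "a \<in> A"
  shows "brack X differentiable at (a, w)"
proof -
  have Xd: "X differentiable at a" by (rule real_analytic_on_differentiable[OF X a])
  have GX: "real_analytic_on (\<lambda>a. G a b (X a)) A" for b
  proof (rule real_analytic_on_cong[OF _ A])
    show "real_analytic_on (\<lambda>a. \<Sum>c\<in>Basis. (X a \<bullet> c) *\<^sub>R G a b c) A"
      by (intro real_analytic_on_sum real_analytic_on_scaleR Ga real_analytic_on_bounded_linear[OF bounded_linear_inner_left X])
    fix a assume "a \<in> A"
    then interpret linear "G a b" by (rule bilinear_linear(2)[OF G])
    have "G a b (\<Sum>c\<in>Basis. (X a \<bullet> c) *\<^sub>R c) = (\<Sum>c\<in>Basis. (X a \<bullet> c) *\<^sub>R G a b c)" by (simp add: sum scale)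
    then show "(\<Sum>c\<in>Basis. (X a \<bullet> c) *\<^sub>R G a b c) = G a b (X a)" by (simp only: euclidean_representation)
  qed
  have lX: "real_analytic_on (\<lambda>a. l a (X a)) A"
  proof (rule real_analytic_on_cong[OF _ A])
    show "real_analytic_on (\<lambda>a. \<Sum>c\<in>Basis. (X a \<bullet> c) *\<^sub>R l a c) A"
      by (intro real_analytic_on_sum real_analytic_on_scaleR la real_analytic_on_bounded_linear[OF bounded_linear_inner_left X])
    fix a assume "a \<in> A"
    then interpret linear "l a" by (rule l)
    have "l a (\<Sum>c\<in>Basis. (X a \<bullet> c) *\<^sub>R c) = (\<Sum>c\<in>Basis. (X a \<bullet> c) *\<^sub>R l a c)" by (simp add: sum scale)
    then show "(\<Sum>c\<in>Basis. (X a \<bullet> c) *\<^sub>R l a c) = l a (X a)" by (simp only: euclidean_representation)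
  qed
  have d1: "(\<lambda>z. frechet_derivative X (at (fst z)) (snd z)) differentiable at (a, w)"
    by (rule differentiable_fibre_linear[OF A a, of "\<lambda>a. frechet_derivative X (at a)"])
      (use linear_frechet_derivative[OF real_analytic_on_differentiable[OF X]]
        real_analytic_on_differentiable[OF real_analytic_on_deriv_const[OF X A] a] in auto)
  have d2: "(\<lambda>z. G (fst z) (snd z) (X (fst z))) differentiable at (a, w)"
    by (rule differentiable_fibre_linear[OF A a, of "\<lambda>a v. G a v (X a)"])
      (use bilinear_linear(1)[OF G] real_analytic_on_differentiable[OF GX a] in auto)
  have d3: "(\<lambda>z. l (fst z) (X (fst z))) differentiable at (a, w)"
    by (rule differentiable_fst_comp) (use real_analytic_on_differentiable[OF lX a] in simp)
  have d4: "(\<lambda>z. - X (fst z)) differentiable at (a, w)"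
    by (intro differentiable_minus differentiable_fst_comp) (simp add: Xd)
  have "(\<lambda>z. frechet_derivative X (at (fst z)) (snd z) + 2 *\<^sub>R G (fst z) (snd z) (X (fst z)) - l (fst z) (X (fst z)))
      differentiable at (a, w)"
    by (intro differentiable_diff differentiable_add differentiable_scaleR differentiable_const d1 d2 d3)
  from differentiable_Pair[OF d4 this] show ?thesis unfolding brack_def case_prod_beta' .
qed

text \<open>The force term \<open>l a (X a)\<close> does not depend on \<open>w\<close> and drops
  out here; so velocity dependent forces leave no trace in the double bracket.\<close>

lemma brack_vertical_deriv:
  assumes X: "real_analytic_on X A" and a: "a \<in> A"
  shows "frechet_derivative (brack X) (at (a, w)) (0, \<eta>) = (0, frechet_derivative X (at a) \<eta> + 2 *\<^sub>R G a \<eta> (X a))"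
proof -
  have "((\<lambda>w. brack X (a, w)) has_derivative (\<lambda>\<eta>. frechet_derivative (brack X) (at (a, w)) (0, \<eta>))) (at w)"
    by (rule has_derivative_slice_snd) (use brack_differentiable[OF assms] frechet_derivative_works in blast)
  moreover have "((\<lambda>w. brack X (a, w)) has_derivative
      (\<lambda>\<eta>. (0, frechet_derivative X (at a) \<eta> + 2 *\<^sub>R G a \<eta> (X a)))) (at w)"
  proof -
    have "bounded_linear (frechet_derivative X (at a))"
      using real_analytic_on_has_derivative[OF X a] by (rule has_derivative_bounded_linear)
    then show ?thesis unfolding brack_def
      by (auto intro!: derivative_eq_intros bounded_linear.has_derivative[OF bounded_linear_connection(2)[OF a]]
          bounded_linear.has_derivative[of "frechet_derivative X (at a)"])
  qed
  ultimately show ?thesis by (rule fun_cong[OF has_derivative_unique])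
qed

text \<open>This is \<open>[Y\<^sup>v, [S, X\<^sup>v]] = \<langle>X : Y\<rangle>\<^sup>v\<close> in
  coordinates. The base component \<open>- X a\<close> of the inner bracket supplies the derivative
  of \<open>Y\<close> along \<open>X\<close>.\<close>

lemma brack_vert_bracket:
  assumes X: "real_analytic_on X A" and Y: "real_analytic_on Y A" and a: "a \<in> A"
  shows "frechet_derivative (brack X) (at (a, w)) (vert Y (a, w)) - (0, frechet_derivative Y (at a) (fst (brack X (a, w))))
     = vert (sym X Y) (a, w)"
proof -
  interpret linear "frechet_derivative Y (at a)"
    by (rule linear_frechet_derivative[OF real_analytic_on_differentiable[OF Y a]])
  show ?thesis
    using Gsym[OF a, of "Y a" "X a"] brack_vertical_deriv[OF X a, of w "Y a"]
    by (simp add: vert_def sym_def brack_def neg)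
qed

end

text \<open>Two applications of \<open>related_bracket\<close>: first to the drift and the lift of
  \<open>X\<close>, then to the lift of \<open>Y\<close> and the bracket so obtained. The first has
  to be carried out on all of \<open>S\<close>, since the second differentiates its result.\<close>

lemma related_sym:
  fixes F :: "'e::euclidean_space \<times> 'e \<Rightarrow> 'f::euclidean_space \<times> 'f"
  assumes "second_order A G g l" "second_order B G' g' l'"
    and F: "real_analytic_on F S" and S: "open S"
    and SA: "\<And>z. z \<in> S \<Longrightarrow> fst z \<in> A" and SB: "\<And>z. z \<in> S \<Longrightarrow> fst (F z) \<in> B"
    and X: "real_analytic_on X A" and Y: "real_analytic_on Y A"
    and X': "real_analytic_on X' B" and Y': "real_analytic_on Y' B"
    and rS: "\<And>z. z \<in> S \<Longrightarrow> frechet_derivative F (at z) (second_order.field G g l z) = second_order.field G' g' l' (F z)"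
    and rX: "\<And>z. z \<in> S \<Longrightarrow> frechet_derivative F (at z) (0, X (fst z)) = (0, X' (fst (F z)))"
    and rY: "\<And>z. z \<in> S \<Longrightarrow> frechet_derivative F (at z) (0, Y (fst z)) = (0, Y' (fst (F z)))"
    and z: "z \<in> S"
  shows "frechet_derivative F (at z) (0, second_order.sym G X Y (fst z)) = (0, second_order.sym G' X' Y' (fst (F z)))"
proof -
  interpret a: second_order A G g l by fact
  interpret b: second_order B G' g' l' by fact
  let ?D = "\<lambda>z v. frechet_derivative F (at z) v"
  have rX': "?D z (a.vert X z) = b.vert X' (F z)" and rY': "?D z (a.vert Y z) = b.vert Y' (F z)" if "z \<in> S" for z
    using rX[OF that] rY[OF that] by (simp_all add: a.vert_def b.vert_def case_prod_beta)
  have 1: "?D z (a.brack X z) = b.brack X' (F z)" if z: "z \<in> S" for z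
  proof -
    obtain x w y u where zz: "z = (x, w)" "F z = (y, u)" by (cases z, cases "F z")
  have zF: "F (x, w) = (y, u)" using zz by simp
    have xA: "x \<in> A" and yB: "y \<in> B" using SA[OF z] SB[OF z] zz by auto
    have "?D z ((0, frechet_derivative X (at x) (fst (a.field z))) - frechet_derivative a.field (at z) (a.vert X z))
       = (0, frechet_derivative X' (at y) (fst (b.field (F z)))) - frechet_derivative b.field (at (F z)) (b.vert X' (F z))"
    proof (rule related_bracket[OF F S z _ _ _ _ rS rX'])
      show "(a.field has_derivative frechet_derivative a.field (at z)) (at z)"
        using a.field_differentiable[OF xA] unfolding zz(1) frechet_derivative_works .
      show "(b.field has_derivative frechet_derivative b.field (at (F z))) (at (F z))"
        using b.field_differentiable[OF yB] unfolding zz(2) frechet_derivative_works .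
      show "(a.vert X has_derivative (\<lambda>h. (0, frechet_derivative X (at x) (fst h)))) (at z)"
        unfolding zz(1) by (rule a.vert_has_derivative[OF X xA])
      show "(b.vert X' has_derivative (\<lambda>h. (0, frechet_derivative X' (at y) (fst h)))) (at (F z))"
        unfolding zz(2) by (rule b.vert_has_derivative[OF X' yB])
    qed
    then show ?thesis
      using a.field_vert_bracket[OF X xA, of w] b.field_vert_bracket[OF X' yB, of u] by (simp only: zz(1) zF)
  qed
  obtain x w y u where zz: "z = (x, w)" "F z = (y, u)" by (cases z, cases "F z")
  have zF: "F (x, w) = (y, u)" using zz by simp
  have xA: "x \<in> A" and yB: "y \<in> B" using SA[OF z] SB[OF z] zz by auto
  have "?D z (frechet_derivative (a.brack X) (at z) (a.vert Y z) - (0, frechet_derivative Y (at x) (fst (a.brack X z))))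
     = frechet_derivative (b.brack X') (at (F z)) (b.vert Y' (F z)) - (0, frechet_derivative Y' (at y) (fst (b.brack X' (F z))))"
  proof (rule related_bracket[OF F S z _ _ _ _ rY' 1])
    show "(a.brack X has_derivative frechet_derivative (a.brack X) (at z)) (at z)"
      using a.brack_differentiable[OF X xA] unfolding zz(1) frechet_derivative_works .
    show "(b.brack X' has_derivative frechet_derivative (b.brack X') (at (F z))) (at (F z))"
      using b.brack_differentiable[OF X' yB] unfolding zz(2) frechet_derivative_works .
    show "(a.vert Y has_derivative (\<lambda>h. (0, frechet_derivative Y (at x) (fst h)))) (at z)"
      unfolding zz(1) by (rule a.vert_has_derivative[OF Y xA])
    show "(b.vert Y' has_derivative (\<lambda>h. (0, frechet_derivative Y' (at y) (fst h)))) (at (F z))"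
      unfolding zz(2) by (rule b.vert_has_derivative[OF Y' yB])
  qed
  then have "?D z (a.vert (a.sym X Y) z) = b.vert (b.sym X' Y') (F z)"
    using a.brack_vert_bracket[OF X Y xA, of w] b.brack_vert_bracket[OF X' Y' yB, of u] by (simp only: zz(1) zF)
  then show ?thesis by (simp add: a.vert_def b.vert_def zz(1) zF)
qed

text \<open>The mean of the values at \<open>v0 + t w\<close> and \<open>v0 - t w\<close> contains
  no terms odd in \<open>t\<close>, so comparison with the value at \<open>v0\<close> isolates
  \<open>B w w\<close>. What remains is an affine map that vanishes on a ball.\<close>

lemma quadratic_vanishes:
  fixes B :: "'a::real_normed_vector \<Rightarrow> 'a \<Rightarrow> 'b::real_normed_vector"
  assumes B: "bilinear B" and L: "linear L" and r: "r > 0"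
    and eq: "\<And>v. v \<in> ball v0 r \<Longrightarrow> B v v = L v + c"
  shows "L v = 0" "c = 0"
proof -
  interpret L: linear L by fact
  have B0: "B w w = 0" for w
  proof -
    obtain t where t: "t > 0" "norm (t *\<^sub>R w) < r"
    proof
      \<comment> \<open>The added \<open>1\<close> keeps the denominator positive for
        \<open>w = 0\<close>.\<close>
      show "r / (2 * (norm w + 1)) > 0" using r by (simp add: add_nonneg_pos)
      have "r * norm w < r * (2 * (norm w + 1))" using r by (intro mult_strict_left_mono) (auto simp: add_nonneg_pos)
      then show "norm ((r / (2 * (norm w + 1))) *\<^sub>R w) < r" using r
        by (simp add: divide_less_eq add_nonneg_pos abs_of_pos)
    qed
    have "B (v0 + t *\<^sub>R w) (v0 + t *\<^sub>R w) = L (v0 + t *\<^sub>R w) + c" "B (v0 - t *\<^sub>R w) (v0 - t *\<^sub>R w) = L (v0 - t *\<^sub>R w) + c"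
      "B v0 v0 = L v0 + c"
      by (rule eq; use t r in \<open>simp add: dist_norm\<close>)+
    note e = this
    have halve: "a = x" if "a + b = x + y" "a - b = x - y" for a b x y :: 'b
    proof -
      have "2 *\<^sub>R a = (a + b) + (a - b)" by (simp add: scaleR_2)
      also have "\<dots> = 2 *\<^sub>R x" unfolding that by (simp add: scaleR_2)
      finally show ?thesis by simp
    qed
    have "B v0 v0 + (t * t) *\<^sub>R B w w = L v0 + c"
      by (rule halve[where b = "t *\<^sub>R B v0 w + t *\<^sub>R B w v0" and y = "t *\<^sub>R L w"])
        (use e(1,2) in \<open>simp_all add: bilinear_ladd[OF B] bilinear_radd[OF B] bilinear_lsub[OF B]
          bilinear_rsub[OF B] bilinear_lmul[OF B] bilinear_rmul[OF B] L.add L.diff L.scale algebra_simps\<close>)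
    then have "(t * t) *\<^sub>R B w w = 0" using e(3) by simp
    then show ?thesis using t by simp
  qed
  have Lc: "L v + c = 0" if "v \<in> ball v0 r" for v using eq[OF that] B0 by simp
  have "L w = 0" for w
  proof -
    obtain t where t: "t > 0" "norm (t *\<^sub>R w) < r"
    proof
      show "r / (2 * (norm w + 1)) > 0" using r by (simp add: add_nonneg_pos)
      have "r * norm w < r * (2 * (norm w + 1))" using r by (intro mult_strict_left_mono) (auto simp: add_nonneg_pos)
      then show "norm ((r / (2 * (norm w + 1))) *\<^sub>R w) < r" using r
        by (simp add: divide_less_eq add_nonneg_pos abs_of_pos)
    qed
    have "L (v0 + t *\<^sub>R w) + c = 0" "L v0 + c = 0" by (rule Lc; use t r in \<open>simp add: dist_norm\<close>)+
    then have "(L v0 + t *\<^sub>R L w + c) - (L v0 + c) = 0" by (simp add: L.add L.scale)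
    then show ?thesis using t by simp
  qed
  then show "L v = 0" "c = 0" using Lc[of v0] r by auto
qed

text \<open>A small multiple of any \<open>w\<close> is the difference of two points of
  \<open>T\<close>.\<close>

lemma subspace_open_subset:
  fixes W :: "'a::real_normed_vector set"
  assumes W: "subspace W" and T: "open T" "T \<noteq> {}" "T \<subseteq> W"
  shows "W = UNIV"
proof -
  obtain u where uT: "u \<in> T" using T by blast
  then obtain r where r: "r > 0" "ball u r \<subseteq> T" using T(1) open_contains_ball by metis
  have "w \<in> W" for w
  proof (cases "w = 0")
    case True then show ?thesis using subspace_0[OF W] by simp
  next
    case False
    define t where "t = r / (2 * norm w)"
    have t: "t > 0" using r False by (simp add: t_def)
    have "u + t *\<^sub>R w \<in> ball u r" using r False by (simp add: dist_norm t_def)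
    then have "u + t *\<^sub>R w \<in> W" "u \<in> W" using r T uT by auto
    then have "t *\<^sub>R w \<in> W" using subspace_diff[OF W] by fastforce
    then have "(1 / t) *\<^sub>R t *\<^sub>R w \<in> W" by (rule subspace_scale[OF W])
    then show ?thesis using t by simp
  qed
  then show ?thesis by blast
qed

section \<open>The tangent map form on a product of balls\<close>

lemma box_in_open:
  fixes z :: "'c::metric_space \<times> 'd::metric_space"
  assumes "open Z" "z \<in> Z"
  obtains r where "r > 0" "ball (fst z) r \<times> ball (snd z) r \<subseteq> Z"
proof -
  obtain A B where AB: "open A" "open B" "z \<in> A \<times> B" "A \<times> B \<subseteq> Z" using open_prod_elim[OF assms] by blast
  obtain r s where r: "r > 0" "ball (fst z) r \<subseteq> A" and s: "s > 0" "ball (snd z) s \<subseteq> B"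
    using AB open_contains_ball by (metis mem_Times_iff)
  have "ball (fst z) (min r s) \<subseteq> ball (fst z) r" "ball (snd z) (min r s) \<subseteq> ball (snd z) s"
    by (auto intro!: subset_ball)
  then have "ball (fst z) (min r s) \<times> ball (snd z) (min r s) \<subseteq> Z"
    using r(2) s(2) AB(4) by fast
  then show ?thesis using that[of "min r s"] r(1) s(1) by simp
qed

lemma tangent_map_on_box:
  fixes F :: "'e::euclidean_space \<times> 'e \<Rightarrow> 'f::euclidean_space \<times> 'f"
  assumes F: "real_analytic_on F S" and S: "open S" and r: "r > 0" and box: "ball x0 r \<times> ball v0 r \<subseteq> S"
    and vert: "\<And>z w. z \<in> S \<Longrightarrow> fst (frechet_derivative F (at z) (0, w)) = 0"
    and spray: "\<And>z. z \<in> S \<Longrightarrow> fst (frechet_derivative F (at z) (snd z, N z)) = snd (F z)"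
  defines "\<phi> \<equiv> \<lambda>x. fst (F (x, v0))"
  shows "real_analytic_on \<phi> (ball x0 r)"
    and "x \<in> ball x0 r \<Longrightarrow> v \<in> ball v0 r \<Longrightarrow> F (x, v) = (\<phi> x, frechet_derivative \<phi> (at x) v)"
    and "x \<in> ball x0 r \<Longrightarrow> v \<in> ball v0 r \<Longrightarrow> frechet_derivative F (at (x, v)) (\<xi>, \<eta>) =
      (frechet_derivative \<phi> (at x) \<xi>,
       frechet_derivative (\<lambda>z. frechet_derivative \<phi> (at z) v) (at x) \<xi> + frechet_derivative \<phi> (at x) \<eta>)"
proof -
  let ?D = "\<lambda>z h. frechet_derivative F (at z) h"
  have v0: "v0 \<in> ball v0 r" using r by simp
  have inS: "(x, v) \<in> S" if "x \<in> ball x0 r" "v \<in> ball v0 r" for x v using box that by blast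
  have D: "(F has_derivative ?D z) (at z)" if "z \<in> S" for z by (rule real_analytic_on_has_derivative[OF F that])
  have lin: "linear (?D z)" if "z \<in> S" for z using D[OF that] by (rule has_derivative_linear)
  have "real_analytic_on (\<lambda>x. F (x, v0)) (ball x0 r)"
    using real_analytic_on_subset[OF real_analytic_on_slice[OF F, of v0], of "ball x0 r"] inS[OF _ v0] by blast
  then show an: "real_analytic_on \<phi> (ball x0 r)"
    unfolding \<phi>_def by (rule real_analytic_on_bounded_linear[OF bounded_linear_fst])
  have const: "fst (F (x, v)) = \<phi> x" if x: "x \<in> ball x0 r" and v: "v \<in> ball v0 r" for x v
  proof -
    have d0: "((\<lambda>v. fst (F (x, v))) has_derivative (\<lambda>h. 0)) (at v within ball v0 r)" if v: "v \<in> ball v0 r" for v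
    proof -
      have "((\<lambda>v. F (x, v)) has_derivative (\<lambda>\<eta>. ?D (x, v) (0, \<eta>))) (at v)"
        by (rule has_derivative_slice_snd[OF D[OF inS[OF x v]]])
      then have "((\<lambda>v. fst (F (x, v))) has_derivative (\<lambda>\<eta>. fst (?D (x, v) (0, \<eta>)))) (at v)"
        by (rule has_derivative_fst)
      then show ?thesis unfolding vert[OF inS[OF x v]] by (rule has_derivative_at_withinI)
    qed
    obtain c where "\<And>v. v \<in> ball v0 r \<Longrightarrow> fst (F (x, v)) = c"
      using has_derivative_zero_constant[OF convex_ball d0] by blast
    then show ?thesis using v v0 unfolding \<phi>_def by simp
  qed
  have d\<phi>: "frechet_derivative \<phi> (at x) \<xi> = fst (?D (x, v) (\<xi>, 0))" if x: "x \<in> ball x0 r" and v: "v \<in> ball v0 r" for x v \<xi>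
  proof -
    have "((\<lambda>x. fst (F (x, v))) has_derivative (\<lambda>\<xi>. fst (?D (x, v) (\<xi>, 0)))) (at x)"
      by (rule has_derivative_fst[OF has_derivative_slice_fst[OF D[OF inS[OF x v]]]])
    then have "(\<phi> has_derivative (\<lambda>\<xi>. fst (?D (x, v) (\<xi>, 0)))) (at x)"
      by (rule has_derivative_transform_within_open[OF _ open_ball x]) (rule const[OF _ v])
    then show ?thesis by (rule fun_cong[OF frechet_derivative_at[symmetric]])
  qed
  have split: "?D z (\<xi>, \<eta>) = ?D z (\<xi>, 0) + ?D z (0, \<eta>)" if "z \<in> S" for z \<xi> \<eta>
    using linear_add[OF lin[OF that], of "(\<xi>, 0)" "(0, \<eta>)"] by simp
  \<comment> \<open>The part \<open>(0, N (x, v))\<close> is vertical, so in the spray hypothesis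
    only the derivative of \<open>\<phi>\<close> applied to \<open>v\<close> remains.\<close>
  have snd_F: "snd (F (x, v)) = frechet_derivative \<phi> (at x) v" if x: "x \<in> ball x0 r" and v: "v \<in> ball v0 r" for x v
    using spray[OF inS[OF that]] split[OF inS[OF that], of v "N (x, v)"] vert[OF inS[OF that], of "N (x, v)"] d\<phi>[OF that]
    by simp
  have FF: "F (x, v) = (\<phi> x, frechet_derivative \<phi> (at x) v)" if "x \<in> ball x0 r" "v \<in> ball v0 r" for x v
    using const[OF that] snd_F[OF that] by (simp add: prod_eq_iff)
  have DF: "frechet_derivative F (at (x, v)) (\<xi>, \<eta>) =
      (frechet_derivative \<phi> (at x) \<xi>,
       frechet_derivative (\<lambda>z. frechet_derivative \<phi> (at z) v) (at x) \<xi> + frechet_derivative \<phi> (at x) \<eta>)"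
    if x: "x \<in> ball x0 r" and v: "v \<in> ball v0 r" for x v \<xi> \<eta>
  proof -
    note z = inS[OF x v]
    have 1: "snd (?D (x, v) (\<xi>, 0)) = frechet_derivative (\<lambda>z. frechet_derivative \<phi> (at z) v) (at x) \<xi>"
    proof -
      have "((\<lambda>x. snd (F (x, v))) has_derivative (\<lambda>\<xi>. snd (?D (x, v) (\<xi>, 0)))) (at x)"
        by (rule has_derivative_snd[OF has_derivative_slice_fst[OF D[OF z]]])
      then have "((\<lambda>z. frechet_derivative \<phi> (at z) v) has_derivative (\<lambda>\<xi>. snd (?D (x, v) (\<xi>, 0)))) (at x)"
        by (rule has_derivative_transform_within_open[OF _ open_ball x]) (rule snd_F[OF _ v])
      then show ?thesis by (rule fun_cong[OF frechet_derivative_at])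
    qed
    \<comment> \<open>Along a fibre the velocity component of \<open>F\<close> is the linear map
      \<open>frechet_derivative \<phi> (at x)\<close>, which is its own derivative.\<close>
    have 2: "snd (?D (x, v) (0, \<eta>)) = frechet_derivative \<phi> (at x) \<eta>"
    proof -
      have "((\<lambda>v. snd (F (x, v))) has_derivative (\<lambda>\<eta>. snd (?D (x, v) (0, \<eta>)))) (at v)"
        by (rule has_derivative_snd[OF has_derivative_slice_snd[OF D[OF z]]])
      then have "(frechet_derivative \<phi> (at x) has_derivative (\<lambda>\<eta>. snd (?D (x, v) (0, \<eta>)))) (at v)"
        by (rule has_derivative_transform_within_open[OF _ open_ball v]) (rule snd_F[OF x])
      moreover have "(frechet_derivative \<phi> (at x) has_derivative frechet_derivative \<phi> (at x)) (at v)"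
        by (rule bounded_linear_imp_has_derivative[OF has_derivative_bounded_linear[OF real_analytic_on_has_derivative[OF an x]]])
      ultimately show ?thesis by (rule fun_cong[OF has_derivative_unique])
    qed
    show ?thesis
      by (rule trans[OF split[OF z]]) (simp add: prod_eq_iff 1 2 d\<phi>[OF x v, of \<xi>] vert[OF z, of \<eta>])
  qed
  show "F (x, v) = (\<phi> x, frechet_derivative \<phi> (at x) v)" if "x \<in> ball x0 r" "v \<in> ball v0 r"
    by (rule FF[OF that])
  show "frechet_derivative F (at (x, v)) (\<xi>, \<eta>) =
      (frechet_derivative \<phi> (at x) \<xi>,
       frechet_derivative (\<lambda>z. frechet_derivative \<phi> (at z) v) (at x) \<xi> + frechet_derivative \<phi> (at x) \<eta>)"
    if "x \<in> ball x0 r" "v \<in> ball v0 r"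
    by (rule DF[OF that])
qed

section \<open>Restriction to open subsets\<close>

lemma analytic_map_submanifold:
  assumes P: "diff_atlas P" and f: "analytic_map P Q f" and W: "openin (mtop P) W"
    and im: "\<And>p. p \<in> W \<Longrightarrow> f p \<in> W'"
  shows "analytic_map (submanifold P W) (submanifold Q W') f"
  unfolding analytic_map_def
proof (intro conjI allI)
  have cont: "continuous_map (mtop P) (mtop Q) f" using f by (simp add: analytic_map_def)
  show "continuous_map (mtop (submanifold P W)) (mtop (submanifold Q W')) f"
    unfolding mtop_submanifold continuous_map_in_subtopology
    using continuous_map_from_subtopology[OF cont] im by auto
  fix i j
  let ?T = "{p \<in> topspace (mtop P). f p \<in> cdom Q j} \<inter> W"
  have T: "openin (mtop P) ?T" by (intro openin_Int W openin_continuous_map_preimage[OF cont] openin_cdom)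
  have eq: "cmap (submanifold P W) i ` (cdom (submanifold P W) i \<inter> f -` cdom (submanifold Q W') j) = cmap P i ` (?T \<inter> cdom P i)"
    using im by (auto simp: topspace_mtop points_iff)
  have "real_analytic_on (cmap Q j \<circ> f \<circ> cinv P i) (cmap P i ` (cdom P i \<inter> f -` cdom Q j))"
    using f by (simp add: analytic_map_def)
  then have "real_analytic_on (cmap Q j \<circ> f \<circ> cinv P i) (cmap P i ` (?T \<inter> cdom P i))"
    by (rule real_analytic_on_subset) auto
  then have "real_analytic_on (cmap Q j \<circ> f \<circ> cinv (submanifold P W) i) (cmap P i ` (?T \<inter> cdom P i))"
    by (rule real_analytic_on_cong[OF _ open_chart_image(1)[OF P T]])
      (auto simp: cinv_cmap[OF P] cinv_submanifold[OF P])
  then show "real_analytic_on (cmap (submanifold Q W') j \<circ> f \<circ> cinv (submanifold P W) i)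
      (cmap (submanifold P W) i ` (cdom (submanifold P W) i \<inter> f -` cdom (submanifold Q W') j))"
    unfolding eq by simp
qed

lemma vector_field_submanifold:
  assumes M: "diff_atlas M" and W: "openin (mtop M) W" and X: "vector_field M X"
  shows "vector_field (submanifold M W) X"
  unfolding vector_field_def
proof (intro conjI ballI allI)
  fix q assume "q \<in> points (submanifold M W)"
  then show "X q \<in> tangent_space (submanifold M W) q"
    using vector_field_in[OF X] tangent_space_submanifold[OF M W] by (simp add: points_submanifold)
next
  fix i
  have "real_analytic_on (\<lambda>x. X (cinv M i x) i) (cmap M i ` (cdom M i \<inter> W))"
    by (rule real_analytic_on_subset[OF vector_field_analytic[OF X]]) auto
  then show "real_analytic_on (\<lambda>x. X (cinv (submanifold M W) i x) i) (cmap (submanifold M W) i ` cdom (submanifold M W) i)"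
    unfolding submanifold_simps
    by (rule real_analytic_on_cong[OF _ open_chart_image(2)[OF M W]])
      (auto simp: cinv_cmap[OF M] cinv_submanifold[OF M])
qed

lemma symmetric_connection_submanifold:
  assumes M: "diff_atlas M" and W: "openin (mtop M) W" and \<Gamma>: "symmetric_connection M \<Gamma>"
  shows "symmetric_connection (submanifold M W) \<Gamma>"
  unfolding symmetric_connection_def Let_def
proof (intro conjI allI ballI)
  fix i q assume q: "q \<in> cdom (submanifold M W) i"
  then show "bilinear (\<Gamma> i q)" "\<Gamma> i q v w = \<Gamma> i q w v" for v w
    using connection_bilinear[OF \<Gamma>] connection_sym[OF \<Gamma>] by simp_all
next
  fix i v w
  have "real_analytic_on (\<lambda>x. \<Gamma> i (cinv M i x) v w) (cmap M i ` (cdom M i \<inter> W))"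
    by (rule real_analytic_on_subset[OF connection_analytic[OF \<Gamma>]]) auto
  then show "real_analytic_on (\<lambda>x. \<Gamma> i (cinv (submanifold M W) i x) v w) (cmap (submanifold M W) i ` cdom (submanifold M W) i)"
    unfolding submanifold_simps
    by (rule real_analytic_on_cong[OF _ open_chart_image(2)[OF M W]])
      (auto simp: cinv_cmap[OF M] cinv_submanifold[OF M])
next
  fix i j q v w assume "q \<in> cdom (submanifold M W) i \<inter> cdom (submanifold M W) j"
  then have q: "q \<in> W" "q \<in> cdom M i" "q \<in> cdom M j" by auto
  have D: "frechet_derivative (transition (submanifold M W) i j) (at z) = frechet_derivative (transition M i j) (at z)"
    if "z \<in> cmap M i ` (cdom M i \<inter> W)" for z
    using that transition_submanifold_deriv[OF M W] by auto
  have x: "cmap M i q \<in> cmap M i ` (cdom M i \<inter> W)" using q by blast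
  have D2: "frechet_derivative (\<lambda>z. frechet_derivative (transition (submanifold M W) i j) (at z) w) (at (cmap M i q))
      = frechet_derivative (\<lambda>z. frechet_derivative (transition M i j) (at z) w) (at (cmap M i q))"
    by (rule frechet_derivative_cong_open[OF open_chart_image(2)[OF M W] x]) (simp only: D)
  show "frechet_derivative (transition (submanifold M W) i j) (at (cmap (submanifold M W) i q)) (\<Gamma> i q v w) =
     frechet_derivative (\<lambda>z. frechet_derivative (transition (submanifold M W) i j) (at z) w) (at (cmap (submanifold M W) i q)) v
     + \<Gamma> j q (frechet_derivative (transition (submanifold M W) i j) (at (cmap (submanifold M W) i q)) v)
          (frechet_derivative (transition (submanifold M W) i j) (at (cmap (submanifold M W) i q)) w)"
    unfolding submanifold_simps D2 D[OF x] by (rule connection_change[OF \<Gamma> q(2,3)])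
qed

lemma fiberwise_linearD:
  assumes "fiberwise_linear M d" "q \<in> points M" "v \<in> tangent_space M q"
  shows "fst (d (q, v)) = q" "snd (d (q, v)) \<in> tangent_space M q"
    and "w \<in> tangent_space M q \<Longrightarrow> snd (d (q, \<lambda>i. a *\<^sub>R v i + b *\<^sub>R w i)) i = a *\<^sub>R snd (d (q, v)) i + b *\<^sub>R snd (d (q, w)) i"
  using assms unfolding fiberwise_linear_def by blast+

lemma openin_fst_vimage:
  assumes M: "analytic_atlas M" and W: "openin (mtop M) W"
  shows "openin (mtop (tangent_bundle M)) (points (tangent_bundle M) \<inter> fst -` W)"
  unfolding openin_mtop_iff[OF diff_atlas_tangent_bundle[OF M]]
proof (intro conjI allI)
  fix i
  note M' = analytic_atlas_imp_diff[OF M]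
  have "cmap (tangent_bundle M) i ` (points (tangent_bundle M) \<inter> fst -` W \<inter> cdom (tangent_bundle M) i)
     = cmap M i ` (W \<inter> cdom M i) \<times> UNIV" (is "?L = ?R")
  proof
    show "?L \<subseteq> ?R" by (auto simp: cdom_tangent_bundle cmap_tangent_bundle)
    show "?R \<subseteq> ?L"
    proof clarify
      fix q w assume q: "q \<in> W" "q \<in> cdom M i"
      have "(q, tvec M i q w) \<in> points (tangent_bundle M) \<inter> fst -` W \<inter> cdom (tangent_bundle M) i"
        using q tvec_in[OF M' q(2)] by (auto simp: cdom_tangent_bundle points_iff)
      moreover have "cmap (tangent_bundle M) i (q, tvec M i q w) = (cmap M i q, w)"
        by (simp add: cmap_tangent_bundle tvec_at[OF M' q(2)])
      ultimately show "(cmap M i q, w) \<in> ?L" by (metis image_eqI)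
    qed
  qed
  then show "open (cmap (tangent_bundle M) i ` (points (tangent_bundle M) \<inter> fst -` W \<inter> cdom (tangent_bundle M) i))"
    using open_Times[OF open_chart_image(1)[OF M' W] open_UNIV] by (rule ssubst)
qed simp

lemma restrict_system_simps [simp]:
  "base (restrict_system \<Sigma> W) = submanifold (base \<Sigma>) W"
  "conn (restrict_system \<Sigma> W) = conn \<Sigma>"
  "inputs (restrict_system \<Sigma> W) = inputs \<Sigma>"
  "field (restrict_system \<Sigma> W) = field \<Sigma>"
  "fibermap (restrict_system \<Sigma> W) = fibermap \<Sigma>"
  by (simp_all add: restrict_system_def)

lemma submanifold_Int_points: "submanifold P (points P \<inter> W) = submanifold P W"
proof -
  have "cdom P i \<inter> (points P \<inter> W) = cdom P i \<inter> W" for i by (auto simp: points_iff)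
  then show ?thesis by (simp add: submanifold_def)
qed

lemma mechanical_restrict_system:
  assumes \<Sigma>: "mechanical_control_system \<Sigma>" and W: "openin (mtop (base \<Sigma>)) W"
  shows "mechanical_control_system (restrict_system \<Sigma> W)"
proof -
  have M: "analytic_manifold (base \<Sigma>)" and \<Gamma>: "symmetric_connection (base \<Sigma>) (conn \<Sigma>)"
    and X: "\<And>r. r \<in> {0..inputs \<Sigma>} \<Longrightarrow> vector_field (base \<Sigma>) (field \<Sigma> r)"
    and d: "analytic_map (TQ \<Sigma>) (TQ \<Sigma>) (fibermap \<Sigma>)" and l: "fiberwise_linear (base \<Sigma>) (fibermap \<Sigma>)"
    using \<Sigma> by (auto simp: mechanical_control_system_def)
  have Ma: "analytic_atlas (base \<Sigma>)" using M by (simp add: analytic_manifold_alt)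
  note Md = analytic_atlas_imp_diff[OF Ma]
  \<comment> \<open>An open set consists of points of the manifold, so the full preimage of
    \<open>W\<close> under \<open>fst\<close> is cut down; by \<open>submanifold_Int_points\<close>
    the submanifold stays the same.\<close>
  let ?W = "points (TQ \<Sigma>) \<inter> fst -` W"
  have TW: "tangent_bundle (submanifold (base \<Sigma>) W) = submanifold (TQ \<Sigma>) ?W"
    unfolding submanifold_Int_points by (rule tangent_bundle_submanifold[OF Md W])
  have "analytic_map (submanifold (TQ \<Sigma>) ?W) (submanifold (TQ \<Sigma>) ?W) (fibermap \<Sigma>)"
  proof (rule analytic_map_submanifold[OF diff_atlas_tangent_bundle[OF Ma] d openin_fst_vimage[OF Ma W]])
    fix p assume "p \<in> ?W"
    then obtain q v where p: "p = (q, v)" "q \<in> W" "q \<in> points (base \<Sigma>)" "v \<in> tangent_space (base \<Sigma>) q"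
      by (cases p) (auto simp: points_tangent_bundle)
    then show "fibermap \<Sigma> p \<in> ?W"
      using fiberwise_linearD(1,2)[OF l p(3,4)] points_tangent_bundle[of q "snd (fibermap \<Sigma> p)" "base \<Sigma>"]
      by (cases "fibermap \<Sigma> p") (simp add: points_tangent_bundle)
  qed
  moreover have "fiberwise_linear (submanifold (base \<Sigma>) W) (fibermap \<Sigma>)"
    using l tangent_space_submanifold[OF Md W] unfolding fiberwise_linear_def points_submanifold by simp
  ultimately show ?thesis
    using analytic_manifold_submanifold[OF M W] symmetric_connection_submanifold[OF Md W \<Gamma>]
      vector_field_submanifold[OF Md W X]
    unfolding mechanical_control_system_def restrict_system_simps TW by blast
qed

section \<open>Lifts in charts\<close>

lemma velocity_vertical:
  assumes "q \<in> cdom M i" "v \<in> tangent_space M q"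
  shows "velocity (tangent_bundle M) (\<lambda>t. (q, \<lambda>i. v i + t *\<^sub>R X i)) 0 i = (0, X i)"
proof -
  have "((\<lambda>t. (cmap M i q, v i + t *\<^sub>R X i)) has_vector_derivative (0, X i)) (at 0)"
    unfolding has_vector_derivative_def by (auto intro!: derivative_eq_intros simp: scaleR_prod_def)
  then have "vector_derivative (\<lambda>t. (cmap M i q, v i + t *\<^sub>R X i)) (at 0) = (0, X i)"
    by (rule vector_derivative_at)
  then show ?thesis using assms by (simp add: velocity_def cdom_tangent_bundle cmap_tangent_bundle o_def)
qed

lemma velocity_vertical_notin:
  "q \<notin> cdom M i \<Longrightarrow> velocity (tangent_bundle M) (\<lambda>t. (q, \<lambda>i. v i + t *\<^sub>R X i)) 0 i = 0"
  by (simp add: velocity_def cdom_tangent_bundle)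

lemma vlft_chart: "q \<in> cdom M i \<Longrightarrow> v \<in> tangent_space M q \<Longrightarrow> vlft M X (q, v) i = (0, X q i)"
  by (simp add: vlft_def velocity_vertical)

text \<open>With zero base component, the second derivative of the transition contributes nothing,
  and the fibre component transforms like \<open>X\<close>.\<close>

lemma vlft_in:
  assumes M: "analytic_atlas M" and v: "v \<in> tangent_space M q" and X: "X q \<in> tangent_space M q"
  shows "vlft M X (q, v) \<in> tangent_space (tangent_bundle M) (q, v)"
  unfolding tangent_space_def[of "tangent_bundle M"]
proof (intro CollectI conjI allI impI)
  show "vlft M X (q, v) i = 0" if "(q, v) \<notin> cdom (tangent_bundle M) i" for i
    using that v by (simp add: vlft_def velocity_vertical_notin cdom_tangent_bundle)
  fix i j assume "(q, v) \<in> cdom (tangent_bundle M) i \<inter> cdom (tangent_bundle M) j"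
  then have q: "q \<in> cdom M i" "q \<in> cdom M j" by (auto simp: cdom_tangent_bundle)
  note M' = analytic_atlas_imp_diff[OF M]
  let ?D = "\<lambda>w x. frechet_derivative (transition M i j) (at x) w"
  have "linear (\<lambda>w. ?D w (cmap M i q))" by (rule linear_transition_deriv[OF M' q])
  moreover have "linear (frechet_derivative (?D (v i)) (at (cmap M i q)))"
    by (rule linear_frechet_derivative, rule real_analytic_on_differentiable[OF
          real_analytic_on_deriv_const[OF analytic_atlas_transition[OF M] diff_atlas_open[OF M']]]) (use q in blast)
  ultimately show "vlft M X (q, v) j = frechet_derivative (transition (tangent_bundle M) i j) (at (cmap (tangent_bundle M) i (q, v))) (vlft M X (q, v) i)"
    unfolding vlft_chart[where M = M, OF q(1) v] vlft_chart[where M = M, OF q(2) v] cmap_tangent_bundle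
      frechet_derivative_at[OF transition_tangent_bundle_has_derivative[OF M q], symmetric]
    by (simp add: linear_0 tangent_spaceD(2)[OF X q])
qed

text \<open>The second derivative of the transition, evaluated at the velocity twice, is exactly the
  inhomogeneous term in the transformation law of the Christoffel symbols.\<close>

lemma spray_in:
  assumes M: "analytic_atlas M" and \<Gamma>: "symmetric_connection M \<Gamma>" and v: "v \<in> tangent_space M q"
  shows "spray M \<Gamma> (q, v) \<in> tangent_space (tangent_bundle M) (q, v)"
  unfolding tangent_space_def[of "tangent_bundle M"]
proof (intro CollectI conjI allI impI)
  show "spray M \<Gamma> (q, v) i = 0" if "(q, v) \<notin> cdom (tangent_bundle M) i" for i
    using that v by (simp add: spray_def cdom_tangent_bundle)
  fix i j assume "(q, v) \<in> cdom (tangent_bundle M) i \<inter> cdom (tangent_bundle M) j"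
  then have q: "q \<in> cdom M i" "q \<in> cdom M j" by (auto simp: cdom_tangent_bundle)
  note M' = analytic_atlas_imp_diff[OF M]
  let ?D = "\<lambda>w x. frechet_derivative (transition M i j) (at x) w"
  let ?x = "cmap M i q"
  have lin: "linear (\<lambda>w. ?D w ?x)" by (rule linear_transition_deriv[OF M' q])
  have vj: "v j = ?D (v i) ?x" by (rule tangent_spaceD(2)[OF v q])
  have "frechet_derivative (?D (v i)) (at ?x) (v i) + ?D (- \<Gamma> i q (v i) (v i)) ?x = - \<Gamma> j q (v j) (v j)"
    using connection_change[OF \<Gamma> q, of "v i" "v i"] unfolding vj by (simp add: linear_neg[OF lin])
  then show "spray M \<Gamma> (q, v) j = frechet_derivative (transition (tangent_bundle M) i j) (at (cmap (tangent_bundle M) i (q, v))) (spray M \<Gamma> (q, v) i)"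
    unfolding cmap_tangent_bundle frechet_derivative_at[OF transition_tangent_bundle_has_derivative[OF M q], symmetric]
    using q vj by (simp add: spray_def)
qed

lemma drift_chart:
  assumes "q \<in> cdom (base \<Sigma>) j" "w \<in> tangent_space (base \<Sigma>) q"
  shows "drift \<Sigma> (q, w) j = (w j, - conn \<Sigma> j q (w j) (w j) + field \<Sigma> 0 q j + snd (fibermap \<Sigma> (q, w)) j)"
  unfolding drift_def vlft_chart[OF assms] using assms
  by (simp add: spray_def fiber_vlft_def velocity_vertical[where M = "base \<Sigma>"])

lemma related_chart:
  assumes P: "diff_atlas P" and r: "related P Q f X Y" and p: "p \<in> cdom P i" and X: "X p \<in> tangent_space P p"
    and j: "f p \<in> cdom Q j" and d: "(cmap Q j \<circ> f \<circ> cinv P i) differentiable at (cmap P i p)"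
  shows "frechet_derivative (cmap Q j \<circ> f \<circ> cinv P i) (at (cmap P i p)) (X p i) = Y (f p) j"
proof -
  have "p \<in> points P" using p by (auto simp: points_iff)
  then have "tangent_map P Q f (p, X p) = (f p, Y (f p))" using r by (simp add: related_def)
  then show ?thesis using tangent_map_chart[OF P p X, of f Q j] j d by simp
qed

lemma tvec_self:
  assumes "diff_atlas M" "q \<in> cdom M i" "v \<in> tangent_space M q"
  shows "tvec M i q (v i) = v"
  by (rule tangent_space_eqI[OF tvec_in[OF assms(1,2)] assms(3,2) tvec_at[OF assms(1,2)]])

lemma tvec_lincomb:
  assumes "diff_atlas M" "q \<in> cdom M i"
  shows "tvec M i q (a *\<^sub>R u + b *\<^sub>R w) = (\<lambda>k. a *\<^sub>R tvec M i q u k + b *\<^sub>R tvec M i q w k)"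
  by (rule tangent_space_eqI[OF tvec_in[OF assms] tangent_space_lincomb[OF assms(1) tvec_in[OF assms] tvec_in[OF assms]] assms(2)])
    (simp add: tvec_at[OF assms])

text \<open>This is the velocity dependent force \<open>l\<close> when the system is read in chart
  \<open>j\<close> as a \<open>second_order\<close> field.\<close>

definition chart_force :: "('i, 'a, 'e::euclidean_space) mechanical_data \<Rightarrow> 'i \<Rightarrow> 'e \<Rightarrow> 'e \<Rightarrow> 'e" where
  "chart_force \<Sigma> j a u = snd (fibermap \<Sigma> (cinv (base \<Sigma>) j a, tvec (base \<Sigma>) j (cinv (base \<Sigma>) j a) u)) j"

lemma second_order_chart:
  assumes \<Sigma>: "mechanical_control_system \<Sigma>"
  defines "M \<equiv> base \<Sigma>"
  shows "second_order (cmap M j ` cdom M j) (\<lambda>a. conn \<Sigma> j (cinv M j a)) (\<lambda>a. field \<Sigma> 0 (cinv M j a) j) (chart_force \<Sigma> j)"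
proof (rule second_order.intro)
  have Ma: "analytic_atlas M" and \<Gamma>: "symmetric_connection M (conn \<Sigma>)"
    and X: "vector_field M (field \<Sigma> 0)"
    and d: "analytic_map (tangent_bundle M) (tangent_bundle M) (fibermap \<Sigma>)" and l: "fiberwise_linear M (fibermap \<Sigma>)"
    using \<Sigma> by (auto simp: mechanical_control_system_def M_def analytic_manifold_alt)
  note Md = analytic_atlas_imp_diff[OF Ma]
  let ?A = "cmap M j ` cdom M j"
  show A: "open ?A" by (rule open_chart[OF Md])
  show "bilinear (conn \<Sigma> j (cinv M j a))" "conn \<Sigma> j (cinv M j a) v w = conn \<Sigma> j (cinv M j a) w v" if "a \<in> ?A" for a v w
    using that connection_bilinear[OF \<Gamma>] connection_sym[OF \<Gamma>] by (auto simp: cinv_cmap[OF Md])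
  show "real_analytic_on (\<lambda>a. conn \<Sigma> j (cinv M j a) v w) ?A" for v w by (rule connection_analytic[OF \<Gamma>])
  show "real_analytic_on (\<lambda>a. field \<Sigma> 0 (cinv M j a) j) ?A" by (rule vector_field_analytic[OF X])
  show "linear (chart_force \<Sigma> j a)" if aA: "a \<in> ?A" for a
  proof -
    obtain q where q: "q \<in> cdom M j" "a = cmap M j q" using aA by blast
    have qp: "q \<in> points M" using q by (auto simp: points_iff)
    have f: "chart_force \<Sigma> j a u = snd (fibermap \<Sigma> (q, tvec M j q u)) j" for u
      unfolding chart_force_def M_def[symmetric] q(2) cinv_cmap[OF Md q(1)] ..
    have lc: "chart_force \<Sigma> j a (s *\<^sub>R u + t *\<^sub>R w) = s *\<^sub>R chart_force \<Sigma> j a u + t *\<^sub>R chart_force \<Sigma> j a w" for s t u w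
      unfolding f tvec_lincomb[OF Md q(1)]
      by (rule fiberwise_linearD(3)[OF l qp tvec_in[OF Md q(1)] tvec_in[OF Md q(1)]])
    show ?thesis
      by (rule linearI) (use lc[of 1 _ 1] lc[of _ _ 0] in auto)
  qed
  show "real_analytic_on (\<lambda>a. chart_force \<Sigma> j a u) ?A" for u
  proof -
    \<comment> \<open>For a fixed velocity \<open>u\<close>, the force is a slice of the chart
      expression of the fibre map, which is analytic on the tangent bundle.\<close>
    let ?h = "cmap (tangent_bundle M) j \<circ> fibermap \<Sigma> \<circ> cinv (tangent_bundle M) j"
    let ?S = "cmap (tangent_bundle M) j ` (cdom (tangent_bundle M) j \<inter> fibermap \<Sigma> -` cdom (tangent_bundle M) j)"
    have "real_analytic_on ?h ?S" using d by (simp add: analytic_map_def)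
    then have "real_analytic_on (\<lambda>x. snd (?h (x, u))) {x. (x, u) \<in> ?S}"
      by (intro real_analytic_on_bounded_linear[OF bounded_linear_snd] real_analytic_on_slice)
    moreover have "?A \<subseteq> {x. (x, u) \<in> ?S}"
    proof clarify
      fix q assume q: "q \<in> cdom M j"
      have qp: "q \<in> points M" using q by (auto simp: points_iff)
      note t = tvec_in[OF Md q, of u]
      have fq: "fibermap \<Sigma> (q, tvec M j q u) = (q, snd (fibermap \<Sigma> (q, tvec M j q u)))"
        by (rule prod_eqI) (simp_all add: fiberwise_linearD(1)[OF l qp t])
      have "fibermap \<Sigma> (q, tvec M j q u) \<in> cdom (tangent_bundle M) j"
        by (subst fq) (simp add: cdom_tangent_bundle q fiberwise_linearD(2)[OF l qp t])
      then have "(q, tvec M j q u) \<in> cdom (tangent_bundle M) j \<inter> fibermap \<Sigma> -` cdom (tangent_bundle M) j"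
        using q t by (simp add: cdom_tangent_bundle)
      moreover have "cmap (tangent_bundle M) j (q, tvec M j q u) = (cmap M j q, u)"
        by (simp add: cmap_tangent_bundle tvec_at[OF Md q])
      ultimately show "(cmap M j q, u) \<in> ?S" by (metis image_eqI)
    qed
    ultimately have "real_analytic_on (\<lambda>x. snd (?h (x, u))) ?A" by (rule real_analytic_on_subset)
    then show ?thesis
    proof (rule real_analytic_on_cong[OF _ A])
      fix x assume "x \<in> ?A"
      then obtain q where q: "q \<in> cdom M j" "x = cmap M j q" by blast
      show "snd (?h (x, u)) = chart_force \<Sigma> j x u"
        unfolding q(2) o_apply cinv_tangent_bundle_tvec[OF Md q(1)] chart_force_def M_def[symmetric] cinv_cmap[OF Md q(1)]
        by (cases "fibermap \<Sigma> (q, tvec M j q u)") (simp add: cmap_tangent_bundle)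
    qed
  qed
qed

lemma second_order_field_chart:
  assumes \<Sigma>: "mechanical_control_system \<Sigma>"
    and q: "q \<in> cdom (base \<Sigma>) j" and w: "w \<in> tangent_space (base \<Sigma>) q"
  shows "second_order.field (\<lambda>a. conn \<Sigma> j (cinv (base \<Sigma>) j a)) (\<lambda>a. field \<Sigma> 0 (cinv (base \<Sigma>) j a) j) (chart_force \<Sigma> j)
     (cmap (base \<Sigma>) j q, w j) = drift \<Sigma> (q, w) j"
proof -
  have Md: "diff_atlas (base \<Sigma>)"
    using \<Sigma> by (auto simp: mechanical_control_system_def analytic_manifold_alt intro: analytic_atlas_imp_diff)
  show ?thesis
    unfolding second_order.field_def[OF second_order_chart[OF \<Sigma>]] drift_chart[OF q w]
    by (simp add: cinv_cmap[OF Md q] chart_force_def tvec_self[OF Md q w])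
qed

lemma second_order_sym_chart:
  assumes \<Sigma>: "mechanical_control_system \<Sigma>" and q: "q \<in> cdom (base \<Sigma>) j"
  shows "second_order.sym (\<lambda>a. conn \<Sigma> j (cinv (base \<Sigma>) j a)) (\<lambda>a. X (cinv (base \<Sigma>) j a) j) (\<lambda>a. Y (cinv (base \<Sigma>) j a) j)
     (cmap (base \<Sigma>) j q) = sym_prod (base \<Sigma>) (conn \<Sigma>) X Y q j"
proof -
  have Md: "diff_atlas (base \<Sigma>)" and \<Gamma>: "symmetric_connection (base \<Sigma>) (conn \<Sigma>)"
    using \<Sigma> by (auto simp: mechanical_control_system_def analytic_manifold_alt intro: analytic_atlas_imp_diff)
  show ?thesis
    unfolding second_order.sym_def[OF second_order_chart[OF \<Sigma>]] sym_prod_def cov_deriv_chart[OF q] cinv_cmap[OF Md q]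
    by (simp add: connection_sym[OF \<Gamma> q, of "Y q j"] scaleR_2)
qed

section \<open>Quotients in charts\<close>

locale mechanical_quotient =
  fixes \<Sigma> :: "('i, 'a, 'e::euclidean_space) mechanical_data"
    and \<Sigma>' :: "('j, 'b, 'f::euclidean_space) mechanical_data"
    and p\<^sub>0 :: "'a \<times> ('i \<Rightarrow> 'e)" and p\<^sub>0' :: "'b \<times> ('j \<Rightarrow> 'f)"
    and U :: "('a \<times> ('i \<Rightarrow> 'e)) set" and V :: "('b \<times> ('j \<Rightarrow> 'f)) set"
    and \<tau> :: "'a \<times> ('i \<Rightarrow> 'e) \<Rightarrow> 'b \<times> ('j \<Rightarrow> 'f)"
  assumes acs: "affine_connection_control_system \<Sigma>"
    and ga: "geodesically_accessible \<Sigma>"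
    and lq: "local_quotient \<Sigma> p\<^sub>0 \<Sigma>' p\<^sub>0' U V \<tau>"
begin

abbreviation "M \<equiv> base \<Sigma>"
abbreviation "N \<equiv> base \<Sigma>'"
abbreviation "V\<^sub>1 \<equiv> fst ` V"
text \<open>Since \<tau> reaches only the points under \<open>V\<close>, the quotient is studied on
  the open submanifold that they form.\<close>

abbreviation "\<Sigma>\<^sub>1 \<equiv> restrict_system \<Sigma>' V\<^sub>1"
abbreviation "N\<^sub>1 \<equiv> submanifold N V\<^sub>1"
abbreviation "F i j \<equiv> cmap (TQ \<Sigma>') j \<circ> \<tau> \<circ> cinv (TQ \<Sigma>) i"
abbreviation "DF i j z \<equiv> frechet_derivative (F i j) (at z)"
abbreviation "G \<equiv> field \<Sigma> ` {1..inputs \<Sigma>}"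
abbreviation "G' \<equiv> field \<Sigma>' ` {1..inputs \<Sigma>}"
abbreviation "E \<equiv> iterated_products M (conn \<Sigma>) G"
abbreviation "E' \<equiv> iterated_products N\<^sub>1 (conn \<Sigma>') G'"

text \<open>The open set on which \<open>F i j\<close> represents \<tau>. Conditions on base points
  suffice, since a chart of a tangent bundle contains whole fibres.\<close>

definition \<Omega> :: "'i \<Rightarrow> 'j \<Rightarrow> ('e \<times> 'e) set" where
  "\<Omega> i j = {(cmap M i q, v i) | q v. (q, v) \<in> U \<and> q \<in> cdom M i \<and> fst (\<tau> (q, v)) \<in> cdom N j}"

lemma mech: "mechanical_control_system \<Sigma>" and mech': "mechanical_control_system \<Sigma>'"
  using acs lq by (auto simp: affine_connection_control_system_def local_quotient_def)

lemma Ma: "analytic_atlas M" and \<Gamma>: "symmetric_connection M (conn \<Sigma>)"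
  and Xr: "r \<in> {0..inputs \<Sigma>} \<Longrightarrow> vector_field M (field \<Sigma> r)"
  using mech by (auto simp: mechanical_control_system_def analytic_manifold_alt)

lemma Na: "analytic_atlas N"
  using mech' by (auto simp: mechanical_control_system_def analytic_manifold_alt)

lemma inputs': "inputs \<Sigma>' = inputs \<Sigma>" using lq by (simp add: local_quotient_def)

lemmas Md = analytic_atlas_imp_diff[OF Ma]
lemmas Nd = analytic_atlas_imp_diff[OF Na]
lemmas TMd = diff_atlas_tangent_bundle[OF Ma]
lemmas TNd = diff_atlas_tangent_bundle[OF Na]

lemma oU: "openin (mtop (TQ \<Sigma>)) U" and oV: "openin (mtop (TQ \<Sigma>')) V"
  using lq by (auto simp: local_quotient_def)

lemma oV1: "openin (mtop N) V\<^sub>1" by (rule openin_fst_image[OF Na oV])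

lemma mech1: "mechanical_control_system \<Sigma>\<^sub>1" by (rule mechanical_restrict_system[OF mech' oV1])

lemma N1a: "analytic_atlas N\<^sub>1" and \<Gamma>1: "symmetric_connection N\<^sub>1 (conn \<Sigma>')"
  and Xr': "r \<in> {0..inputs \<Sigma>} \<Longrightarrow> vector_field N\<^sub>1 (field \<Sigma>' r)"
  using mech1 by (auto simp: mechanical_control_system_def analytic_manifold_alt inputs')

lemmas N1d = analytic_atlas_imp_diff[OF N1a]

lemma U_points: "U \<subseteq> points (TQ \<Sigma>)" and V_points: "V \<subseteq> points (TQ \<Sigma>')"
  using openin_subset[OF oU] openin_subset[OF oV] by (simp_all add: topspace_mtop)

lemma UD:
  assumes "(q, v) \<in> U"
  shows "q \<in> points M" "v \<in> tangent_space M q"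
  using subsetD[OF U_points assms] by (simp_all add: points_tangent_bundle)

lemma VD:
  assumes "p \<in> V"
  shows "fst p \<in> points N" "snd p \<in> tangent_space N (fst p)" "fst p \<in> points N\<^sub>1" "snd p \<in> tangent_space N\<^sub>1 (fst p)"
proof -
  have "(fst p, snd p) \<in> points (TQ \<Sigma>')" using subsetD[OF V_points assms] by simp
  then show "fst p \<in> points N" "snd p \<in> tangent_space N (fst p)" by (simp_all only: points_tangent_bundle)
  then show "fst p \<in> points N\<^sub>1" "snd p \<in> tangent_space N\<^sub>1 (fst p)"
    using assms tangent_space_submanifold[OF Nd oV1] by (auto simp: points_submanifold)
qed

lemma \<tau>_analytic: "analytic_map (submanifold (TQ \<Sigma>) U) (submanifold (TQ \<Sigma>') V) \<tau>" and \<tau>_image: "\<tau> ` U = V"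
  using lq U_points V_points
  by (auto simp: local_quotient_def quotient_map_of_def points_submanifold Int_absorb1)

lemma \<tau>V: "p \<in> U \<Longrightarrow> \<tau> p \<in> V" using \<tau>_image by blast

lemma cont_\<tau>: "continuous_map (mtop (submanifold (TQ \<Sigma>) U)) (mtop (submanifold (TQ \<Sigma>') V)) \<tau>"
  using \<tau>_analytic by (simp add: analytic_map_def)

lemma \<tau>_cdom: "p \<in> U \<Longrightarrow> \<tau> p \<in> cdom (TQ \<Sigma>') j \<longleftrightarrow> fst (\<tau> p) \<in> cdom N j"
  using VD(2)[OF \<tau>V] cdom_tangent_bundle[of "fst (\<tau> p)" "snd (\<tau> p)" N j] by simp

lemma \<Omega>_alt: "\<Omega> i j = cmap (TQ \<Sigma>) i ` (cdom (TQ \<Sigma>) i \<inter> U \<inter> \<tau> -` (cdom (TQ \<Sigma>') j \<inter> V))" (is "_ = ?R")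
proof
  show "\<Omega> i j \<subseteq> ?R"
  proof
    fix z assume "z \<in> \<Omega> i j"
    then obtain q v where q: "z = (cmap M i q, v i)" "(q, v) \<in> U" "q \<in> cdom M i" "fst (\<tau> (q, v)) \<in> cdom N j"
      unfolding \<Omega>_def by blast
    have "(q, v) \<in> cdom (TQ \<Sigma>) i \<inter> U \<inter> \<tau> -` (cdom (TQ \<Sigma>') j \<inter> V)"
      using q UD(2)[OF q(2)] \<tau>V[OF q(2)] \<tau>_cdom[OF q(2)] by (simp add: cdom_tangent_bundle)
    moreover have "z = cmap (TQ \<Sigma>) i (q, v)" using q(1) by (simp add: cmap_tangent_bundle)
    ultimately show "z \<in> ?R" by blast
  qed
  show "?R \<subseteq> \<Omega> i j"
  proof
    fix z assume "z \<in> ?R"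
    then obtain q v where a: "(q, v) \<in> cdom (TQ \<Sigma>) i" "(q, v) \<in> U" "\<tau> (q, v) \<in> cdom (TQ \<Sigma>') j"
        and z: "z = cmap (TQ \<Sigma>) i (q, v)" by auto
    then show "z \<in> \<Omega> i j"
      using \<tau>_cdom[OF a(2)] unfolding \<Omega>_def z cmap_tangent_bundle cdom_tangent_bundle by blast
  qed
qed

lemma open_\<Omega>: "open (\<Omega> i j)"
proof -
  let ?P = "submanifold (TQ \<Sigma>) U"
  let ?T = "{p \<in> topspace (mtop ?P). \<tau> p \<in> cdom (submanifold (TQ \<Sigma>') V) j}"
  have "openin (mtop ?P) ?T" by (rule openin_continuous_map_preimage[OF cont_\<tau> openin_cdom])
  then have "open (cmap ?P i ` (?T \<inter> cdom ?P i))"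
    by (rule open_chart_image(1)[OF diff_atlas_submanifold[OF TMd oU]])
  moreover have "?T \<inter> cdom ?P i = cdom (TQ \<Sigma>) i \<inter> U \<inter> \<tau> -` (cdom (TQ \<Sigma>') j \<inter> V)"
    by (auto simp: topspace_mtop points_submanifold points_iff)
  ultimately show ?thesis unfolding \<Omega>_alt by simp
qed

lemma F_analytic: "real_analytic_on (F i j) (\<Omega> i j)"
proof -
  let ?P = "submanifold (TQ \<Sigma>) U"
  have "real_analytic_on (cmap (TQ \<Sigma>') j \<circ> \<tau> \<circ> cinv ?P i) (\<Omega> i j)"
    using \<tau>_analytic unfolding analytic_map_def \<Omega>_alt by simp
  then show ?thesis
    by (rule real_analytic_on_cong[OF _ open_\<Omega>])
      (auto simp: \<Omega>_alt inv_into_f_f[OF diff_atlas_inj[OF TMd]] cinv_submanifold[OF TMd])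
qed

lemma \<Omega>I: "(q, v) \<in> U \<Longrightarrow> q \<in> cdom M i \<Longrightarrow> fst (\<tau> (q, v)) \<in> cdom N j \<Longrightarrow> (cmap M i q, v i) \<in> \<Omega> i j"
  unfolding \<Omega>_def by blast

lemma \<Omega>E:
  assumes "z \<in> \<Omega> i j"
  obtains q v where "(q, v) \<in> U" "q \<in> cdom M i" "fst (\<tau> (q, v)) \<in> cdom N j" "z = (cmap M i q, v i)"
  using assms unfolding \<Omega>_def by blast

lemma F_at:
  assumes "(q, v) \<in> U" "q \<in> cdom M i"
  shows "F i j (cmap M i q, v i) = (cmap N j (fst (\<tau> (q, v))), snd (\<tau> (q, v)) j)"
  using cinv_tangent_bundle[OF Md assms(2) UD(2)[OF assms(1)]]
    cmap_tangent_bundle[of N j "fst (\<tau> (q, v))" "snd (\<tau> (q, v))"] by simp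

text \<open>The hypothesis refers to the atlases restricted to \<open>U\<close> and
  \<open>V\<close>. On the open set \<open>\<Omega> i j\<close> their representative of \<tau>
  coincides with \<open>F i j\<close>, hence so do the derivatives.\<close>

lemma related_F:
  assumes r: "related (submanifold (TQ \<Sigma>) U) (submanifold (TQ \<Sigma>') V) \<tau> X Y"
    and q: "(q, v) \<in> U" "q \<in> cdom M i" "fst (\<tau> (q, v)) \<in> cdom N j"
    and X: "X (q, v) \<in> tangent_space (TQ \<Sigma>) (q, v)"
  shows "DF i j (cmap M i q, v i) (X (q, v) i) = Y (\<tau> (q, v)) j"
proof -
  let ?P = "submanifold (TQ \<Sigma>) U" and ?Q = "submanifold (TQ \<Sigma>') V"
  have P: "diff_atlas ?P" by (rule diff_atlas_submanifold[OF TMd oU])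
  have p: "(q, v) \<in> cdom ?P i" using q UD(2)[OF q(1)] by (simp add: cdom_tangent_bundle)
  have j: "\<tau> (q, v) \<in> cdom ?Q j" using q \<tau>V[OF q(1)] \<tau>_cdom[OF q(1)] by simp
  have X': "X (q, v) \<in> tangent_space ?P (q, v)" using X tangent_space_submanifold[OF TMd oU q(1)] by simp
  have z: "(cmap M i q, v i) \<in> \<Omega> i j" by (rule \<Omega>I[OF q])
  have eq: "(cmap (TQ \<Sigma>') j \<circ> \<tau> \<circ> inv_into (cdom (TQ \<Sigma>) i \<inter> U) (cmap (TQ \<Sigma>) i)) z = F i j z"
    if "z \<in> \<Omega> i j" for z
    using that by (auto simp: \<Omega>_alt inv_into_f_f[OF diff_atlas_inj[OF TMd]] cinv_submanifold[OF TMd])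
  have d: "(cmap ?Q j \<circ> \<tau> \<circ> cinv ?P i) differentiable at (cmap ?P i (q, v))"
    unfolding submanifold_simps cmap_tangent_bundle
    by (rule iffD2[OF differentiable_cong_open[OF open_\<Omega> z eq] real_analytic_on_differentiable[OF F_analytic z]])
  show ?thesis
    by (rule trans[OF fun_cong[OF frechet_derivative_cong_open[OF open_\<Omega> z eq, symmetric]]
          related_chart[OF P r p X' j d, unfolded submanifold_simps cmap_tangent_bundle]])
qed

lemma acs_zero:
  assumes "q \<in> points M"
  shows "field \<Sigma> 0 q = (\<lambda>i. 0)" and "v \<in> tangent_space M q \<Longrightarrow> fibermap \<Sigma> (q, v) = (q, \<lambda>i. 0)"
  using acs assms by (auto simp: affine_connection_control_system_def)

text \<open>The vanishing forces of \<open>\<Sigma>\<close> are kept in the expression, so that both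
  sides have the form treated in \<open>second_order\<close>.\<close>

abbreviation "S i \<equiv> second_order.field (\<lambda>a. conn \<Sigma> i (cinv M i a)) (\<lambda>a. field \<Sigma> 0 (cinv M i a) i) (chart_force \<Sigma> i)"
abbreviation "S' j \<equiv> second_order.field (\<lambda>a. conn \<Sigma>' j (cinv N\<^sub>1 j a)) (\<lambda>a. field \<Sigma>' 0 (cinv N\<^sub>1 j a) j) (chart_force \<Sigma>\<^sub>1 j)"

lemma S_at:
  assumes "(q, v) \<in> U" "q \<in> cdom M i"
  shows "S i (cmap M i q, v i) = (v i, - conn \<Sigma> i q (v i) (v i))"
  unfolding second_order_field_chart[OF mech assms(2) UD(2)[OF assms(1)]] drift_chart[OF assms(2) UD(2)[OF assms(1)]]
  using acs_zero[OF UD(1)[OF assms(1)]] UD(2)[OF assms(1)] by simp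

lemma S'_at:
  assumes "(q, v) \<in> U" "fst (\<tau> (q, v)) \<in> cdom N j"
  shows "S' j (cmap N j (fst (\<tau> (q, v))), snd (\<tau> (q, v)) j) = drift \<Sigma>' (\<tau> (q, v)) j"
proof -
  let ?y = "fst (\<tau> (q, v))" and ?w = "snd (\<tau> (q, v))"
  have y: "?y \<in> cdom (base \<Sigma>\<^sub>1) j" using assms \<tau>V[OF assms(1)] by simp
  have w: "?w \<in> tangent_space (base \<Sigma>\<^sub>1) ?y" and w': "?w \<in> tangent_space N ?y"
    using VD[OF \<tau>V[OF assms(1)]] by simp_all
  have "S' j (cmap N j ?y, ?w j) = drift \<Sigma>\<^sub>1 (?y, ?w) j"
    using second_order_field_chart[OF mech1 y w] by simp
  also have "\<dots> = drift \<Sigma>' (?y, ?w) j"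
    unfolding drift_chart[OF y w] drift_chart[OF assms(2) w'] by simp
  finally show ?thesis by simp
qed

lemma spray_related:
  assumes "z \<in> \<Omega> i j"
  shows "DF i j z (S i z) = S' j (F i j z)"
proof -
  obtain q v where q: "(q, v) \<in> U" "q \<in> cdom M i" "fst (\<tau> (q, v)) \<in> cdom N j" "z = (cmap M i q, v i)"
    using assms by (rule \<Omega>E)
  have r: "related (submanifold (TQ \<Sigma>) U) (submanifold (TQ \<Sigma>') V) \<tau> (spray M (conn \<Sigma>)) (drift \<Sigma>')"
    using lq by (simp add: local_quotient_def)
  have "spray M (conn \<Sigma>) (q, v) i = S i z"
    unfolding q(4) S_at[OF q(1,2)] using q(2) by (simp add: spray_def)
  then show ?thesis
    using related_F[OF r q(1-3) spray_in[OF Ma \<Gamma> UD(2)[OF q(1)]]] S'_at[OF q(1,3)] F_at[OF q(1,2), of j]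
    by (simp only: q(4))
qed

text \<open>The vertical lifts of \<open>X\<close> and \<open>X'\<close> are \<open>\<tau>\<close>-related, expressed in charts.\<close>

definition vrel :: "('a \<Rightarrow> 'i \<Rightarrow> 'e) \<Rightarrow> ('b \<Rightarrow> 'j \<Rightarrow> 'f) \<Rightarrow> bool" where
  "vrel X X' \<longleftrightarrow> (\<forall>i j q v. (q, v) \<in> U \<longrightarrow> q \<in> cdom M i \<longrightarrow> fst (\<tau> (q, v)) \<in> cdom N j \<longrightarrow>
     DF i j (cmap M i q, v i) (0, X q i) = (0, X' (fst (\<tau> (q, v))) j))"

lemma vrel_field:
  assumes "r \<in> {1..inputs \<Sigma>}"
  shows "vrel (field \<Sigma> r) (field \<Sigma>' r)"
  unfolding vrel_def
proof (intro allI impI)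
  fix i j q v assume q: "(q, v) \<in> U" "q \<in> cdom M i" "fst (\<tau> (q, v)) \<in> cdom N j"
  have r: "related (submanifold (TQ \<Sigma>) U) (submanifold (TQ \<Sigma>') V) \<tau> (vlft M (field \<Sigma> r)) (vlft N (field \<Sigma>' r))"
    using lq assms by (simp add: local_quotient_def)
  have X: "field \<Sigma> r q \<in> tangent_space M q" using Xr[of r] assms vector_field_in UD(1)[OF q(1)] by auto
  note w = VD(2)[OF \<tau>V[OF q(1)]]
  have "DF i j (cmap M i q, v i) (vlft M (field \<Sigma> r) (q, v) i) = vlft N (field \<Sigma>' r) (\<tau> (q, v)) j"
    by (rule related_F[OF r q vlft_in[where X = "field \<Sigma> r", OF Ma UD(2)[OF q(1)] X]])
  then show "DF i j (cmap M i q, v i) (0, field \<Sigma> r q i) = (0, field \<Sigma>' r (fst (\<tau> (q, v))) j)"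
    using vlft_chart[OF q(2) UD(2)[OF q(1)], of "field \<Sigma> r"] vlft_chart[OF q(3) w, of "field \<Sigma>' r"] by simp
qed

lemma vrel_sym_prod:
  assumes X: "vector_field M X" and Y: "vector_field M Y" and X': "vector_field N\<^sub>1 X'" and Y': "vector_field N\<^sub>1 Y'"
    and rX: "vrel X X'" and rY: "vrel Y Y'"
  shows "vrel (sym_prod M (conn \<Sigma>) X Y) (sym_prod N\<^sub>1 (conn \<Sigma>') X' Y')"
  unfolding vrel_def
proof (intro allI impI)
  fix i j q v assume q: "(q, v) \<in> U" "q \<in> cdom M i" "fst (\<tau> (q, v)) \<in> cdom N j"
  let ?y = "fst (\<tau> (q, v))"
  have y: "fst (\<tau> (q, v)) \<in> cdom N\<^sub>1 j" if "(q, v) \<in> U" "fst (\<tau> (q, v)) \<in> cdom N j" for q v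
    using that \<tau>V[OF that(1)] by simp
  have so: "second_order (cmap M i ` cdom M i) (\<lambda>a. conn \<Sigma> i (cinv M i a)) (\<lambda>a. field \<Sigma> 0 (cinv M i a) i) (chart_force \<Sigma> i)"
    by (rule second_order_chart[OF mech])
  have so': "second_order (cmap N\<^sub>1 j ` cdom N\<^sub>1 j) (\<lambda>a. conn \<Sigma>' j (cinv N\<^sub>1 j a)) (\<lambda>a. field \<Sigma>' 0 (cinv N\<^sub>1 j a) j) (chart_force \<Sigma>\<^sub>1 j)"
    using second_order_chart[OF mech1, of j] by (simp only: restrict_system_simps)
  \<comment> \<open>\<open>vrel\<close> speaks of points and \<open>related_sym\<close> of
    coordinates; inverting the charts translates one into the other.\<close>
  have vr: "DF i j z (0, X (cinv M i (fst z)) i) = (0, X' (cinv N\<^sub>1 j (fst (F i j z))) j)"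
    if XX: "vrel X X'" and zO: "z \<in> \<Omega> i j" for X X' z
  proof -
    obtain q v where q: "(q, v) \<in> U" "q \<in> cdom M i" "fst (\<tau> (q, v)) \<in> cdom N j" "z = (cmap M i q, v i)"
      using zO by (rule \<Omega>E)
    have "cinv N\<^sub>1 j (cmap N j (fst (\<tau> (q, v)))) = fst (\<tau> (q, v))"
      using cinv_cmap[OF N1d y[OF q(1,3)]] by simp
    then show ?thesis
      using XX q unfolding vrel_def q(4) F_at[OF q(1,2)] fst_conv cinv_cmap[OF Md q(2)] by simp
  qed
  have "DF i j (cmap M i q, v i) (0, second_order.sym (\<lambda>a. conn \<Sigma> i (cinv M i a)) (\<lambda>a. X (cinv M i a) i) (\<lambda>a. Y (cinv M i a) i)
          (fst (cmap M i q, v i))) =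
     (0, second_order.sym (\<lambda>a. conn \<Sigma>' j (cinv N\<^sub>1 j a)) (\<lambda>a. X' (cinv N\<^sub>1 j a) j) (\<lambda>a. Y' (cinv N\<^sub>1 j a) j)
          (fst (F i j (cmap M i q, v i))))"
  proof (rule related_sym[OF so so' F_analytic open_\<Omega> _ _ vector_field_analytic[OF X] vector_field_analytic[OF Y]
        vector_field_analytic[OF X'] vector_field_analytic[OF Y'] spray_related vr[OF rX] vr[OF rY] \<Omega>I[OF q]])
    show "fst z \<in> cmap M i ` cdom M i" if "z \<in> \<Omega> i j" for z using that by (auto elim!: \<Omega>E)
    show "fst (F i j z) \<in> cmap N\<^sub>1 j ` cdom N\<^sub>1 j" if zO: "z \<in> \<Omega> i j" for z
    proof -
      obtain q v where q: "(q, v) \<in> U" "q \<in> cdom M i" "fst (\<tau> (q, v)) \<in> cdom N j" "z = (cmap M i q, v i)"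
        using zO by (rule \<Omega>E)
      show ?thesis unfolding q(4) F_at[OF q(1,2)] fst_conv submanifold_simps(2)[symmetric, of N j V\<^sub>1] by (rule imageI[OF y[OF q(1,3)]])
    qed
  qed
  then show "DF i j (cmap M i q, v i) (0, sym_prod M (conn \<Sigma>) X Y q i) = (0, sym_prod N\<^sub>1 (conn \<Sigma>') X' Y' ?y j)"
    using second_order_sym_chart[OF mech q(2), of X Y] second_order_sym_chart[OF mech1, of ?y j X' Y'] y[OF q(1,3)]
    unfolding F_at[OF q(1,2)] fst_conv restrict_system_simps by simp
qed

section \<open>Matching iterated products and the action on vertical vectors\<close>

lemma E_vf: "X \<in> E \<Longrightarrow> vector_field M X"
  by (rule iterated_products_vector_field[OF Ma \<Gamma>]) (use Xr in auto)

lemma E'_vf: "X \<in> E' \<Longrightarrow> vector_field N\<^sub>1 X"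
  by (rule iterated_products_vector_field[OF N1a \<Gamma>1]) (use Xr' in auto)

text \<open>The partner of \<open>X\<close> is the same bracket expression formed from the inputs of
  the quotient. \<open>vrel_E'\<close> follows the correspondence in the other direction.\<close>

lemma vrel_E:
  assumes "X \<in> E"
  shows "\<exists>X'\<in>E'. vrel X X'"
  using assms
proof induction
  case (gen X)
  then obtain r where "r \<in> {1..inputs \<Sigma>}" "X = field \<Sigma> r" by blast
  then show ?case using vrel_field iterated_products.gen[of "field \<Sigma>' r" G'] by blast
next
  case (prod X Y)
  then obtain X' Y' where "X' \<in> E'" "vrel X X'" "Y' \<in> E'" "vrel Y Y'" by blast
  then show ?case
    using vrel_sym_prod[OF E_vf[OF prod(1)] E_vf[OF prod(2)] E'_vf E'_vf] iterated_products.prod by blast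
qed

text \<open>Accessibility provides a member of \<open>Sym\<close> with any prescribed value at
  \<open>q\<close>, and that value is a linear combination of values of iterated products.\<close>

lemma span_E:
  assumes q: "q \<in> cdom M i"
  shows "span ((\<lambda>X. X q i) ` E) = UNIV"
proof -
  have qp: "q \<in> points M" using q by (auto simp: points_iff)
  have "w \<in> span ((\<lambda>X. X q i) ` E)" for w
  proof -
    have "tvec M i q w \<in> (\<lambda>X. X q) ` Sym M (conn \<Sigma>) G"
      using ga qp tvec_in[OF Md q, of w] unfolding geodesically_accessible_def by blast
    then obtain X where X: "X \<in> Sym M (conn \<Sigma>) G" "X q = tvec M i q w" by force
    have "module_span M E X"
      by (rule Sym_module_span[OF Ma \<Gamma> _ X(1)]) (use Xr in auto)
    then have "X q i \<in> span ((\<lambda>X. X q i) ` E)" using qp by (rule module_span_value)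
    then show ?thesis unfolding X(2) tvec_at[OF Md q] .
  qed
  then show ?thesis by blast
qed

lemma linear_DF: "z \<in> \<Omega> i j \<Longrightarrow> linear (DF i j z)"
  by (rule linear_frechet_derivative[OF real_analytic_on_differentiable[OF F_analytic]])

lemma vertical:
  assumes "z \<in> \<Omega> i j"
  shows "fst (DF i j z (0, w)) = 0"
proof -
  obtain q v where q: "(q, v) \<in> U" "q \<in> cdom M i" "fst (\<tau> (q, v)) \<in> cdom N j" "z = (cmap M i q, v i)"
    using assms by (rule \<Omega>E)
  interpret linear "DF i j z" by (rule linear_DF[OF assms])
  have lin: "linear (\<lambda>w. fst (DF i j z (0, w)))"
  proof (rule linearI)
    show "fst (DF i j z (0, a + b)) = fst (DF i j z (0, a)) + fst (DF i j z (0, b))" for a b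
      using add[of "(0, a)" "(0, b)"] by (simp del: o_apply)
    show "fst (DF i j z (0, c *\<^sub>R a)) = c *\<^sub>R fst (DF i j z (0, a))" for c a
      using scale[of c "(0, a)"] by (simp del: o_apply)
  qed
  show ?thesis
  proof (rule linear_eq_0_on_span[OF lin])
    show "w \<in> span ((\<lambda>X. X q i) ` E)" using span_E[OF q(2)] by simp
    fix x assume "x \<in> (\<lambda>X. X q i) ` E"
    then obtain X where X: "X \<in> E" "x = X q i" by blast
    obtain X' where "vrel X X'" using vrel_E[OF X(1)] by blast
    then show "fst (DF i j z (0, x)) = 0" using q unfolding vrel_def X(2) by (simp del: o_apply)
  qed
qed

text \<open>The base component of a second-order field is the velocity, on either side of the
  relation; this prepares the hypothesis \<open>spray\<close> of
  \<open>tangent_map_on_box\<close>.\<close>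

lemma spray_fst:
  assumes "z \<in> \<Omega> i j"
  shows "fst (DF i j z (snd z, snd (S i z))) = snd (F i j z)"
proof -
  obtain q v where q: "(q, v) \<in> U" "q \<in> cdom M i" "fst (\<tau> (q, v)) \<in> cdom N j" "z = (cmap M i q, v i)"
    using assms by (rule \<Omega>E)
  have "S i z = (snd z, snd (S i z))" unfolding q(4) S_at[OF q(1,2)] by simp
  moreover have "fst (S' j (F i j z)) = snd (F i j z)"
    unfolding second_order.field_def[OF second_order_chart[OF mech1, of j], unfolded restrict_system_simps]
    by (simp add: case_prod_beta)
  ultimately show ?thesis using spray_related[OF assms] by (simp del: o_apply)
qed

lemma vrel_E':
  assumes "X' \<in> E'"
  shows "\<exists>X\<in>E. vrel X X'"
  using assms
proof induction
  case (gen X)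
  then obtain r where "r \<in> {1..inputs \<Sigma>}" "X = field \<Sigma>' r" by blast
  then show ?case using vrel_field iterated_products.gen[of "field \<Sigma> r" G] by blast
next
  case (prod X' Y')
  then obtain X Y where "X \<in> E" "vrel X X'" "Y \<in> E" "vrel Y Y'" by blast
  then show ?case
    using vrel_sym_prod[OF E_vf E_vf E'_vf[OF prod(1)] E'_vf[OF prod(2)]] iterated_products.prod by blast
qed

section \<open>The quotient map is a tangent map\<close>

lemmas tangent_map_on_\<Omega> = tangent_map_on_box[OF F_analytic open_\<Omega> _ _ vertical spray_fst]

text \<open>The base component of \<tau> in charts with the velocity frozen at \<open>v\<close>.
  Within a box inside \<open>\<Omega> i j\<close> its value does not depend on this choice.\<close>

abbreviation "\<phi> i j v \<equiv> \<lambda>x. fst (F i j (x, v))"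
abbreviation "D\<phi> i j q v \<equiv> frechet_derivative (\<phi> i j (v i)) (at (cmap M i q))"

definition tangent_box :: "'i \<Rightarrow> 'j \<Rightarrow> 'a \<Rightarrow> ('i \<Rightarrow> 'e) \<Rightarrow> real \<Rightarrow> bool" where
  "tangent_box i j q v r \<longleftrightarrow> r > 0 \<and> ball (cmap M i q) r \<times> ball (v i) r \<subseteq> \<Omega> i j"

text \<open>The set \<open>Z\<close> allows the box to be kept inside the smaller neighbourhood
  \<open>U\<^sub>0\<close> in \<open>is_tangent_map\<close>.\<close>

lemma tangent_box_exists:
  assumes q: "(q, v) \<in> U" "q \<in> cdom M i" "fst (\<tau> (q, v)) \<in> cdom N j"
    and Z: "open Z" "(cmap M i q, v i) \<in> Z"
  obtains r where "tangent_box i j q v r" "ball (cmap M i q) r \<times> ball (v i) r \<subseteq> Z"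
proof -
  have Z': "open (\<Omega> i j \<inter> Z)" "(cmap M i q, v i) \<in> \<Omega> i j \<inter> Z" using open_\<Omega> Z \<Omega>I[OF q] by auto
  obtain r where r: "r > 0" "ball (cmap M i q) r \<times> ball (v i) r \<subseteq> \<Omega> i j \<inter> Z"
    using box_in_open[OF Z'] by auto
  show ?thesis by (rule that[of r]) (use r in \<open>auto simp: tangent_box_def\<close>)
qed

lemma tangent_box_exists':
  assumes "(q, v) \<in> U" "q \<in> cdom M i" "fst (\<tau> (q, v)) \<in> cdom N j"
  obtains r where "tangent_box i j q v r"
  using tangent_box_exists[OF assms open_UNIV UNIV_I] by blast

lemma tangent_boxD:
  assumes "tangent_box i j q v r"
  shows "r > 0" "ball (cmap M i q) r \<times> ball (v i) r \<subseteq> \<Omega> i j"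
    "cmap M i q \<in> ball (cmap M i q) r" "v i \<in> ball (v i) r"
  using assms by (auto simp: tangent_box_def)

lemma tangent_box_form:
  assumes b: "tangent_box i j q v r"
  shows tangent_box_analytic: "real_analytic_on (\<phi> i j (v i)) (ball (cmap M i q) r)"
    and tangent_box_F: "x \<in> ball (cmap M i q) r \<Longrightarrow> w \<in> ball (v i) r \<Longrightarrow>
      F i j (x, w) = (\<phi> i j (v i) x, frechet_derivative (\<phi> i j (v i)) (at x) w)"
    and tangent_box_DF: "x \<in> ball (cmap M i q) r \<Longrightarrow> w \<in> ball (v i) r \<Longrightarrow>
      DF i j (x, w) (\<xi>, \<eta>) = (frechet_derivative (\<phi> i j (v i)) (at x) \<xi>,
       frechet_derivative (\<lambda>z. frechet_derivative (\<phi> i j (v i)) (at z) w) (at x) \<xi>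
         + frechet_derivative (\<phi> i j (v i)) (at x) \<eta>)"
  using tangent_map_on_\<Omega>(1)[OF tangent_boxD(1,2)[OF b]]
    tangent_map_on_\<Omega>(2)[OF tangent_boxD(1,2)[OF b], of x w]
    tangent_map_on_\<Omega>(3)[OF tangent_boxD(1,2)[OF b], of x w \<xi> \<eta>] by (blast, blast, blast)

lemma D\<phi>_linear:
  assumes q: "(q, v) \<in> U" "q \<in> cdom M i" "fst (\<tau> (q, v)) \<in> cdom N j"
  shows "linear (D\<phi> i j q v)"
proof -
  obtain r where b: "tangent_box i j q v r" using q by (rule tangent_box_exists')
  show ?thesis
    by (rule linear_frechet_derivative[OF real_analytic_on_differentiable[OF tangent_box_analytic[OF b] tangent_boxD(3)[OF b]]])
qed

text \<open>On vertical vectors \<open>DF\<close> acts as \<open>D\<phi>\<close>, so related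
  vertical lifts become related fields on the base.\<close>

lemma D\<phi>_vrel:
  assumes q: "(q, v) \<in> U" "q \<in> cdom M i" "fst (\<tau> (q, v)) \<in> cdom N j" and X: "vrel X X'"
  shows "D\<phi> i j q v (X q i) = X' (fst (\<tau> (q, v))) j"
proof -
  obtain r where b: "tangent_box i j q v r" using q by (rule tangent_box_exists')
  note x = tangent_boxD(3,4)[OF b]
  have "linear (frechet_derivative (\<lambda>z. frechet_derivative (\<phi> i j (v i)) (at z) (v i)) (at (cmap M i q)))"
    by (rule linear_frechet_derivative[OF real_analytic_on_differentiable[OF
            real_analytic_on_deriv_const[OF tangent_box_analytic[OF b] open_ball] x(1)]])
  then have "snd (DF i j (cmap M i q, v i) (0, X q i)) = D\<phi> i j q v (X q i)"
    unfolding tangent_box_DF[OF b x] by (simp add: linear_0 del: o_apply)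
  moreover have "DF i j (cmap M i q, v i) (0, X q i) = (0, X' (fst (\<tau> (q, v))) j)"
    using X q unfolding vrel_def by blast
  ultimately show ?thesis by (simp del: o_apply)
qed

lemma D\<phi>_velocity:
  assumes q: "(q, v) \<in> U" "q \<in> cdom M i" "fst (\<tau> (q, v)) \<in> cdom N j"
  shows "D\<phi> i j q v (v i) = snd (\<tau> (q, v)) j"
proof -
  obtain r where b: "tangent_box i j q v r" using q by (rule tangent_box_exists')
  show ?thesis
    using tangent_box_F[OF b tangent_boxD(3,4)[OF b]] F_at[OF q(1,2), of j] by (simp del: o_apply)
qed

text \<open>\<open>D\<phi>\<close> carries the whole tangent space, spanned by the values of
  \<open>E\<close>, into the span of the values of \<open>E'\<close>. The velocity of
  \<open>\<tau> (q, v)\<close> is its value at \<open>v\<close>.\<close>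

lemma velocity_in_span:
  assumes q: "(q, v) \<in> U" "q \<in> cdom M i" "fst (\<tau> (q, v)) \<in> cdom N j"
  shows "snd (\<tau> (q, v)) j \<in> span ((\<lambda>X'. X' (fst (\<tau> (q, v))) j) ` E')"
proof -
  have "D\<phi> i j q v ` span ((\<lambda>X. X q i) ` E) = span (D\<phi> i j q v ` (\<lambda>X. X q i) ` E)"
    by (rule linear_span_image[OF D\<phi>_linear[OF q], symmetric])
  also have "\<dots> \<subseteq> span ((\<lambda>X'. X' (fst (\<tau> (q, v))) j) ` E')"
  proof (rule span_mono)
    show "D\<phi> i j q v ` (\<lambda>X. X q i) ` E \<subseteq> (\<lambda>X'. X' (fst (\<tau> (q, v))) j) ` E'"
    proof
      fix u assume "u \<in> D\<phi> i j q v ` (\<lambda>X. X q i) ` E"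
      then obtain X where X: "X \<in> E" "u = D\<phi> i j q v (X q i)" by blast
      obtain X' where X': "X' \<in> E'" "vrel X X'" using vrel_E[OF X(1)] by blast
      show "u \<in> (\<lambda>X'. X' (fst (\<tau> (q, v))) j) ` E'"
        unfolding X(2) D\<phi>_vrel[OF q X'(2)] by (rule imageI[OF X'(1)])
    qed
  qed
  finally have "D\<phi> i j q v (v i) \<in> span ((\<lambda>X'. X' (fst (\<tau> (q, v))) j) ` E')"
    unfolding span_E[OF q(2)] by blast
  then show ?thesis unfolding D\<phi>_velocity[OF q] .
qed

text \<open>
  Surjectivity of \<open>\<tau>\<close> makes the nonempty open set \<open>V \<inter> T\<^sub>y Q'\<close> consist of velocities of the form
  above, so the iterated symmetric products span \<open>T\<^sub>y Q'\<close>.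
\<close>

lemma span_E':
  assumes y: "y \<in> V\<^sub>1" "y \<in> cdom N j"
  shows "span ((\<lambda>X'. X' y j) ` E') = UNIV"
proof (rule subspace_open_subset[OF subspace_span])
  let ?T = "Pair (cmap N j y) -` (cmap (TQ \<Sigma>') j ` (V \<inter> cdom (TQ \<Sigma>') j))"
  show "open ?T"
    by (rule open_vimage[OF open_chart_image(1)[OF TNd oV]]) (intro continuous_intros)
  obtain w where w: "(y, w) \<in> V" using y(1) by force
  have "(y, w) \<in> V \<inter> cdom (TQ \<Sigma>') j" using VD(2)[OF w] w y(2) by (simp add: cdom_tangent_bundle)
  then have "cmap (TQ \<Sigma>') j (y, w) \<in> cmap (TQ \<Sigma>') j ` (V \<inter> cdom (TQ \<Sigma>') j)" by (rule imageI)
  then have "w j \<in> ?T" unfolding cmap_tangent_bundle by simp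
  then show "?T \<noteq> {}" by blast
  show "?T \<subseteq> span ((\<lambda>X'. X' y j) ` E')"
  proof
    fix u assume "u \<in> ?T"
    then obtain p where p: "p \<in> V" "p \<in> cdom (TQ \<Sigma>') j" "(cmap N j y, u) = cmap (TQ \<Sigma>') j p" by auto
    obtain y' w' where yw: "p = (y', w')" by (cases p)
    have y': "y' \<in> cdom N j" using p(2) by (simp add: yw cdom_tangent_bundle)
    have "cmap N j y' = cmap N j y" and u: "u = w' j" using p(3) by (simp_all add: yw cmap_tangent_bundle)
    then have "y' = y" using inj_onD[OF diff_atlas_inj[OF Nd, of j]] y' y(2) by blast
    have "p \<in> \<tau> ` U" using p(1) unfolding \<tau>_image .
    then obtain q v where qv: "(q, v) \<in> U" "\<tau> (q, v) = p" by auto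
    obtain i where i: "q \<in> cdom M i" using UD(1)[OF qv(1)] by (auto simp: points_iff)
    show "u \<in> span ((\<lambda>X'. X' y j) ` E')"
      using velocity_in_span[OF qv(1) i, of j] y' unfolding qv(2) yw u \<open>y' = y\<close> by simp
  qed
qed

text \<open>Every value of a member of \<open>E'\<close> is the image of the value of its partner in
  \<open>E\<close>, and the former span the target.\<close>

lemma D\<phi>_surj:
  assumes q: "(q, v) \<in> U" "q \<in> cdom M i" "fst (\<tau> (q, v)) \<in> cdom N j"
  shows "range (D\<phi> i j q v) = UNIV"
proof -
  have y: "fst (\<tau> (q, v)) \<in> V\<^sub>1" using \<tau>V[OF q(1)] by blast
  have "span ((\<lambda>X'. X' (fst (\<tau> (q, v))) j) ` E') \<subseteq> range (D\<phi> i j q v)"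
  proof (rule span_minimal)
    show "subspace (range (D\<phi> i j q v))" by (rule linear_subspace_image[OF D\<phi>_linear[OF q] subspace_UNIV])
    show "(\<lambda>X'. X' (fst (\<tau> (q, v))) j) ` E' \<subseteq> range (D\<phi> i j q v)"
    proof
      fix u assume "u \<in> (\<lambda>X'. X' (fst (\<tau> (q, v))) j) ` E'"
      then obtain X' where X': "X' \<in> E'" "u = X' (fst (\<tau> (q, v))) j" by blast
      obtain X where X: "vrel X X'" using vrel_E'[OF X'(1)] by blast
      show "u \<in> range (D\<phi> i j q v)" unfolding X'(2) D\<phi>_vrel[OF q X, symmetric] by (rule rangeI)
    qed
  qed
  then show ?thesis unfolding span_E'[OF y q(3)] by blast
qed

text \<open>
  Along a fibre, the second component of the spray relation is polynomial of degree two in the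
  velocity; its terms of degree zero and one are the forces of the quotient.
\<close>

lemma forces_vanish:
  assumes q: "(q, v) \<in> U" "q \<in> cdom M i" "fst (\<tau> (q, v)) \<in> cdom N j"
  shows "field \<Sigma>' 0 (fst (\<tau> (q, v))) j = 0" and "chart_force \<Sigma>\<^sub>1 j (cmap N j (fst (\<tau> (q, v)))) u = 0"
proof -
  let ?x = "cmap M i q" and ?y = "fst (\<tau> (q, v))"
  let ?\<phi> = "\<phi> i j (v i)" and ?D = "D\<phi> i j q v"
  let ?D2 = "\<lambda>a b. frechet_derivative (\<lambda>z. frechet_derivative ?\<phi> (at z) b) (at ?x) a"
  obtain r where b: "tangent_box i j q v r" using q by (rule tangent_box_exists')
  note r = tangent_boxD(1)[OF b] and box = tangent_boxD(2)[OF b] and x = tangent_boxD(3)[OF b]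
    and an = tangent_box_analytic[OF b] and Fxw = tangent_box_F[OF b] and DFxw = tangent_box_DF[OF b]
  have lin: "linear ?D" by (rule D\<phi>_linear[OF q])
  have yN: "?y \<in> cdom N\<^sub>1 j" using q \<tau>V[OF q(1)] by simp
  have cy: "cinv N\<^sub>1 j (cmap N j ?y) = ?y" using cinv_cmap[OF N1d yN] by simp
  have \<phi>x: "?\<phi> ?x = cmap N j ?y" using F_at[OF q(1,2), of j] by (simp del: o_apply)
  let ?l = "chart_force \<Sigma>\<^sub>1 j (cmap N j ?y)" and ?g = "field \<Sigma>' 0 ?y j"
  \<comment> \<open>These are the terms of degree two in the velocity: the second fundamental form
    of \<Phi>, which measures how far it is from being affine.\<close>
  let ?B = "\<lambda>a b. ?D2 a b - ?D (conn \<Sigma> i q a b) + conn \<Sigma>' j ?y (?D a) (?D b)"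
  have so': "second_order (cmap N\<^sub>1 j ` cdom N\<^sub>1 j) (\<lambda>a. conn \<Sigma>' j (cinv N\<^sub>1 j a)) (\<lambda>a. field \<Sigma>' 0 (cinv N\<^sub>1 j a) j) (chart_force \<Sigma>\<^sub>1 j)"
    using second_order_chart[OF mech1, of j] by (simp only: restrict_system_simps)
  have yA: "cmap N j ?y \<in> cmap N\<^sub>1 j ` cdom N\<^sub>1 j" using imageI[OF yN, of "cmap N j"] by simp
  have linl: "linear ?l" by (rule second_order.l[OF so' yA])
  have eq: "?B w w = ?l (?D w) + ?g" if w: "w \<in> ball (v i) r" for w
  proof -
    have z: "(?x, w) \<in> \<Omega> i j" using box x w by blast
    then obtain q' v' where q': "(q', v') \<in> U" "q' \<in> cdom M i" "(?x, w) = (cmap M i q', v' i)" by (rule \<Omega>E)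
    have "q' = q" using inj_onD[OF diff_atlas_inj[OF Md, of i], of q' q] q' q(2) by simp
    have Sz: "S i (?x, w) = (w, - conn \<Sigma> i q w w)"
      using S_at[OF q'(1,2)] q'(3) \<open>q' = q\<close> by simp
    have lin2: "?D (- conn \<Sigma> i q w w) = - ?D (conn \<Sigma> i q w w)" by (rule linear_neg[OF lin])
    have 1: "snd (DF i j (?x, w) (S i (?x, w))) = ?D2 w w - ?D (conn \<Sigma> i q w w)"
      unfolding Sz DFxw[OF x w] lin2 by simp
    have 2: "snd (S' j (F i j (?x, w))) = - conn \<Sigma>' j ?y (?D w) (?D w) + ?g + ?l (?D w)"
      unfolding Fxw[OF x w] \<phi>x second_order.field_def[OF so'] by (simp only: prod.case snd_conv cy)
    have "?D2 w w - ?D (conn \<Sigma> i q w w) = - conn \<Sigma>' j ?y (?D w) (?D w) + ?g + ?l (?D w)"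
      unfolding 1[symmetric] 2[symmetric] spray_related[OF z] ..
    then show ?thesis by (simp add: algebra_simps)
  qed
  have D2: "linear (\<lambda>a. ?D2 a b)" for b
    by (rule linear_frechet_derivative[OF real_analytic_on_differentiable[OF real_analytic_on_deriv_const[OF an open_ball] x]])
  \<comment> \<open>Symmetry of the second derivative transfers linearity from one argument to the
    other.\<close>
  have D2': "linear (\<lambda>b. ?D2 a b)" for a
    using D2[of a] unfolding frechet_derivative_commute[OF an open_ball x, of a] .
  note G1 = bilinear_linear[OF connection_bilinear[OF \<Gamma> q(2)]]
  note G2 = bilinear_linear[OF connection_bilinear[OF \<Gamma>1 yN]]
  have bil: "bilinear ?B"
  proof -
    have l: "linear (\<lambda>b. ?D (conn \<Sigma> i q a b))" "linear (\<lambda>b. ?D (conn \<Sigma> i q b a))" for a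
      using linear_compose[OF G1(2) lin, of a] linear_compose[OF G1(1) lin, of a] by (simp_all only: o_def)
    have l': "linear (\<lambda>b. conn \<Sigma>' j ?y (?D a) (?D b))" "linear (\<lambda>b. conn \<Sigma>' j ?y (?D b) (?D a))" for a
      using linear_compose[OF lin G2(2), of "?D a"] linear_compose[OF lin G2(1), of "?D a"] by (simp_all only: o_def)
    show ?thesis
      unfolding bilinear_def
      by (intro conjI allI linear_compose_add[OF linear_compose_sub[OF D2' l(1)] l'(1)]
          linear_compose_add[OF linear_compose_sub[OF D2 l(2)] l'(2)])
  qed
  have linlD: "linear (\<lambda>w. ?l (?D w))" using linear_compose[OF lin linl] by (simp only: o_def)
  show "?g = 0" by (rule quadratic_vanishes(2)[OF bil linlD r eq])
  \<comment> \<open>The polynomial identity controls the force only on velocities of the form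
    \<open>?D w\<close>; surjectivity makes these all velocities.\<close>
  have "u \<in> range ?D" unfolding D\<phi>_surj[OF q] by (rule UNIV_I)
  then obtain w where w: "u = ?D w" by (rule rangeE)
  show "?l u = 0" unfolding w by (rule quadratic_vanishes(1)[OF bil linlD r eq])
qed

section \<open>The quotient has no forces and is geodesically accessible\<close>

lemma V1E:
  assumes "y \<in> V\<^sub>1"
  obtains q v where "(q, v) \<in> U" "fst (\<tau> (q, v)) = y"
proof -
  obtain p where p: "p \<in> V" "y = fst p" using assms by (rule imageE)
  have "p \<in> \<tau> ` U" using p(1) unfolding \<tau>_image .
  then obtain x where "p = \<tau> x" "x \<in> U" by (rule imageE)
  then show ?thesis using that[of "fst x" "snd x"] p(2) by simp
qed

lemma acs1: "affine_connection_control_system \<Sigma>\<^sub>1"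
  unfolding affine_connection_control_system_def
proof (intro conjI ballI)
  show "mechanical_control_system \<Sigma>\<^sub>1" by (rule mech1)
next
  fix y assume y: "y \<in> points (base \<Sigma>\<^sub>1)"
  then have "y \<in> V\<^sub>1" by (simp add: points_submanifold)
  then obtain q v where q: "(q, v) \<in> U" "fst (\<tau> (q, v)) = y" by (rule V1E)
  obtain i where i: "q \<in> cdom M i" using UD(1)[OF q(1)] by (auto simp: points_iff)
  have y': "y \<in> points N\<^sub>1" using y by simp
  have X: "field \<Sigma>' 0 y \<in> tangent_space N\<^sub>1 y" using vector_field_in[OF Xr'[of 0] y'] by simp
  \<comment> \<open>Components in charts that do not contain \<open>y\<close> are zero by the
    representation of tangent vectors.\<close>
  have "field \<Sigma>' 0 y j = 0" for j
  proof (cases "y \<in> cdom N j")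
    case True then show ?thesis using forces_vanish(1)[OF q(1) i, of j] q(2) by simp
  next
    case False then show ?thesis using tangent_spaceD(1)[OF X, of j] by simp
  qed
  then show "field \<Sigma>\<^sub>1 0 y = (\<lambda>i. 0)" by auto
  fix w assume "w \<in> tangent_space (base \<Sigma>\<^sub>1) y"
  then have w: "w \<in> tangent_space N\<^sub>1 y" by simp
  have fl: "fiberwise_linear N\<^sub>1 (fibermap \<Sigma>')" using mech1 by (simp add: mechanical_control_system_def)
  have "snd (fibermap \<Sigma>' (y, w)) j = 0" for j
  proof (cases "y \<in> cdom N j")
    case True
    have yj: "y \<in> cdom N\<^sub>1 j" using True \<open>y \<in> V\<^sub>1\<close> by simp
    have cy: "cinv N\<^sub>1 j (cmap N j y) = y" using cinv_cmap[OF N1d yj] by simp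
    have "chart_force \<Sigma>\<^sub>1 j (cmap N j y) (w j) = snd (fibermap \<Sigma>' (y, w)) j"
      unfolding chart_force_def restrict_system_simps cy tvec_self[OF N1d yj w] ..
    then show ?thesis using forces_vanish(2)[OF q(1) i, of j "w j"] True unfolding q(2) by simp
  next
    case False then show ?thesis using tangent_spaceD(1)[OF fiberwise_linearD(2)[OF fl y' w], of j] by simp
  qed
  then show "fibermap \<Sigma>\<^sub>1 (y, w) = (y, \<lambda>i. 0)"
    using fiberwise_linearD(1)[OF fl y' w] by (intro prod_eqI) auto
qed

text \<open>Constants are analytic functions, so the values of \<open>Sym\<close> at a point, read
  in one chart, form a subspace. It contains the values of the iterated products, which span
  everything by \<open>span_E'\<close>.\<close>

lemma ga1: "geodesically_accessible \<Sigma>\<^sub>1"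
  unfolding geodesically_accessible_def
proof
  fix y assume "y \<in> points (base \<Sigma>\<^sub>1)"
  then have y: "y \<in> points N\<^sub>1" by simp
  then obtain j where j: "y \<in> cdom N\<^sub>1 j" by (auto simp: points_iff)
  let ?Sym = "Sym N\<^sub>1 (conn \<Sigma>') G'"
  have "X y \<in> tangent_space N\<^sub>1 y" if "X \<in> ?Sym" for X
  proof -
    have ms: "module_span N\<^sub>1 E' X" by (rule Sym_module_span[OF N1a \<Gamma>1 _ that]) (use Xr' in auto)
    have "vector_field N\<^sub>1 X" by (rule module_span_vector_field[where E = E', OF N1a E'_vf ms])
    then show ?thesis using y by (rule vector_field_in)
  qed
  moreover have "v \<in> (\<lambda>X. X y) ` ?Sym" if v: "v \<in> tangent_space N\<^sub>1 y" for v
  proof -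
    let ?W = "{u. \<exists>X\<in>?Sym. X y j = u}"
    have "subspace ?W"
    proof (rule subspaceI)
      show "0 \<in> ?W" using Sym_0[of N\<^sub>1 "conn \<Sigma>'" G'] by (intro CollectI bexI[of _ "\<lambda>q i. 0"]) simp_all
      show "a + b \<in> ?W" if ab: "a \<in> ?W" "b \<in> ?W" for a b
      proof -
        obtain X Y where "X \<in> ?Sym" "Y \<in> ?Sym" "X y j = a" "Y y j = b" using ab by blast
        then show ?thesis by (intro CollectI bexI[of _ "\<lambda>q i. X q i + Y q i"] Sym_add) simp_all
      qed
      show "c *\<^sub>R a \<in> ?W" if aW: "a \<in> ?W" for c a
      proof -
        obtain X where "X \<in> ?Sym" "X y j = a" using aW by blast
        then show ?thesis
          by (intro CollectI bexI[of _ "\<lambda>q i. c *\<^sub>R X q i"] Sym_scale[OF analytic_function_const]) simp_all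
      qed
    qed
    then have "span ((\<lambda>X'. X' y j) ` E') \<subseteq> ?W"
      by (rule span_minimal[rotated]) (use iterated_products_Sym in blast)
    moreover have "span ((\<lambda>X'. X' y j) ` E') = UNIV" using j by (intro span_E') auto
    ultimately obtain X where X: "X \<in> ?Sym" "X y j = v j" by blast
    have "X y = v" 
      by (rule tangent_space_eqI[where M = N\<^sub>1 and q = y and i = j])
        (use v j X \<open>\<And>X. X \<in> ?Sym \<Longrightarrow> X y \<in> tangent_space N\<^sub>1 y\<close> in auto)
    then show ?thesis using X(1) by blast
  qed
  ultimately have "(\<lambda>X. X y) ` ?Sym = tangent_space N\<^sub>1 y" by blast
  then show "(\<lambda>X. X y) ` Sym (base \<Sigma>\<^sub>1) (conn \<Sigma>\<^sub>1) (field \<Sigma>\<^sub>1 ` {1..inputs \<Sigma>\<^sub>1}) = tangent_space (base \<Sigma>\<^sub>1) y"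
    by (simp add: inputs')
qed

text \<open>The form with an arbitrary \<open>U\<^sub>0\<close> serves twice: for a small
  neighbourhood of a point, and for \<open>U\<close> itself when its fibres are connected. Near each
  point \<Phi> is a slice of \<tau> in charts, so its analyticity and derivative come from the box
  lemmas.\<close>

lemma is_tangent_map:
  assumes oU0: "openin (mtop (TQ \<Sigma>)) U\<^sub>0" and sub: "U\<^sub>0 \<subseteq> U"
    and const: "\<And>q v w. (q, v) \<in> U\<^sub>0 \<Longrightarrow> (q, w) \<in> U\<^sub>0 \<Longrightarrow> fst (\<tau> (q, v)) = fst (\<tau> (q, w))"
  shows "is_tangent_map_of_submersion M N U\<^sub>0 (fst ` U\<^sub>0) V\<^sub>1 \<tau>"
proof -
  let ?U1 = "fst ` U\<^sub>0"
  let ?P = "submanifold M ?U1"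
  \<comment> \<open>The selected vector is immaterial by \<open>const\<close>.\<close>
  define \<Phi> where "\<Phi> = (\<lambda>q. fst (\<tau> (q, SOME v. (q, v) \<in> U\<^sub>0)))"
  have \<Phi>: "\<Phi> q = fst (\<tau> (q, v))" if "(q, v) \<in> U\<^sub>0" for q v
    unfolding \<Phi>_def by (rule const[OF someI[of "\<lambda>v. (q, v) \<in> U\<^sub>0", OF that] that])
  have oU1: "openin (mtop M) ?U1" by (rule openin_fst_image[OF Ma oU0])
  note Pd = diff_atlas_submanifold[OF Md oU1]
  have \<Phi>V: "\<Phi> q \<in> V\<^sub>1" if "(q, v) \<in> U\<^sub>0" for q v using \<Phi>[OF that] \<tau>V sub that by auto
  \<comment> \<open>Choosing the box inside the chart image of \<open>U\<^sub>0\<close> ensures that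
    every base point in it lies in the domain of \<Phi>.\<close>
  have loc: "\<exists>r. tangent_box i j q v r \<and>
      (\<forall>x\<in>ball (cmap M i q) r. x \<in> cmap M i ` (cdom M i \<inter> ?U1) \<and> (cmap N j \<circ> \<Phi> \<circ> cinv ?P i) x = \<phi> i j (v i) x)"
    if q: "(q, v) \<in> U\<^sub>0" "q \<in> cdom M i" "\<Phi> q \<in> cdom N j" for q v i j
  proof -
    let ?Z = "cmap (TQ \<Sigma>) i ` (U\<^sub>0 \<inter> cdom (TQ \<Sigma>) i)"
    have Z: "open ?Z" by (rule open_chart_image(1)[OF TMd oU0])
    have qU: "(q, v) \<in> U" using q(1) sub by blast
    have "(q, v) \<in> U\<^sub>0 \<inter> cdom (TQ \<Sigma>) i" using q UD(2)[OF qU] by (simp add: cdom_tangent_bundle)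
    then have zZ: "(cmap M i q, v i) \<in> ?Z" unfolding cmap_tangent_bundle[symmetric] by (rule imageI)
    have "fst (\<tau> (q, v)) \<in> cdom N j" using q(3) unfolding \<Phi>[OF q(1)] .
    from tangent_box_exists[OF qU q(2) this Z zZ]
    obtain r where b: "tangent_box i j q v r" and box: "ball (cmap M i q) r \<times> ball (v i) r \<subseteq> ?Z" .
    have "x \<in> cmap M i ` (cdom M i \<inter> ?U1) \<and> (cmap N j \<circ> \<Phi> \<circ> cinv ?P i) x = \<phi> i j (v i) x"
      if x: "x \<in> ball (cmap M i q) r" for x
    proof -
      have "(x, v i) \<in> ?Z" using box x tangent_boxD(4)[OF b] by blast
      then obtain p where "p \<in> U\<^sub>0" "p \<in> cdom (TQ \<Sigma>) i" "(x, v i) = cmap (TQ \<Sigma>) i p" by blast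
      then obtain q' v' where q': "(q', v') \<in> U\<^sub>0" "q' \<in> cdom M i" "x = cmap M i q'" "v i = v' i"
        by (cases p) (auto simp: cdom_tangent_bundle cmap_tangent_bundle)
      have qU': "(q', v') \<in> U" using q'(1) sub by blast
      have "q' \<in> ?U1" using q'(1) by force
      then have "cinv ?P i x = q'" using q'(2,3) cinv_submanifold[OF Md q'(2)] by simp
      then show ?thesis
        using F_at[OF qU' q'(2), of j] \<Phi>[OF q'(1)] q'(2-4) \<open>q' \<in> ?U1\<close> by auto
    qed
    then show ?thesis using b by blast
  qed
  have rep: "\<exists>T. open T \<and> cmap M i q \<in> T \<and> real_analytic_on (cmap N j \<circ> \<Phi> \<circ> cinv ?P i) T"
    and repD: "frechet_derivative (cmap N j \<circ> \<Phi> \<circ> cinv ?P i) (at (cmap M i q)) = D\<phi> i j q v"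
    if q: "(q, v) \<in> U\<^sub>0" "q \<in> cdom M i" "\<Phi> q \<in> cdom N j" for q v i j
  proof -
    obtain r where b: "tangent_box i j q v r"
      and al: "\<forall>x\<in>ball (cmap M i q) r. x \<in> cmap M i ` (cdom M i \<inter> ?U1) \<and>
        (cmap N j \<circ> \<Phi> \<circ> cinv ?P i) x = \<phi> i j (v i) x"
      using loc[OF q] by (elim exE conjE)
    have eq: "\<phi> i j (v i) x = (cmap N j \<circ> \<Phi> \<circ> cinv ?P i) x" if "x \<in> ball (cmap M i q) r" for x
      using bspec[OF al that] by (simp only:)
    have "real_analytic_on (cmap N j \<circ> \<Phi> \<circ> cinv ?P i) (ball (cmap M i q) r)"
      by (rule real_analytic_on_cong[OF tangent_box_analytic[OF b] open_ball eq])
    then show "\<exists>T. open T \<and> cmap M i q \<in> T \<and> real_analytic_on (cmap N j \<circ> \<Phi> \<circ> cinv ?P i) T"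
      using tangent_boxD(3)[OF b] open_ball by blast
    show "frechet_derivative (cmap N j \<circ> \<Phi> \<circ> cinv ?P i) (at (cmap M i q)) = D\<phi> i j q v"
      by (rule frechet_derivative_cong_open[OF open_ball tangent_boxD(3)[OF b], symmetric]) (rule eq)
  qed
  \<comment> \<open>The preimage of \<open>W\<close> under \<Phi> is the projection of the part of
    \<open>U\<^sub>0\<close> that \<tau> sends over \<open>W\<close>; this part is open, and
    projections of open sets are open.\<close>
  have contP: "continuous_map (mtop ?P) (mtop N\<^sub>1) \<Phi>"
    unfolding continuous_map_def
  proof (intro conjI allI impI)
    have "\<Phi> q \<in> topspace (mtop N\<^sub>1)" if qt: "q \<in> topspace (mtop ?P)" for q
    proof -
      obtain v where v: "(q, v) \<in> U\<^sub>0" using qt by (auto simp: topspace_mtop points_submanifold)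
      show ?thesis unfolding \<Phi>[OF v] topspace_mtop by (rule VD(3)[OF \<tau>V[OF subsetD[OF sub v]]])
    qed
    then show "\<Phi> \<in> topspace (mtop ?P) \<rightarrow> topspace (mtop N\<^sub>1)" by blast
    fix W assume "openin (mtop N\<^sub>1) W"
    then have W: "openin (mtop N) W" unfolding mtop_submanifold openin_open_subtopology[OF oV1] by blast
    have "openin (mtop (submanifold (TQ \<Sigma>') V)) (points (TQ \<Sigma>') \<inter> fst -` W \<inter> V)"
      unfolding mtop_submanifold by (rule openin_subtopology_Int[OF openin_fst_vimage[OF Na W]])
    then have "openin (mtop (submanifold (TQ \<Sigma>) U))
        {p \<in> topspace (mtop (submanifold (TQ \<Sigma>) U)). \<tau> p \<in> points (TQ \<Sigma>') \<inter> fst -` W \<inter> V}" (is "openin _ ?A")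
      by (rule openin_continuous_map_preimage[OF cont_\<tau>])
    then have "openin (mtop (TQ \<Sigma>)) ?A"
      unfolding mtop_submanifold openin_open_subtopology[OF oU] by blast
    then have o: "openin (mtop M) (fst ` (?A \<inter> U\<^sub>0))" by (intro openin_fst_image[OF Ma] openin_Int oU0)
    have "fst ` (?A \<inter> U\<^sub>0) = {q \<in> topspace (mtop ?P). \<Phi> q \<in> W}"
    proof (rule set_eqI)
      fix q
      have "p \<in> ?A \<longleftrightarrow> \<Phi> (fst p) \<in> W" if "p \<in> U\<^sub>0" for p
        using that sub U_points V_points \<tau>V[of p] \<Phi>[of "fst p" "snd p"]
        by (auto simp: topspace_mtop points_submanifold)
      then have "q \<in> fst ` (?A \<inter> U\<^sub>0) \<longleftrightarrow> q \<in> ?U1 \<and> \<Phi> q \<in> W" by auto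
      moreover have "?U1 \<subseteq> points M" using openin_subset[OF oU1] by (simp add: topspace_mtop)
      ultimately show "q \<in> fst ` (?A \<inter> U\<^sub>0) \<longleftrightarrow> q \<in> {q \<in> topspace (mtop ?P). \<Phi> q \<in> W}"
        by (auto simp: topspace_mtop points_submanifold)
    qed
    then show "openin (mtop ?P) {q \<in> topspace (mtop ?P). \<Phi> q \<in> W}"
      using o unfolding mtop_submanifold[of M] openin_open_subtopology[OF oU1] by auto
  qed
  have diff: "(cmap N\<^sub>1 j \<circ> \<Phi> \<circ> cinv ?P i) differentiable at (cmap ?P i q)"
    if q: "(q, v) \<in> U\<^sub>0" "q \<in> cdom M i" "\<Phi> q \<in> cdom N j" for q v i j
  proof -
    obtain T where "cmap M i q \<in> T" "real_analytic_on (cmap N j \<circ> \<Phi> \<circ> cinv ?P i) T" using rep[OF q] by blast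
    then show ?thesis unfolding submanifold_simps(2) by (intro real_analytic_on_differentiable)
  qed
  have tm_chart: "snd (tangent_map ?P N\<^sub>1 \<Phi> (q, w)) j = D\<phi> i j q v (w i)"
    if q: "(q, v) \<in> U\<^sub>0" "q \<in> cdom M i" "\<Phi> q \<in> cdom N j" and w: "w \<in> tangent_space ?P q" for q v w i j
  proof -
    have qP: "q \<in> cdom ?P i" using q by force
    have j: "\<Phi> q \<in> cdom N\<^sub>1 j" using q \<Phi>V[OF q(1)] by simp
    have "snd (tangent_map ?P N\<^sub>1 \<Phi> (q, w)) j =
       frechet_derivative (cmap N\<^sub>1 j \<circ> \<Phi> \<circ> cinv ?P i) (at (cmap ?P i q)) (w i)"
      by (rule tangent_map_chart[OF Pd qP w j diff[OF q]])
    then show ?thesis using fun_cong[OF repD[OF q], of "w i"] by (simp del: o_apply)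
  qed
  have tm_in: "snd (tangent_map ?P N\<^sub>1 \<Phi> (q, w)) \<in> tangent_space N\<^sub>1 (\<Phi> q)"
    if q: "(q, v) \<in> U\<^sub>0" and w: "w \<in> tangent_space ?P q" for q v w
  proof -
    have qU: "(q, v) \<in> U" using q sub by blast
    obtain i where i: "q \<in> cdom M i" using UD(1)[OF qU] by (auto simp: points_iff)
    have qP: "q \<in> cdom ?P i" using q i by force
    show ?thesis
      by (rule tangent_map_in[OF Pd N1d qP w diff[OF q i] contP]) simp
  qed
  have "submersion ?P N\<^sub>1 \<Phi>"
    unfolding submersion_def
  proof (intro conjI ballI)
    show "analytic_map ?P N\<^sub>1 \<Phi>"
      unfolding analytic_map_def
    proof (intro conjI allI contP)
      fix i j
      show "real_analytic_on (cmap N\<^sub>1 j \<circ> \<Phi> \<circ> cinv ?P i) (cmap ?P i ` (cdom ?P i \<inter> \<Phi> -` cdom N\<^sub>1 j))"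
      proof (rule real_analytic_on_locally)
        fix a assume "a \<in> cmap ?P i ` (cdom ?P i \<inter> \<Phi> -` cdom N\<^sub>1 j)"
        then obtain q v where q: "(q, v) \<in> U\<^sub>0" "q \<in> cdom M i" "\<Phi> q \<in> cdom N j" "a = cmap M i q" by auto
        show "\<exists>T. open T \<and> a \<in> T \<and> (\<exists>g. real_analytic_on g T \<and> (\<forall>x\<in>T. g x = (cmap N\<^sub>1 j \<circ> \<Phi> \<circ> cinv ?P i) x))"
        proof -
          obtain T where "open T" "a \<in> T" "real_analytic_on (cmap N j \<circ> \<Phi> \<circ> cinv ?P i) T"
            using rep[OF q(1-3)] unfolding q(4) by blast
          then show ?thesis unfolding submanifold_simps(2)[of N]
            by (intro exI[of _ T] exI[of _ "cmap N j \<circ> \<Phi> \<circ> cinv ?P i"] conjI ballI refl)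
        qed
      qed
    qed
    fix q assume "q \<in> points ?P"
    then obtain v where v: "(q, v) \<in> U\<^sub>0" by (auto simp: points_submanifold)
    have vU: "(q, v) \<in> U" using v sub by blast
    obtain i where i: "q \<in> cdom M i" using UD(1)[OF vU] by (auto simp: points_iff)
    have qP: "q \<in> cdom ?P i" using v i by force
    show "(\<lambda>v. snd (tangent_map ?P N\<^sub>1 \<Phi> (q, v))) ` tangent_space ?P q = tangent_space N\<^sub>1 (\<Phi> q)"
    proof
      show "(\<lambda>v. snd (tangent_map ?P N\<^sub>1 \<Phi> (q, v))) ` tangent_space ?P q \<subseteq> tangent_space N\<^sub>1 (\<Phi> q)"
        using tm_in[OF v] by blast
      show "tangent_space N\<^sub>1 (\<Phi> q) \<subseteq> (\<lambda>v. snd (tangent_map ?P N\<^sub>1 \<Phi> (q, v))) ` tangent_space ?P q"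
      proof
        fix u assume u: "u \<in> tangent_space N\<^sub>1 (\<Phi> q)"
        have "\<Phi> q \<in> points N\<^sub>1" unfolding \<Phi>[OF v] by (rule VD(3)[OF \<tau>V[OF vU]])
        then obtain j where j: "\<Phi> q \<in> cdom N\<^sub>1 j" by (auto simp: points_iff)
        then have j': "\<Phi> q \<in> cdom N j" by simp
        have "range (D\<phi> i j q v) = UNIV" using j' unfolding \<Phi>[OF v] by (rule D\<phi>_surj[OF vU i])
        then have "u j \<in> range (D\<phi> i j q v)" by (rule ssubst) (rule UNIV_I)
        then obtain \<xi> where \<xi>: "D\<phi> i j q v \<xi> = u j" by (metis rangeE)
        let ?w = "tvec ?P i q \<xi>"
        have w: "?w \<in> tangent_space ?P q" by (rule tvec_in[OF Pd qP])
        have "snd (tangent_map ?P N\<^sub>1 \<Phi> (q, ?w)) = u"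
          by (rule tangent_space_eqI[OF tm_in[OF v w] u j])
            (simp only: tm_chart[OF v i j' w] tvec_at[OF Pd qP] \<xi>)
        then show "u \<in> (\<lambda>v. snd (tangent_map ?P N\<^sub>1 \<Phi> (q, v))) ` tangent_space ?P q" using w by blast
      qed
    qed
  qed
  moreover have "\<tau> p = tangent_map ?P N\<^sub>1 \<Phi> p" if p: "p \<in> U\<^sub>0" for p
  proof -
    obtain q v where pq: "p = (q, v)" by (cases p)
    have v: "(q, v) \<in> U\<^sub>0" "(q, v) \<in> U" using p pq sub by auto
    have y: "\<Phi> q = fst (\<tau> (q, v))" by (rule \<Phi>[OF v(1)])
    obtain i where i: "q \<in> cdom M i" using UD(1)[OF v(2)] by (auto simp: points_iff)
    have "\<Phi> q \<in> points N\<^sub>1" unfolding y by (rule VD(3)[OF \<tau>V[OF v(2)]])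
    then obtain j where j: "\<Phi> q \<in> cdom N\<^sub>1 j" by (auto simp: points_iff)
    then have j': "\<Phi> q \<in> cdom N j" by simp
    have "q \<in> ?U1" using v(1) by force
    then have w: "v \<in> tangent_space ?P q" using UD(2)[OF v(2)] tangent_space_submanifold[OF Md oU1] by simp
    have \<tau>T: "snd (\<tau> (q, v)) \<in> tangent_space N\<^sub>1 (\<Phi> q)" unfolding y by (rule VD(4)[OF \<tau>V[OF v(2)]])
    have "D\<phi> i j q v (v i) = snd (\<tau> (q, v)) j" using j' unfolding y by (rule D\<phi>_velocity[OF v(2) i])
    then have "snd (tangent_map ?P N\<^sub>1 \<Phi> (q, v)) = snd (\<tau> (q, v))"
      by (intro tangent_space_eqI[OF tm_in[OF v(1) w] \<tau>T j]) (simp only: tm_chart[OF v(1) i j' w])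
    then show ?thesis unfolding pq by (intro prod_eqI) (simp_all add: y[symmetric] tangent_map_def)
  qed
  ultimately show ?thesis
    unfolding is_tangent_map_of_submersion_def by (intro conjI exI[of _ \<Phi>] ballI oU1 oV1 refl)
qed

text \<open>\<open>U\<^sub>0\<close> is the part of the tangent bundle over a box: there the base
  component of \<tau> depends on the base point alone, and the target chart is injective.\<close>

lemma locally_tangent_map:
  assumes p: "(q\<^sub>0, v\<^sub>0) \<in> U"
  obtains U\<^sub>0 where "openin (mtop (TQ \<Sigma>)) U\<^sub>0" "(q\<^sub>0, v\<^sub>0) \<in> U\<^sub>0" "U\<^sub>0 \<subseteq> U"
    "is_tangent_map_of_submersion M N U\<^sub>0 (fst ` U\<^sub>0) V\<^sub>1 \<tau>"
proof -
  obtain i where i: "q\<^sub>0 \<in> cdom M i" using UD(1)[OF p] by (auto simp: points_iff)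
  obtain j where j: "fst (\<tau> (q\<^sub>0, v\<^sub>0)) \<in> cdom N j" using VD(1)[OF \<tau>V[OF p]] by (auto simp: points_iff)
  obtain r where b: "tangent_box i j q\<^sub>0 v\<^sub>0 r" using p i j by (rule tangent_box_exists')
  let ?B = "ball (cmap M i q\<^sub>0) r \<times> ball (v\<^sub>0 i) r"
  let ?U0 = "cdom (TQ \<Sigma>) i \<inter> cmap (TQ \<Sigma>) i -` ?B"
  have o: "openin (mtop (TQ \<Sigma>)) ?U0" by (intro openin_chart_preimage open_Times open_ball)
  have in0: "(q\<^sub>0, v\<^sub>0) \<in> ?U0" using tangent_boxD(3,4)[OF b] i UD(2)[OF p] by (simp add: cdom_tangent_bundle cmap_tangent_bundle)
  have sub\<Omega>: "p' \<in> U \<and> fst (\<tau> p') \<in> cdom N j" if "p' \<in> ?U0" for p'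
  proof -
    have "cmap (TQ \<Sigma>) i p' \<in> ?B" using that by simp
    then have "cmap (TQ \<Sigma>) i p' \<in> \<Omega> i j" by (rule subsetD[OF tangent_boxD(2)[OF b]])
    then obtain p'' where "cmap (TQ \<Sigma>) i p' = cmap (TQ \<Sigma>) i p''"
        "p'' \<in> cdom (TQ \<Sigma>) i \<inter> U \<inter> \<tau> -` (cdom (TQ \<Sigma>') j \<inter> V)"
      unfolding \<Omega>_alt by (rule imageE)
    then have p'': "p'' \<in> cdom (TQ \<Sigma>) i" "p'' \<in> U" "\<tau> p'' \<in> cdom (TQ \<Sigma>') j"
        "cmap (TQ \<Sigma>) i p' = cmap (TQ \<Sigma>) i p''" by simp_all
    have "p' = p''" by (rule inj_onD[OF diff_atlas_inj[OF TMd] p''(4)]) (use that p''(1) in simp_all)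
    then show ?thesis using p''(2,3) \<tau>_cdom[OF p''(2)] by simp
  qed
  have subU: "?U0 \<subseteq> U"
  proof
    fix p' assume "p' \<in> ?U0"
    from sub\<Omega>[OF this] show "p' \<in> U" by (rule conjunct1)
  qed
  have "is_tangent_map_of_submersion M N ?U0 (fst ` ?U0) V\<^sub>1 \<tau>"
  proof (rule is_tangent_map[OF o subU])
    have F1: "cmap N j (fst (\<tau> (q, v))) = \<phi> i j (v\<^sub>0 i) (cmap M i q)" if "(q, v) \<in> ?U0" for q v
    proof -
      have q: "q \<in> cdom M i" "cmap M i q \<in> ball (cmap M i q\<^sub>0) r" "v i \<in> ball (v\<^sub>0 i) r"
        using that by (simp_all add: cdom_tangent_bundle cmap_tangent_bundle)
      have "F i j (cmap M i q, v i) = (cmap N j (fst (\<tau> (q, v))), snd (\<tau> (q, v)) j)"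
        by (rule F_at[OF conjunct1[OF sub\<Omega>[OF that]] q(1)])
      then show ?thesis using tangent_box_F[OF b q(2,3)] by (simp del: o_apply)
    qed
    show "fst (\<tau> (q, v)) = fst (\<tau> (q, w))" if "(q, v) \<in> ?U0" "(q, w) \<in> ?U0" for q v w
      by (rule inj_onD[OF diff_atlas_inj[OF Nd] trans[OF F1[OF that(1)] F1[OF that(2), symmetric]]
            conjunct2[OF sub\<Omega>[OF that(1)]] conjunct2[OF sub\<Omega>[OF that(2)]]])
  qed
  then show ?thesis by (rule that[OF o in0 subU])
qed

text \<open>The boxes show that the base component is locally constant along a fibre, and a locally
  constant function on a connected set is constant.\<close>

lemma fibrewise_constant:
  assumes C: "connected_fibers M U" and q: "(q, v) \<in> U" "(q, w) \<in> U"
  shows "fst (\<tau> (q, v)) = fst (\<tau> (q, w))"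
proof -
  obtain i where i: "q \<in> cdom M i" using UD(1)[OF q(1)] by (auto simp: points_iff)
  let ?C = "{p \<in> U. fst p = q}"
  let ?X = "subtopology (mtop (TQ \<Sigma>)) (cdom (TQ \<Sigma>) i)"
  have Cc: "?C \<subseteq> cdom (TQ \<Sigma>) i" using UD(2) i by (auto simp: cdom_tangent_bundle)
  \<comment> \<open>Connectedness is assumed in the manifold topology and has to be carried to the
    model space by the chart.\<close>
  have "continuous_map ?X euclidean (cmap (TQ \<Sigma>) i)"
    unfolding continuous_map_def
  proof (intro conjI allI impI)
    fix W :: "('e \<times> 'e) set" assume "openin euclidean W"
    then have "openin (mtop (TQ \<Sigma>)) (cdom (TQ \<Sigma>) i \<inter> cmap (TQ \<Sigma>) i -` W)"
      by (intro openin_chart_preimage) simp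
    moreover have "{x \<in> topspace ?X. cmap (TQ \<Sigma>) i x \<in> W} = cdom (TQ \<Sigma>) i \<inter> cmap (TQ \<Sigma>) i -` W"
      using openin_subset[OF openin_cdom[of "TQ \<Sigma>" i]] by auto
    ultimately show "openin ?X {x \<in> topspace ?X. cmap (TQ \<Sigma>) i x \<in> W}"
      unfolding openin_open_subtopology[OF openin_cdom] by simp
  qed simp
  moreover have "connectedin ?X ?C"
    using C UD(1)[OF q(1)] Cc unfolding connected_fibers_def connectedin_subtopology by blast
  ultimately have "connectedin euclidean (cmap (TQ \<Sigma>) i ` ?C)" by (rule connectedin_continuous_map_image)
  then have "connected (snd ` cmap (TQ \<Sigma>) i ` ?C)"
    by (intro connected_continuous_image continuous_on_snd continuous_on_id) (simp add: connectedin_iff_connected)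
  moreover have "snd ` cmap (TQ \<Sigma>) i ` ?C = (\<lambda>v. v i) ` {v. (q, v) \<in> U}"
    by (force simp: cmap_tangent_bundle image_iff)
  ultimately have conn: "connected ((\<lambda>v. v i) ` {v. (q, v) \<in> U})" by simp
  define h where "h = (\<lambda>u. fst (\<tau> (q, tvec M i q u)))"
  have tv: "tvec M i q (v i) = v" if "(q, v) \<in> U" for v by (rule tvec_self[OF Md i UD(2)[OF that]])
  have "h (v i) = h (w i)"
  proof (rule connected_local_const[OF conn])
    show "\<forall>a\<in>(\<lambda>v. v i) ` {v. (q, v) \<in> U}. \<forall>\<^sub>F b in at a within (\<lambda>v. v i) ` {v. (q, v) \<in> U}. h a = h b"
    proof
      fix a assume "a \<in> (\<lambda>v. v i) ` {v. (q, v) \<in> U}"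
      then obtain v where v: "(q, v) \<in> U" "a = v i" by blast
      obtain j where j: "fst (\<tau> (q, v)) \<in> cdom N j" using VD(1)[OF \<tau>V[OF v(1)]] by (auto simp: points_iff)
      obtain r where b: "tangent_box i j q v r" using v(1) i j by (rule tangent_box_exists')
      have "h a = h b'" if b': "b' \<in> ball a r" for b'
      proof -
        \<comment> \<open>The box lies in \<open>\<Omega> i j\<close>, so every component in the
          ball belongs to a vector of \<open>U\<close>, and injectivity of the chart places that
          vector over \<open>q\<close>.\<close>
        have "(cmap M i q, b') \<in> \<Omega> i j" using tangent_boxD(2,3)[OF b] b' v(2) by blast
        then obtain q' v' where q': "(q', v') \<in> U" "q' \<in> cdom M i" "fst (\<tau> (q', v')) \<in> cdom N j"
            "(cmap M i q, b') = (cmap M i q', v' i)" by (rule \<Omega>E)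
        have "q' = q" using inj_onD[OF diff_atlas_inj[OF Md, of i], of q' q] q' i by simp
        then have v': "(q, v') \<in> U" "b' = v' i" "fst (\<tau> (q, v')) \<in> cdom N j" using q' by auto
        have "cmap N j (fst (\<tau> (q, v'))) = \<phi> i j (v i) (cmap M i q)"
          using tangent_box_F[OF b tangent_boxD(3)[OF b], of b'] F_at[OF v'(1) i, of j] b' v(2) v'(2) by (simp del: o_apply)
        moreover have "cmap N j (fst (\<tau> (q, v))) = \<phi> i j (v i) (cmap M i q)"
          using F_at[OF v(1) i, of j] by (simp del: o_apply)
        ultimately have "fst (\<tau> (q, v)) = fst (\<tau> (q, v'))"
          using inj_onD[OF diff_atlas_inj[OF Nd, of j]] j v'(3) by metis
        then show ?thesis unfolding h_def v(2) v'(2) tv[OF v(1)] tv[OF v'(1)] .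
      qed
      then show "\<forall>\<^sub>F b in at a within (\<lambda>v. v i) ` {v. (q, v) \<in> U}. h a = h b"
        unfolding eventually_at using tangent_boxD(1)[OF b] by (auto simp: dist_commute intro!: exI[of _ r])
    qed
  qed (use q in blast)+
  then show ?thesis unfolding h_def tv[OF q(1)] tv[OF q(2)] .
qed

end

theorem corollary3:
  fixes \<Sigma> :: "('i, 'a, 'e::euclidean_space) mechanical_data"
    and \<Sigma>' :: "('j, 'b, 'f::euclidean_space) mechanical_data"
    and x\<^sub>0 :: 'a and v\<^sub>0 :: "'i \<Rightarrow> 'e" and x\<^sub>0' :: 'b and v\<^sub>0' :: "'j \<Rightarrow> 'f"
    and U :: "('a \<times> ('i \<Rightarrow> 'e)) set" and V :: "('b \<times> ('j \<Rightarrow> 'f)) set"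
    and \<tau> :: "'a \<times> ('i \<Rightarrow> 'e) \<Rightarrow> 'b \<times> ('j \<Rightarrow> 'f)"
  assumes "affine_connection_control_system \<Sigma>"
    and "geodesically_accessible \<Sigma>"
    and "x\<^sub>0 \<in> points (base \<Sigma>)" and "v\<^sub>0 \<in> tangent_space (base \<Sigma>) x\<^sub>0"
    and "local_quotient \<Sigma> (x\<^sub>0, v\<^sub>0) \<Sigma>' (x\<^sub>0', v\<^sub>0') U V \<tau>"
  shows "\<exists>V\<^sub>1. openin (mtop (base \<Sigma>')) V\<^sub>1 \<and> x\<^sub>0' \<in> V\<^sub>1 \<and> V\<^sub>1 = fst ` V \<and>
     (\<exists>U\<^sub>0 U\<^sub>1. openin (mtop (TQ \<Sigma>)) U\<^sub>0 \<and> (x\<^sub>0, v\<^sub>0) \<in> U\<^sub>0 \<and> U\<^sub>0 \<subseteq> U \<and>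
        is_tangent_map_of_submersion (base \<Sigma>) (base \<Sigma>') U\<^sub>0 U\<^sub>1 V\<^sub>1 \<tau>) \<and>
     (connected_fibers (base \<Sigma>) U \<longrightarrow>
        (\<exists>U\<^sub>1. is_tangent_map_of_submersion (base \<Sigma>) (base \<Sigma>') U U\<^sub>1 V\<^sub>1 \<tau>)) \<and>
     affine_connection_control_system (restrict_system \<Sigma>' V\<^sub>1) \<and>
     geodesically_accessible (restrict_system \<Sigma>' V\<^sub>1)"
proof -
  interpret mechanical_quotient \<Sigma> \<Sigma>' "(x\<^sub>0, v\<^sub>0)" "(x\<^sub>0', v\<^sub>0')" U V \<tau>
    by unfold_locales fact+
  have p: "(x\<^sub>0, v\<^sub>0) \<in> U" "(x\<^sub>0', v\<^sub>0') \<in> V" using lq by (auto simp: local_quotient_def)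
  obtain U\<^sub>0 where "openin (mtop (TQ \<Sigma>)) U\<^sub>0" "(x\<^sub>0, v\<^sub>0) \<in> U\<^sub>0" "U\<^sub>0 \<subseteq> U"
      "is_tangent_map_of_submersion (base \<Sigma>) (base \<Sigma>') U\<^sub>0 (fst ` U\<^sub>0) (fst ` V) \<tau>"
    using p(1) by (rule locally_tangent_map)
  moreover have "x\<^sub>0' \<in> fst ` V" using p(2) by force
  moreover have "is_tangent_map_of_submersion (base \<Sigma>) (base \<Sigma>') U (fst ` U) (fst ` V) \<tau>"
    if "connected_fibers (base \<Sigma>) U"
    by (rule is_tangent_map[OF oU subset_refl fibrewise_constant[OF that]])
  ultimately show ?thesis using oV1 acs1 ga1 by blast
qed

end
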